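(* Let $n\ge 0$ be an integer and let $W$ be an interaction potential satisfying the standing assumptions below. Suppose that $W$ is $\frac{1}{n+1}$-periodic, that $2\widehat W(n+1)=1$, and that $$2\widehat W(k)\le \frac{n+1}{k}\qquad\text{for all integers } k\ge 1.$$ Then a phase transition occurs at the critical coupling strength $K_c=1=K_\#$, and this phase transition is continuous. Furthermore, if $K\le \frac12$, then the uniform distribution $q_u\equiv 1$ is the unique critical point of $\mathcal F_K$.
   Context: $\mathbb T=[-\frac12,\frac12)$ with periodic boundary conditions; $\mathcal P(\mathbb T)$ denotes Borel probability measures on $\mathbb T$, identified with their Lebesgue densities when absolutely continuous; $q_u\equiv 1$ is the uniform distribution. Fourier coefficients are $\widehat f(k)=\int_{\mathbb T} f(\theta)e^{-2\pi i k\theta}\,d\theta$. Standing assumptions on $W$: $W:\mathbb T\to\mathbb R$ is Borel measurable, even, with zero average, so that $W(\theta)=\sum_{k\ge1}2\widehat W(k)\cos(2\pi k\theta)$ with real $\widehat W(k)$. Let $\mathcal I_\pm=\{k\in\mathbb N:\pm\widehat W(k)>0\}$ and $W^{+}(\theta)=2\sum_{k\in\mathcal I_+}\widehat W(k)\cos(2\pi k\theta)$, $W^-=W^+-W$. Write $W^+=W^+_+-W^+_-$ with $W^+_\pm\ge0$ its positive and negative parts. It is assumed that for every $K\ge0$ there is $C_K\ge0$ with $\int\log q\,dq-K\iint W^+_+(\theta-\theta')\,dq(\theta)dq(\theta')\ge -C_K$ for all $q\in\mathcal P(\mathbb T)$, and that the interaction energy $q\mapsto\iint W(\theta-\theta')\,dq(\theta)dq(\theta')$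 is upper semicontinuous. Free energy: for $K\ge0$, $\mathcal F_K(q)=\int_{\mathbb T}\log q\,dq-K\iint_{\mathbb T\times\mathbb T}W(\theta-\theta')\,dq(\theta)dq(\theta')$ (equal to $+\infty$ if $q$ is not absolutely continuous), extended as the lower semicontinuous functional on $\mathcal P(\mathbb T)$. A critical point of $\mathcal F_K$ is a probability density $q$ solving the Kirkwood--Monroe equation $q=e^{2K(W*q)}/\int_{\mathbb T}e^{2K(W*q)}d\theta$. Phase transition: a number $K_c\ge0$ is the critical coupling if for $K<K_c$, $q_u$ is the unique global minimizer of $\mathcal F_K$; at $K=K_c$, $q_u$ is a global minimizer; for $K>K_c$ there is a global minimizer $q\neq q_u$. The phase transition is continuous if at $K=K_c$ the global minimizer is unique and for every family $\{q_K:K>K_c\}$ of global minimizers of $\mathcal F_K$, $\limsup_{K\to K_c^+}\|q_K-q_u\|_{L^1}=0$; otherwise it is discontinuous. The linear stability threshold of $q_u$ is $K_\#=\big(2\max_{k\in\mathcal I_+}\widehat W(k)\big)^{-1}$. *)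

theory Defs
  imports "HOL-Probability.Probability"
begin

text \<open>The torus T = [-1/2,1/2) with periodic boundary conditions. Functions on T are
  represented by their 1-periodic extensions to the real line; measures on T live on
  the measurable space of Borel subsets of [-1/2,1/2).\<close>

definition Tor :: "real set" where
  "Tor = {-1/2..<1/2}"

definition LT :: "real measure" where
  "LT = restrict_space lborel Tor"

definition PT :: "real measure set" where
  "PT = {\<mu>. prob_space \<mu> \<and> sets \<mu> = sets LT}"

definition is_density :: "(real \<Rightarrow> real) \<Rightarrow> bool" where
  "is_density q \<longleftrightarrow> q \<in> borel_measurable LT \<and> (AE x in LT. 0 \<le> q x)
      \<and> integrable LT q \<and> (\<integral>x. q x \<partial>LT) = 1"

definition dmeas :: "(real \<Rightarrow> real) \<Rightarrow> real measure" where
  "dmeas q = density LT (\<lambda>x. ennreal (q x))"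

definition unif :: "real \<Rightarrow> real" where
  "unif = (\<lambda>_. 1)"

definition fourier :: "(real \<Rightarrow> real) \<Rightarrow> int \<Rightarrow> complex" where
  "fourier f k = (\<integral>x. complex_of_real (f x) * cis (- 2 * pi * of_int k * x) \<partial>LT)"

text \<open>The (real) Fourier coefficients of the even potential W at k >= 1.\<close>
definition What :: "(real \<Rightarrow> real) \<Rightarrow> nat \<Rightarrow> real" where
  "What W k = Re (fourier W (int k))"

definition Iplus :: "(real \<Rightarrow> real) \<Rightarrow> nat set" where
  "Iplus W = {k. 1 \<le> k \<and> What W k > 0}"

text \<open>Linear stability threshold K_# = (2 max_{k in I_+} W^(k))^(-1).\<close>
definition Ksharp :: "(real \<Rightarrow> real) \<Rightarrow> real" where
  "Ksharp W = 1 / (2 * Sup (What W ` Iplus W))"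

text \<open>Entropy  \<integral> log q dq = \<integral> q log q d\<theta>, with values in (-\<infinity>, \<infinity>].\<close>
definition entropy :: "(real \<Rightarrow> real) \<Rightarrow> ereal" where
  "entropy q = enn2ereal (\<integral>\<^sup>+x. ennreal (q x * ln (q x)) \<partial>LT)
             - enn2ereal (\<integral>\<^sup>+x. ennreal (- (q x * ln (q x))) \<partial>LT)"

definition energy :: "(real \<Rightarrow> real) \<Rightarrow> real measure \<Rightarrow> ereal" where
  "energy W \<mu> = enn2ereal (\<integral>\<^sup>+z. ennreal (W (fst z - snd z)) \<partial>(\<mu> \<Otimes>\<^sub>M \<mu>))
              - enn2ereal (\<integral>\<^sup>+z. ennreal (- W (fst z - snd z)) \<partial>(\<mu> \<Otimes>\<^sub>M \<mu>))"

text \<open>Weak convergence of measures on T: tested against continuous functions on the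
  circle, i.e. continuous 1-periodic functions on the real line.\<close>
definition weak_conv_T :: "(nat \<Rightarrow> real measure) \<Rightarrow> real measure \<Rightarrow> bool" where
  "weak_conv_T \<mu>s \<mu> \<longleftrightarrow> (\<forall>f :: real \<Rightarrow> real. continuous_on UNIV f \<and> (\<forall>x. f (x + 1) = f x)
      \<longrightarrow> (\<lambda>n. \<integral>x. f x \<partial>(\<mu>s n)) \<longlonglongrightarrow> (\<integral>x. f x \<partial>\<mu>))"

definition standing_assms :: "(real \<Rightarrow> real) \<Rightarrow> bool" where
  "standing_assms W \<longleftrightarrow>
     W \<in> borel_measurable borel \<and> (\<forall>x. W (x + 1) = W x) \<and> (\<forall>x. W (- x) = W x)
   \<and> integrable LT W \<and> (\<integral>x. W x \<partial>LT) = 0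
   \<and> (\<exists>Wp :: real \<Rightarrow> real. Wp \<in> borel_measurable borel \<and> (\<forall>x. Wp (x + 1) = Wp x)
        \<and> integrable LT Wp
        \<and> (\<forall>k::int. fourier Wp k = (if nat \<bar>k\<bar> \<in> Iplus W then fourier W k else 0))
        \<and> (\<forall>K::real. K \<ge> 0 \<longrightarrow> (\<exists>C::real. C \<ge> 0 \<and> (\<forall>q. is_density q \<longrightarrow>
              ereal K * enn2ereal (\<integral>\<^sup>+z. ennreal (Wp (fst z - snd z)) \<partial>(dmeas q \<Otimes>\<^sub>M dmeas q))
                \<le> entropy q + ereal C))))
   \<and> (\<forall>\<mu>\<in>PT. energy W \<mu> < \<infinity>)
   \<and> (\<forall>\<mu>s \<mu>. (\<forall>n. \<mu>s n \<in> PT) \<and> \<mu> \<in> PT \<and> weak_conv_T \<mu>s \<mu>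
        \<longrightarrow> limsup (\<lambda>n. energy W (\<mu>s n)) \<le> energy W \<mu>)"

text \<open>Free energy F_K on densities (non-absolutely-continuous measures have F_K = +\<infinity>).\<close>
definition free_energy :: "(real \<Rightarrow> real) \<Rightarrow> real \<Rightarrow> (real \<Rightarrow> real) \<Rightarrow> ereal" where
  "free_energy W K q = entropy q - ereal K * energy W (dmeas q)"

definition global_min :: "(real \<Rightarrow> real) \<Rightarrow> real \<Rightarrow> (real \<Rightarrow> real) \<Rightarrow> bool" where
  "global_min W K q \<longleftrightarrow> is_density q \<and>
     (\<forall>p. is_density p \<longrightarrow> free_energy W K q \<le> free_energy W K p)"

definition unique_global_min_unif :: "(real \<Rightarrow> real) \<Rightarrow> real \<Rightarrow> bool" where
  "unique_global_min_unif W K \<longleftrightarrow> global_min W K unif \<and>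
     (\<forall>q. global_min W K q \<longrightarrow> (AE x in LT. q x = 1))"

definition conv :: "(real \<Rightarrow> real) \<Rightarrow> (real \<Rightarrow> real) \<Rightarrow> real \<Rightarrow> real" where
  "conv W q \<theta> = (\<integral>y. W (\<theta> - y) * q y \<partial>LT)"

text \<open>Critical points: densities solving the Kirkwood--Monroe equation.\<close>
definition critical_point :: "(real \<Rightarrow> real) \<Rightarrow> real \<Rightarrow> (real \<Rightarrow> real) \<Rightarrow> bool" where
  "critical_point W K q \<longleftrightarrow> is_density q
     \<and> (AE \<theta> in LT. integrable LT (\<lambda>y. W (\<theta> - y) * q y))
     \<and> integrable LT (\<lambda>\<theta>. exp (2 * K * conv W q \<theta>))
     \<and> (AE \<theta> in LT. q \<theta> = exp (2 * K * conv W q \<theta>)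
                         / (\<integral>\<theta>'. exp (2 * K * conv W q \<theta>') \<partial>LT))"

definition phase_transition_at :: "(real \<Rightarrow> real) \<Rightarrow> real \<Rightarrow> bool" where
  "phase_transition_at W Kc \<longleftrightarrow> 0 \<le> Kc
     \<and> (\<forall>K. 0 \<le> K \<and> K < Kc \<longrightarrow> unique_global_min_unif W K)
     \<and> global_min W Kc unif
     \<and> (\<forall>K. K > Kc \<longrightarrow> (\<exists>q. global_min W K q \<and> \<not> (AE x in LT. q x = 1)))"

definition continuous_phase_transition :: "(real \<Rightarrow> real) \<Rightarrow> real \<Rightarrow> bool" where
  "continuous_phase_transition W Kc \<longleftrightarrow> phase_transition_at W Kc
     \<and> unique_global_min_unif W Kc
     \<and> (\<forall>qf :: real \<Rightarrow> real \<Rightarrow> real. (\<forall>K. K > Kc \<longrightarrow> global_min W K (qf K))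
          \<longrightarrow> ((\<lambda>K. \<integral>x. \<bar>qf K x - 1\<bar> \<partial>LT) \<longlongrightarrow> 0) (at_right Kc))"

end

theory Submission
  imports Defs "HOL-Complex_Analysis.Laurent_Convergence"
begin

text \<open>
  Write \<open>m = n + 1\<close> and \<open>c\<^sub>j\<close> for the \<open>m * j\<close>-th Fourier coefficient of a density \<open>q\<close>. The
  Lebedev--Milin inequality and its dual, the logarithmic Hardy--Littlewood--Sobolev inequality
  \<open>\<Sum> \<bar>c\<^sub>j\<bar>\<^sup>2 / j \<le> \<integral> q log q\<close>, bound the interaction energy by the entropy, so that \<open>K = 1\<close> is the threshold.
  Keeping the defects in the Cauchy--Schwarz steps behind Lebedev--Milin shows that equality forces
  \<open>c\<^sub>j = c\<^sub>1 ^ j\<close>; a nonzero \<open>c\<^sub>1\<close> would make \<open>W\<close> the logarithmic potential. This is excluded because upper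
  semicontinuity of the energy, tested on pairs of atoms, bounds \<open>W\<close> from above. Minimizers for
  \<open>K > 1\<close> and their limit as \<open>K\<close> decreases to \<open>1\<close> come from weak compactness of entropy sublevel sets.
  A critical point satisfies \<open>\<integral> q log q - \<integral> log q = 2 K E\<close> with \<open>E\<close> its interaction energy, so
  for \<open>K \<le> 1/2\<close> the bound of the energy by the entropy gives \<open>\<integral> log q \<ge> 0\<close>, that is \<open>q = 1\<close>.
\<close>

subsection \<open>The torus and trigonometric polynomials\<close>

text \<open>The dual step is Gibbs' principle with the test function f = 2 Re (sum of c_j e_j / j),
  where e_j is the character of frequency m j. Its pairing with q is 2 H for H = sum of |c_j|^2 / j,
  while Lebedev--Milin bounds the logarithm of the integral of exp f by H; the difference leaves H
  at most the entropy. The obstacle is that the energy of a general density has no usable Fourier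
  expansion: W is bounded above but from below only integrable, and the energy may be minus
  infinity. The inequality is therefore proved for trigonometric polynomials, where all sums are
  finite, and extended by dominated convergence to bounded densities and then to densities of finite
  entropy and energy. Equality cannot be analysed after such limits, so the deficits travel with the
  inequality: \<open>core\<close> keeps finitely many of them at a time, and each passes to the
  limit of the coefficients.\<close>

lemma space_LT [simp]: "space LT = Tor"
  by (simp add: LT_def space_restrict_space)

lemma Tor_borel [measurable, simp]: "Tor \<in> sets borel"
  by (simp add: Tor_def)

lemma sets_LT: "sets LT = sets (restrict_space borel Tor)"
  by (simp add: LT_def sets_restrict_space)

lemma measurable_LT_borel: "f \<in> borel_measurable borel \<Longrightarrow> f \<in> borel_measurable LT"
  unfolding LT_def by (rule measurable_restrict_space1) simp

lemma sets_LT_iff: "A \<in> sets LT \<longleftrightarrow> A \<in> sets borel \<and> A \<subseteq> Tor"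
  by (auto simp: LT_def sets_restrict_space_iff)

lemma prob_space_LT: "prob_space LT"
  by (rule prob_spaceI) (auto simp: LT_def emeasure_restrict_space space_restrict_space, simp add: Tor_def)

interpretation LT: prob_space LT by (rule prob_space_LT)
interpretation LT2: pair_prob_space LT LT ..

lemma measurable_ident_LT_borel: "(\<lambda>x. x) \<in> measurable LT borel"
  by (rule measurable_LT_borel) simp

lemma nn_integral_LT:
  assumes [measurable]: "f \<in> borel_measurable borel"
  shows "(\<integral>\<^sup>+x. f x \<partial>LT) = (\<integral>\<^sup>+x. f x * indicator Tor x \<partial>lborel)"
  unfolding LT_def by (subst nn_integral_restrict_space) auto

section \<open>Translation and reflection invariance on the circle\<close>

definition wrap :: "real \<Rightarrow> real" where
  "wrap t = t - of_int \<lfloor>t + 1/2\<rfloor>"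

lemma wrap_Tor: "wrap t \<in> Tor"
  unfolding wrap_def Tor_def by simp linarith

lemma wrap_measurable_borel [measurable]: "wrap \<in> borel_measurable borel"
  unfolding wrap_def by measurable

lemma periodic_nat:
  assumes "\<And>x. f (x + 1) = f (x::real)" shows "f (x + real n) = f x"
proof (induction n)
  case (Suc n)
  have "f (x + real (Suc n)) = f ((x + real n) + 1)" by (simp add: algebra_simps)
  then show ?case using assms Suc by simp
qed simp

lemma periodic_int:
  assumes "\<And>x. f (x + 1) = f (x::real)" shows "f (x + of_int k) = f x"
proof (cases "k \<ge> 0")
  case True
  then show ?thesis using periodic_nat[of f x "nat k", OF assms] by simp
next
  case False
  then show ?thesis using periodic_nat[of f "x + of_int k" "nat (-k)", OF assms] by simp
qed

lemma periodic_wrap: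
  assumes "\<And>x. f (x + 1) = f (x::real)" shows "f (wrap x) = f x"
  using periodic_int[of f x "- \<lfloor>x + 1/2\<rfloor>", OF assms] by (simp add: wrap_def)

lemma wrap_periodic: "wrap (x + 1) = wrap x"
proof -
  have "\<lfloor>(x + 1) + 1/2\<rfloor> = \<lfloor>x + 1/2\<rfloor> + 1"
    by (metis floor_add_int add.assoc add.commute of_int_1)
  then show ?thesis by (simp add: wrap_def)
qed

lemma wrap_measurable_LT [measurable]: "wrap \<in> measurable borel LT"
  unfolding LT_def by (rule measurable_restrict_space2) (auto simp: wrap_Tor)

text \<open>A shift 0 \<le> s < 1 pushes a piece of the window beyond 1/2, and periodicity moves
  that piece back by 1. Every other shift differs from such an s by an integer.\<close>

lemma nn_integral_shift:
  assumes [measurable]: "f \<in> borel_measurable borel" and per: "\<And>x. f (x + 1) = (f (x::real) :: ennreal)"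
  shows "(\<integral>\<^sup>+x. f (x + a) \<partial>LT) = (\<integral>\<^sup>+x. f x \<partial>LT)"
proof -
  define s where "s = wrap a"
  have s: "-1/2 \<le> s" "s < 1/2" using wrap_Tor[of a] by (auto simp: s_def Tor_def)
  define k where "k = \<lfloor>a + 1/2\<rfloor>"
  have a: "a = s + of_int k" by (simp add: s_def wrap_def k_def)
  have main: "(\<integral>\<^sup>+x. f (x + s) \<partial>LT) = (\<integral>\<^sup>+x. f x \<partial>LT)" if s: "0 \<le> s" "s < 1" for s
  proof -
    have "(\<integral>\<^sup>+x. f (x + s) \<partial>LT) = (\<integral>\<^sup>+x. f (s + 1 * x) * indicator {-1/2+s..<1/2+s} (s + 1 * x) \<partial>lborel)"
      by (subst nn_integral_LT) (auto intro!: nn_integral_cong simp: Tor_def indicator_def add.commute)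
    also have "\<dots> = (\<integral>\<^sup>+x. f x * indicator {-1/2+s..<1/2+s} x \<partial>lborel)"
      by (subst (2) nn_integral_real_affine[where c=1 and t=s]) auto
    also have "\<dots> = (\<integral>\<^sup>+x. (f x * indicator {-1/2+s..<1/2} x + f x * indicator {1/2..<1/2+s} x) \<partial>lborel)"
      using s by (intro nn_integral_cong) (auto simp: indicator_def)
    also have "\<dots> = (\<integral>\<^sup>+x. f x * indicator {-1/2+s..<1/2} x \<partial>lborel) + (\<integral>\<^sup>+x. f x * indicator {1/2..<1/2+s} x \<partial>lborel)"
      by (rule nn_integral_add) auto
    also have "(\<integral>\<^sup>+x. f x * indicator {1/2..<1/2+s} x \<partial>lborel)
        = (\<integral>\<^sup>+x. f (1 + 1 * x) * indicator {1/2..<1/2+s} (1 + 1 * x) \<partial>lborel)"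
      by (subst nn_integral_real_affine[where c=1 and t=1]) auto
    also have "\<dots> = (\<integral>\<^sup>+x. f x * indicator {-1/2..<-1/2+s} x \<partial>lborel)"
      using per by (intro nn_integral_cong) (auto simp: indicator_def add.commute)
    also have "(\<integral>\<^sup>+x. f x * indicator {-1/2+s..<1/2} x \<partial>lborel) + \<dots>
       = (\<integral>\<^sup>+x. f x * indicator {-1/2+s..<1/2} x + f x * indicator {-1/2..<-1/2+s} x \<partial>lborel)"
      by (rule nn_integral_add[symmetric]) auto
    also have "\<dots> = (\<integral>\<^sup>+x. f x * indicator Tor x \<partial>lborel)"
      using s by (intro nn_integral_cong) (auto simp: indicator_def Tor_def)
    also have "\<dots> = (\<integral>\<^sup>+x. f x \<partial>LT)"
      by (rule nn_integral_LT[symmetric]) auto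
    finally show ?thesis .
  qed
  have "f (x + a) = f (x + s)" for x
    using periodic_int[of f "x+s" k, OF per] by (simp add: a algebra_simps)
  moreover have "(\<integral>\<^sup>+x. f (x + s) \<partial>LT) = (\<integral>\<^sup>+x. f x \<partial>LT)"
  proof (cases "s \<ge> 0")
    case True then show ?thesis using s by (intro main) auto
  next
    case False
    have "f (x + s) = f (x + (s + 1))" for x using per[of "x+s"] by (simp add: algebra_simps)
    then show ?thesis using main[of "s+1"] s False by simp
  qed
  ultimately show ?thesis by simp
qed

lemma nn_integral_reflect:
  assumes [measurable]: "f \<in> borel_measurable borel"
  shows "(\<integral>\<^sup>+x. f (- x) \<partial>LT) = (\<integral>\<^sup>+x. (f x :: ennreal) \<partial>LT)"
proof -
  have "(\<integral>\<^sup>+x. f (- x) \<partial>LT) = (\<integral>\<^sup>+x. f (0 + (-1) * x) * indicator {-1/2<..1/2} (0 + (-1) * x) \<partial>lborel)"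
    by (subst nn_integral_LT) (auto intro!: nn_integral_cong simp: Tor_def indicator_def)
  also have "\<dots> = (\<integral>\<^sup>+x. f x * indicator {-1/2<..1/2} x \<partial>lborel)"
    by (subst (2) nn_integral_real_affine[where c="-1" and t=0]) auto
  also have "\<dots> = (\<integral>\<^sup>+x. f x * indicator Tor x \<partial>lborel)"
  proof (rule nn_integral_cong_AE)
    \<comment> \<open>Reflection exchanges which endpoint belongs to the interval; both endpoints
      are null.\<close>
    have "AE x in lborel. x \<noteq> -1/2 \<and> x \<noteq> (1/2::real)"
      using AE_lborel_singleton[of "-1/2::real"] AE_lborel_singleton[of "1/2::real"] by auto
    then show "AE x in lborel. f x * indicator {-1/2<..1/2} x = f x * indicator Tor x"
      by eventually_elim (auto simp: indicator_def Tor_def)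
  qed
  also have "\<dots> = (\<integral>\<^sup>+x. f x \<partial>LT)"
    by (rule nn_integral_LT[symmetric]) auto
  finally show ?thesis .
qed

lemma measurable_wrap_affine [measurable]: "(\<lambda>x. wrap (c * x + a)) \<in> measurable LT LT"
  by (rule measurable_compose[OF measurable_LT_borel wrap_measurable_LT]) auto

text \<open>Invariance of the measure itself transfers to Bochner integrals at once. Indicators
  composed with \<open>wrap\<close> are periodic, so the two preceding lemmas apply to them.\<close>

lemma distr_wrap:
  assumes "c = 1 \<or> c = -1"
  shows "distr LT LT (\<lambda>x. wrap (c * x + a)) = LT"
proof (rule measure_eqI)
  fix A assume "A \<in> sets (distr LT LT (\<lambda>x. wrap (c * x + a)))"
  then have A [measurable]: "A \<in> sets LT" by simp
  then have Ab [measurable]: "A \<in> sets borel" and AT: "A \<subseteq> Tor" by (auto simp: sets_LT_iff)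
  define g where "g x = (indicator A (wrap x) :: ennreal)" for x
  have [measurable]: "g \<in> borel_measurable borel" unfolding g_def by measurable
  have per: "g (x + 1) = g x" for x by (simp add: g_def wrap_periodic)
  have "emeasure (distr LT LT (\<lambda>x. wrap (c * x + a))) A = (\<integral>\<^sup>+x. g (c * x + a) \<partial>LT)"
    unfolding g_def by (subst nn_integral_indicator[symmetric], simp, subst nn_integral_distr) auto
  also have "\<dots> = (\<integral>\<^sup>+x. g x \<partial>LT)"
  proof (cases "c = 1")
    case True then show ?thesis using nn_integral_shift[of g a] per by simp
  next
    case False
    then have "c = -1" using assms by simp
    then have "(\<integral>\<^sup>+x. g (c * x + a) \<partial>LT) = (\<integral>\<^sup>+x. g (x + a) \<partial>LT)"
      using nn_integral_reflect[of "\<lambda>x. g (x + a)"] by simp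
    then show ?thesis using nn_integral_shift[of g a] per by simp
  qed
  also have "\<dots> = (\<integral>\<^sup>+x. indicator A x \<partial>LT)"
  proof (rule nn_integral_cong)
    fix x assume "x \<in> space LT"
    then have "wrap x = x" by (auto simp: Tor_def wrap_def floor_eq_iff)
    then show "g x = indicator A x" by (simp add: g_def)
  qed
  also have "\<dots> = emeasure LT A" by simp
  finally show "emeasure (distr LT LT (\<lambda>x. wrap (c * x + a))) A = emeasure LT A" .
qed simp

lemma
  fixes f :: "real \<Rightarrow> 'b::{banach, second_countable_topology}"
  assumes [measurable]: "f \<in> borel_measurable borel" and per: "\<And>x. f (x + 1) = f x" and c: "c = 1 \<or> c = -1"
  shows integral_affine_LT: "(\<integral>x. f (c * x + a) \<partial>LT) = (\<integral>x. f x \<partial>LT)"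
    and integrable_affine_LT: "integrable LT (\<lambda>x. f (c * x + a)) \<longleftrightarrow> integrable LT f"
proof -
  have f: "f \<in> borel_measurable LT" by (rule measurable_LT_borel) simp
  have eq: "f (c * x + a) = f (wrap (c * x + a))" for x
    using periodic_wrap[of f, OF per] by simp
  show "(\<integral>x. f (c * x + a) \<partial>LT) = (\<integral>x. f x \<partial>LT)"
    unfolding eq using f by (subst (2) distr_wrap[OF c, symmetric, of a]) (simp add: integral_distr)
  show "integrable LT (\<lambda>x. f (c * x + a)) \<longleftrightarrow> integrable LT f"
    unfolding eq using f by (subst (2) distr_wrap[OF c, symmetric, of a]) (simp add: integrable_distr_eq)
qed

section \<open>Characters of the circle\<close>

definition ech :: "int \<Rightarrow> real \<Rightarrow> complex" where
  "ech k x = cis (2 * pi * of_int k * x)"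

lemma ech_mult: "ech k x * ech l x = ech (k + l) x"
  by (simp add: ech_def cis_mult algebra_simps)

lemma ech_add: "ech k (x + y) = ech k x * ech k y"
  by (simp add: ech_def cis_mult algebra_simps)

lemma ech_0 [simp]: "ech 0 x = 1" "ech k 0 = 1"
  by (simp_all add: ech_def)

lemma norm_ech [simp]: "norm (ech k x) = 1"
  by (simp add: ech_def)

lemma cnj_ech: "cnj (ech k x) = ech (- k) x"
  by (simp add: ech_def cis_cnj)

lemma ech_minus: "ech k (- x) = ech (- k) x"
  by (simp add: ech_def)

lemma ech_power: "ech k x ^ j = ech (k * int j) x"
  by (induction j) (simp_all add: ech_mult algebra_simps)

lemma ech_int [simp]: "ech k (of_int j) = 1"
proof -
  have "ech k (of_int j) = cis (of_int (k * j) * (2 * pi))"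
    by (simp add: ech_def algebra_simps)
  then show ?thesis
    using cis_multiple_2pi[of "of_int (k * j)"] by (simp add: mult.commute)
qed

lemma ech_periodic: "ech k (x + 1) = ech k x"
  using ech_int[of k 1] by (simp add: ech_add)

lemma ech_measurable [measurable]: "ech k \<in> borel_measurable borel"
  unfolding ech_def by (intro borel_measurable_continuous_onI continuous_intros)

lemma ech_measurable_LT [measurable]: "ech k \<in> borel_measurable LT"
  by (rule measurable_LT_borel) simp

lemma continuous_ech [continuous_intros]: "continuous_on S (ech k)"
  unfolding ech_def by (intro continuous_intros)

lemma integrable_mult_ech:
  fixes f :: "real \<Rightarrow> complex"
  assumes "integrable LT f"
  shows "integrable LT (\<lambda>x. f x * ech k x)"
  by (rule Bochner_Integration.integrable_bound[OF assms]) (use assms in \<open>auto simp: norm_mult\<close>)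

lemma integrable_ech [simp]: "integrable LT (ech k)"
  by (rule LT.integrable_const_bound[where B=1]) auto

lemma integral_ech: "(\<integral>x. ech k x \<partial>LT) = (if k = 0 then 1 else 0)"
proof (cases "k = 0")
  case True
  then have "ech k = (\<lambda>x. 1)" by (auto simp: fun_eq_iff)
  then show ?thesis using True LT.prob_space by simp
next
  case False
  \<comment> \<open>Translation by half a period of \<open>ech k\<close> multiplies it by -1, so the
    integral equals its own negative.\<close>
  define a where "a = 1 / (2 * of_int k :: real)"
  have "(\<integral>x. ech k x \<partial>LT) = (\<integral>x. ech k (1 * x + a) \<partial>LT)"
    by (rule integral_affine_LT[symmetric]) (auto simp: ech_periodic)
  also have "\<dots> = ech k a * (\<integral>x. ech k x \<partial>LT)"
    by (simp add: ech_add mult.commute)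
  also have "ech k a = -1" using False by (simp add: ech_def a_def)
  finally show ?thesis using False by simp
qed

abbreviation (input) cplx :: "real \<Rightarrow> complex" where
  "cplx \<equiv> complex_of_real"

lemma fourier_ech: "fourier f k = (\<integral>x. cplx (f x) * ech (- k) x \<partial>LT)"
  by (simp add: fourier_def ech_def)

lemma fourier_cnj: "fourier f (- k) = cnj (fourier f k)"
proof -
  have "cnj (fourier f k) = (\<integral>x. cnj (cplx (f x) * ech (- k) x) \<partial>LT)"
    unfolding fourier_ech by (rule Bochner_Integration.integral_cnj[symmetric])
  then show ?thesis by (simp add: fourier_ech cnj_ech)
qed

section \<open>Trigonometric polynomials\<close>

definition trig_sum :: "(real \<Rightarrow> complex) \<Rightarrow> bool" where
  "trig_sum f \<longleftrightarrow> (\<exists>L c. \<forall>x. f x = (\<Sum>k\<in>{-int L..int L}. c k * ech k x))"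

lemma trig_sum_add: assumes "trig_sum f" "trig_sum g" shows "trig_sum (\<lambda>x. f x + g x)"
proof -
  obtain L c where f: "\<And>x. f x = (\<Sum>k\<in>{-int L..int L}. c k * ech k x)"
    using assms by (auto simp: trig_sum_def)
  obtain M d where g: "\<And>x. g x = (\<Sum>k\<in>{-int M..int M}. d k * ech k x)"
    using assms by (auto simp: trig_sum_def)
  define c' where "c' k = (if k \<in> {-int L..int L} then c k else 0)" for k
  define d' where "d' k = (if k \<in> {-int M..int M} then d k else 0)" for k
  define N where "N = max L M"
  have "f x = (\<Sum>k\<in>{-int N..int N}. c' k * ech k x)" for x
    unfolding f by (rule sum.mono_neutral_cong_left) (auto simp: c'_def N_def)
  moreover have "g x = (\<Sum>k\<in>{-int N..int N}. d' k * ech k x)" for x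
    unfolding g by (rule sum.mono_neutral_cong_left) (auto simp: d'_def N_def)
  ultimately have "f x + g x = (\<Sum>k\<in>{-int N..int N}. (c' k + d' k) * ech k x)" for x
    by (simp add: sum.distrib algebra_simps)
  then show ?thesis unfolding trig_sum_def by fast
qed

lemma trig_sum_monom: "trig_sum (\<lambda>x. a * ech k x)"
proof -
  have "a * ech k x = (\<Sum>l\<in>{-int (nat \<bar>k\<bar>)..int (nat \<bar>k\<bar>)}. (if l = k then a else 0) * ech l x)" for x
    by (subst sum.mono_neutral_right[where S="{k}"]) auto
  then show ?thesis unfolding trig_sum_def by fast
qed

lemma trig_sum_sum: "finite A \<Longrightarrow> (\<And>i. i \<in> A \<Longrightarrow> trig_sum (f i)) \<Longrightarrow> trig_sum (\<lambda>x. \<Sum>i\<in>A. f i x)"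
proof (induction A rule: finite_induct)
  case empty
  then show ?case using trig_sum_monom[of 0 0] by simp
next
  case (insert i A)
  then show ?case using trig_sum_add[of "f i" "\<lambda>x. \<Sum>i\<in>A. f i x"] by simp
qed

lemma trig_sum_mult: assumes "trig_sum f" "trig_sum g" shows "trig_sum (\<lambda>x. f x * g x)"
proof -
  obtain L c where f: "\<And>x. f x = (\<Sum>k\<in>{-int L..int L}. c k * ech k x)"
    using assms by (auto simp: trig_sum_def)
  obtain M d where g: "\<And>x. g x = (\<Sum>k\<in>{-int M..int M}. d k * ech k x)"
    using assms by (auto simp: trig_sum_def)
  have eq: "(\<lambda>x. f x * g x) = (\<lambda>x. \<Sum>k\<in>{-int L..int L}. \<Sum>l\<in>{-int M..int M}. (c k * d l) * ech (k + l) x)"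
    unfolding f g sum_product by (intro ext sum.cong) (auto simp: ech_mult[symmetric])
  show ?thesis unfolding eq
    by (intro trig_sum_sum trig_sum_monom) auto
qed

definition trig_poly :: "(real \<Rightarrow> real) \<Rightarrow> bool" where
  "trig_poly P \<longleftrightarrow> trig_sum (\<lambda>x. cplx (P x))"

lemma trig_poly_add: "trig_poly f \<Longrightarrow> trig_poly g \<Longrightarrow> trig_poly (\<lambda>x. f x + g x)"
  unfolding trig_poly_def using trig_sum_add by simp

lemma trig_poly_mult: "trig_poly f \<Longrightarrow> trig_poly g \<Longrightarrow> trig_poly (\<lambda>x. f x * g x)"
  unfolding trig_poly_def using trig_sum_mult by simp

lemma trig_poly_const: "trig_poly (\<lambda>x. a)"
  unfolding trig_poly_def using trig_sum_monom[of "cplx a" 0] by simp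

lemma trig_poly_cos: "trig_poly (\<lambda>x. cos (2 * pi * of_int k * x))"
proof -
  have eq: "cplx (cos (2 * pi * of_int k * x)) = (1/2) * ech k x + (1/2) * ech (-k) x" for x
    by (simp add: ech_def complex_eq_iff)
  show ?thesis unfolding trig_poly_def eq by (intro trig_sum_add trig_sum_monom)
qed

lemma trig_poly_sin: "trig_poly (\<lambda>x. sin (2 * pi * of_int k * x))"
proof -
  have eq: "cplx (sin (2 * pi * of_int k * x)) = (-\<i>/2) * ech k x + (\<i>/2) * ech (-k) x" for x
    by (simp add: ech_def complex_eq_iff)
  show ?thesis unfolding trig_poly_def eq by (intro trig_sum_add trig_sum_monom)
qed

text \<open>Orthogonality of the characters identifies any representing coefficients with the
  Fourier coefficients.\<close>

lemma trig_polyE: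
  assumes "trig_poly P"
  obtains L where "\<And>x. cplx (P x) = (\<Sum>k\<in>{-int L..int L}. fourier P k * ech k x)"
    "\<And>k. \<bar>k\<bar> > int L \<Longrightarrow> fourier P k = 0"
proof -
  obtain L c where P: "\<And>x. cplx (P x) = (\<Sum>k\<in>{-int L..int L}. c k * ech k x)"
    using assms by (auto simp: trig_sum_def trig_poly_def)
  have *: "fourier P l = (if l \<in> {-int L..int L} then c l else 0)" for l
  proof -
    have "fourier P l = (\<integral>x. (\<Sum>k\<in>{-int L..int L}. c k * ech (k - l) x) \<partial>LT)"
      unfolding fourier_ech P by (simp add: sum_distrib_right mult.assoc ech_mult)
    also have "\<dots> = (\<Sum>k\<in>{-int L..int L}. c k * (if k = l then 1 else 0))"
      by (subst Bochner_Integration.integral_sum) (auto simp: integral_ech)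
    also have "\<dots> = (if l \<in> {-int L..int L} then c l else 0)"
      by (simp only: if_distrib[of "\<lambda>z. _ * z"] mult_1_right mult_zero_right) (simp add: sum.delta)
    finally show ?thesis .
  qed
  show ?thesis
  proof (rule that[of L])
    show "cplx (P x) = (\<Sum>k\<in>{-int L..int L}. fourier P k * ech k x)" for x
      unfolding P by (rule sum.cong) (auto simp: *)
  qed (auto simp: *)
qed

lemma trig_poly_continuous: assumes "trig_poly P" shows "continuous_on S P"
proof -
  obtain L c where P: "\<And>x. cplx (P x) = (\<Sum>k\<in>{-int L..int L}. c k * ech k x)"
    using assms by (auto simp: trig_sum_def trig_poly_def)
  have "P = (\<lambda>x. Re (\<Sum>k\<in>{-int L..int L}. c k * ech k x))"
    unfolding P[symmetric] by simp
  moreover have "continuous_on S (\<lambda>x. Re (\<Sum>k\<in>{-int L..int L}. c k * ech k x))"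
    by (intro continuous_intros)
  ultimately show ?thesis by metis
qed

lemma trig_poly_periodic: assumes "trig_poly P" shows "P (x + 1) = P x"
proof -
  obtain L c where P: "\<And>x. cplx (P x) = (\<Sum>k\<in>{-int L..int L}. c k * ech k x)"
    using assms by (auto simp: trig_sum_def trig_poly_def)
  have "cplx (P (x + 1)) = cplx (P x)" unfolding P by (simp add: ech_periodic)
  then show ?thesis by simp
qed

lemma trig_poly_measurable: "trig_poly P \<Longrightarrow> P \<in> borel_measurable borel"
  by (rule borel_measurable_continuous_onI[OF trig_poly_continuous])

subsection \<open>The interaction energy as a bilinear form\<close>

abbreviation LL :: "(real \<times> real) measure" where
  "LL \<equiv> LT \<Otimes>\<^sub>M LT"

abbreviation ker :: "(real \<Rightarrow> real) \<Rightarrow> (real \<Rightarrow> real) \<Rightarrow> (real \<Rightarrow> real) \<Rightarrow> real \<times> real \<Rightarrow> real" where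
  "ker W p q z \<equiv> W (fst z - snd z) * p (fst z) * q (snd z)"

lemma measurable_diff_LT2 [measurable]: "(\<lambda>z. fst z - snd z) \<in> borel_measurable LL"
proof -
  have "fst \<in> borel_measurable LL" "snd \<in> borel_measurable LL"
    using measurable_compose[OF measurable_fst measurable_ident_LT_borel]
      measurable_compose[OF measurable_snd measurable_ident_LT_borel] by auto
  then show ?thesis by simp
qed

text \<open>A Bochner integral is 0 when the integrand is not integrable, so this is the energy only
  where the kernel is integrable; \<open>energy_cases\<close> makes the connection.\<close>

definition bil :: "(real \<Rightarrow> real) \<Rightarrow> (real \<Rightarrow> real) \<Rightarrow> (real \<Rightarrow> real) \<Rightarrow> real" where
  "bil W p q = (\<integral>z. ker W p q z \<partial>LL)"

locale potential =
  fixes W :: "real \<Rightarrow> real"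
  assumes W_measurable [measurable]: "W \<in> borel_measurable borel"
    and W_periodic: "\<And>x. W (x + 1) = W x"
    and W_even: "\<And>x. W (- x) = W x"
    and W_integrable: "integrable LT W"
begin

lemma W_affine_integrable: "c = 1 \<or> c = -1 \<Longrightarrow> integrable LT (\<lambda>x. W (c * x + a))"
  using integrable_affine_LT[of W c a] W_periodic W_integrable by simp

lemma W_minus_commute: "W (x - y) = W (y - x)"
  using W_even[of "x - y"] by simp

text \<open>Integrating first over the variable absent from \<open>q\<close> leaves the L1 norm of
  \<open>W\<close>, by translation invariance.\<close>

lemma integrable_W_fst:
  assumes q: "integrable LT q"
  shows "integrable LL (\<lambda>z. W (fst z - snd z) * q (fst z))"
proof (rule LT2.Fubini_integrable)
  have [measurable]: "q \<in> borel_measurable LT" using q by simp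
  show "(\<lambda>z. W (fst z - snd z) * q (fst z)) \<in> borel_measurable LL" by measurable
  have "(\<integral>y. norm (W (x - y) * q x) \<partial>LT) = (\<integral>x. \<bar>W x\<bar> \<partial>LT) * \<bar>q x\<bar>" for x
    using integral_affine_LT[of "\<lambda>x. \<bar>W x\<bar>" "-1" x] W_periodic by (simp add: abs_mult)
  then show "integrable LT (\<lambda>x. \<integral>y. norm (W (fst (x, y) - snd (x, y)) * q (fst (x, y))) \<partial>LT)"
    using q by simp
  show "AE x in LT. integrable LT (\<lambda>y. W (fst (x, y) - snd (x, y)) * q (fst (x, y)))"
    using W_affine_integrable[of "-1"] by (auto intro!: AE_I2)
qed

lemma integrable_W_snd:
  assumes q: "integrable LT q"
  shows "integrable LL (\<lambda>z. W (fst z - snd z) * q (snd z))"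
proof -
  have "(\<lambda>(x, y). (\<lambda>z. W (fst z - snd z) * q (fst z)) (y, x)) = (\<lambda>z. W (fst z - snd z) * q (snd z))"
  proof
    fix z :: "real \<times> real"
    show "(case z of (x, y) \<Rightarrow> (\<lambda>z. W (fst z - snd z) * q (fst z)) (y, x)) = W (fst z - snd z) * q (snd z)"
      by (cases z) (simp, metis W_minus_commute)
  qed
  then show ?thesis
    using LT2.integrable_product_swap[OF integrable_W_fst[OF q]] by (simp only:)
qed

text \<open>Evenness makes the sign of the frequency irrelevant and the coefficients real, so the
  real part taken in \<open>What\<close> loses nothing.\<close>

lemma integral_W_ech: "(\<integral>x. cplx (W x) * ech k x \<partial>LT) = cplx (What W (nat \<bar>k\<bar>))"
proof -
  have even: "(\<integral>x. cplx (W x) * ech (- k) x \<partial>LT) = (\<integral>x. cplx (W x) * ech k x \<partial>LT)" for k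
    using integral_affine_LT[of "\<lambda>x. cplx (W x) * ech k x" "-1" 0] W_periodic W_even
    by (simp add: ech_periodic ech_minus)
  then have e: "(\<integral>x. cplx (W x) * ech k x \<partial>LT) = fourier W k" for k
    by (simp add: fourier_ech)
  have "fourier W k = cnj (fourier W k)" for k
    using fourier_cnj[of W k] e[of k] e[of "-k"] even[of k] by simp
  then have r: "fourier W k = cplx (Re (fourier W k))" for k
    by (metis Reals_cnj_iff of_real_Re)
  have "fourier W (int (nat \<bar>k\<bar>)) = fourier W k"
  proof (cases "k \<ge> 0")
    case True
    then show ?thesis by (simp only: abs_of_nonneg int_nat_eq if_True)
  next
    case False
    then have k: "int (nat \<bar>k\<bar>) = - k" by simp
    have "fourier W (- k) = fourier W k"
      using even[of k] by (simp only: fourier_ech minus_minus)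
    then show ?thesis by (simp only: k)
  qed
  then show ?thesis unfolding What_def e by (simp only: r[symmetric])
qed

text \<open>Convolution with \<open>W\<close> acts diagonally on characters. Only \<open>P\<close>
  is expanded, so the sum is finite although \<open>q\<close> is merely integrable.\<close>

lemma bil_trig:
  assumes P: "\<And>x. cplx (P x) = (\<Sum>k\<in>{-int L..int L}. fourier P k * ech k x)"
    and q: "integrable LT q"
  shows "cplx (bil W P q) =
    (\<Sum>k\<in>{-int L..int L}. cplx (What W (nat \<bar>k\<bar>)) * fourier P k * cnj (fourier q k))"
proof -
  have [measurable]: "q \<in> borel_measurable LT" using q by simp
  have int: "integrable LL (\<lambda>z. cplx (W (fst z - snd z) * q (snd z)) * ech k (fst z))" for k
    by (rule Bochner_Integration.integrable_bound[OF integrable_W_snd[OF q]]) (auto simp: norm_mult)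
  have one: "(\<integral>z. cplx (W (fst z - snd z) * q (snd z)) * ech k (fst z) \<partial>LL)
     = cplx (What W (nat \<bar>k\<bar>)) * cnj (fourier q k)" for k
  proof -
    have "(\<integral>z. cplx (W (fst z - snd z) * q (snd z)) * ech k (fst z) \<partial>LL)
      = (\<integral>y. \<integral>x. cplx (W (x - y) * q y) * ech k x \<partial>LT \<partial>LT)"
      using int[of k] LT2.integral_snd[of "\<lambda>x y. cplx (W (x - y) * q y) * ech k x"]
      by (simp add: case_prod_beta')
    also have "\<dots> = (\<integral>y. cplx (q y) * ech k y * cplx (What W (nat \<bar>k\<bar>)) \<partial>LT)"
    proof (rule Bochner_Integration.integral_cong)
      fix y
      have "(\<integral>x. cplx (W (x - y) * q y) * ech k x \<partial>LT)
         = (\<integral>x. cplx (q y) * ech k y * (cplx (W (1 * x + (-y))) * ech k (1 * x + (-y))) \<partial>LT)"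
      proof (rule Bochner_Integration.integral_cong)
        fix x
        have "ech k x = ech k y * ech k (1 * x + (-y))" using ech_add[of k y "1 * x + (-y)"] by simp
        then show "cplx (W (x - y) * q y) * ech k x =
          cplx (q y) * ech k y * (cplx (W (1 * x + (-y))) * ech k (1 * x + (-y)))"
          by simp
      qed simp
      also have "\<dots> = cplx (q y) * ech k y * (\<integral>x. (cplx (W (1 * x + (-y))) * ech k (1 * x + (-y))) \<partial>LT)"
        by simp
      also have "(\<integral>x. (cplx (W (1 * x + (-y))) * ech k (1 * x + (-y))) \<partial>LT)
          = (\<integral>x. (cplx (W x) * ech k x) \<partial>LT)"
        by (rule integral_affine_LT) (auto simp: W_periodic ech_periodic)
      finally show "(\<integral>x. cplx (W (x - y) * q y) * ech k x \<partial>LT) = cplx (q y) * ech k y * cplx (What W (nat \<bar>k\<bar>))"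
        by (simp add: integral_W_ech)
    qed simp
    also have "\<dots> = fourier q (- k) * cplx (What W (nat \<bar>k\<bar>))"
      by (simp add: fourier_ech)
    finally show ?thesis by (simp add: fourier_cnj)
  qed
  have "cplx (bil W P q) = (\<integral>z. cplx (ker W P q z) \<partial>LL)"
    unfolding bil_def by (rule integral_complex_of_real[symmetric])
  also have "\<dots> = (\<integral>z. (\<Sum>k\<in>{-int L..int L}. fourier P k * (cplx (W (fst z - snd z) * q (snd z)) * ech k (fst z))) \<partial>LL)"
    by (simp only: of_real_mult P sum_distrib_left sum_distrib_right ac_simps)
  also have "\<dots> = (\<Sum>k\<in>{-int L..int L}. fourier P k * (cplx (What W (nat \<bar>k\<bar>)) * cnj (fourier q k)))"
    using int by (subst Bochner_Integration.integral_sum) (auto simp: one[unfolded of_real_mult])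
  finally show ?thesis by (simp only: ac_simps)
qed

end

subsection \<open>The Lebedev--Milin inequality\<close>

text \<open>The Taylor coefficients of F(z) = exp (sum of c_j z^j / j). The recursion compares
  coefficients in dF/dz = (sum of c_j z^(j-1)) F.\<close>

fun expcoef :: "(nat \<Rightarrow> 'a::real_normed_field) \<Rightarrow> nat \<Rightarrow> 'a" where
  "expcoef c 0 = 1"
| "expcoef c (Suc k) = (\<Sum>l\<le>k. c (Suc l) * expcoef c (k - l)) / of_nat (Suc k)"

declare expcoef.simps(2) [simp del]

lemma expcoef_of_real:
  "expcoef (\<lambda>j. cplx (b j)) k = cplx (expcoef b k)"
  by (induction k rule: less_induct; case_tac x) (simp_all add: expcoef.simps(2))

lemma expcoef_Suc: "of_nat (Suc k) * expcoef c (Suc k) = (\<Sum>l\<le>k. c (Suc l) * expcoef c (k - l))"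
  using of_nat_neq_0[of k, where 'a='a] by (simp only: expcoef.simps(2)) simp

text \<open>With finitely many nonzero \<open>c j\<close> the exponential is entire, so its
  expansion converges everywhere; its differential equation gives the recursion of
  \<open>expcoef\<close>.\<close>

lemma expcoef_sums:
  fixes c :: "nat \<Rightarrow> complex"
  assumes c: "\<And>j. j > N \<Longrightarrow> c j = 0"
  shows "(\<lambda>k. expcoef c k * z ^ k) sums exp (\<Sum>j=1..N. c j * z ^ j / of_nat j)"
proof -
  define g where "g z = (\<Sum>j=1..N. c j * z ^ j / of_nat j)" for z
  define f where "f z = exp (g z)" for z
  define F where "F = fps_expansion f 0"
  define G where "G = (\<Sum>j<N. fps_const (c (Suc j)) * fps_X ^ j)"
  have hol: "f holomorphic_on A" for A
    unfolding f_def g_def by (intro holomorphic_intros) auto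
  have fF: "f has_fps_expansion F"
    unfolding F_def by (rule has_fps_expansion_fps_expansion[of UNIV]) (auto intro: hol)
  have "deriv f z = (\<Sum>j<N. c (Suc j) * z ^ j) * f z" for z
  proof -
    have "(g has_field_derivative (\<Sum>j=1..N. c j * z ^ (j - 1))) (at z)"
      unfolding g_def by (auto intro!: derivative_eq_intros sum.cong)
    then have "(f has_field_derivative f z * (\<Sum>j=1..N. c j * z ^ (j - 1))) (at z)"
      unfolding f_def by (auto intro!: derivative_eq_intros)
    moreover have "(\<Sum>j=1..N. c j * z ^ (j - 1)) = (\<Sum>j<N. c (Suc j) * z ^ j)"
      by (rule sum.reindex_bij_witness[of _ Suc "\<lambda>j. j - 1"]) auto
    ultimately show ?thesis by (simp add: DERIV_imp_deriv mult.commute)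
  qed
  then have "deriv f = (\<lambda>z. (\<Sum>j<N. c (Suc j) * z ^ j) * f z)" by auto
  moreover have "(\<lambda>z. (\<Sum>j<N. c (Suc j) * z ^ j) * f z) has_fps_expansion G * F"
    unfolding G_def by (intro fps_expansion_intros fF)
  ultimately have dF: "fps_deriv F = G * F"
    using has_fps_expansion_deriv[OF fF] fps_expansion_unique_complex by metis
  have "fps_nth G i = c (Suc i)" for i
    using c[of "Suc i"] by (auto simp: G_def fps_sum_nth fps_X_power_nth if_distrib[of "\<lambda>x. _ * x"] cong: if_cong)
  then have rec: "of_nat (Suc k) * fps_nth F (Suc k) = (\<Sum>i\<le>k. c (Suc i) * fps_nth F (k - i))" for k
    using arg_cong[OF dF, of "\<lambda>H. fps_nth H k"] by (simp add: fps_mult_nth atLeast0AtMost)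
  have "fps_nth F 0 = f 0" using has_fps_expansion_imp_0_eq_fps_nth_0[OF fF] by simp
  also have "\<dots> = 1" by (simp add: f_def g_def power_0_left sum.neutral)
  finally have F0: "fps_nth F 0 = 1" .
  have F: "fps_nth F k = expcoef c k" for k
  proof (induction k rule: less_induct)
    case (less k)
    show ?case
    proof (cases k)
      case (Suc j)
      have "of_nat (Suc j) * fps_nth F (Suc j) = of_nat (Suc j) * expcoef c (Suc j)"
        unfolding rec expcoef_Suc using less Suc by (intro sum.cong) auto
      then show ?thesis using of_nat_neq_0[of j, where 'a=complex] Suc mult_left_cancel by blast
    qed (simp add: F0)
  qed
  have "(\<lambda>k. fps_nth F k * z ^ k) sums f z"
    by (rule has_fps_expansion_imp_sums_complex[OF fF, where r=\<infinity>]) (auto intro: hol)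
  then show ?thesis by (simp add: F f_def g_def)
qed

text \<open>The power series converges at 2, hence absolutely at 1.\<close>

lemma expcoef_norm_summable:
  fixes c :: "nat \<Rightarrow> complex"
  assumes c: "\<And>j. j > N \<Longrightarrow> c j = 0"
  shows "summable (\<lambda>k. norm (expcoef c k))"
  using powser_insidea[of "expcoef c" "2::complex" 1] sums_summable[OF expcoef_sums[OF c, where z=2]]
  by simp

lemma expcoef_real_sums:
  fixes b :: "nat \<Rightarrow> real"
  assumes b: "\<And>j. j > N \<Longrightarrow> b j = 0"
  shows "expcoef b sums exp (\<Sum>j=1..N. b j / real j)"
proof -
  have "(\<lambda>k. cplx (expcoef b k)) sums cplx (exp (\<Sum>j=1..N. b j / real j))"
    using expcoef_sums[of N "\<lambda>j. cplx (b j)" 1] b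
    by (simp add: expcoef_of_real exp_of_real[symmetric])
  then show ?thesis by (simp only: sums_of_real_iff)
qed

text \<open>Cauchy--Schwarz on the k + 1 summands of the recursion costs a factor k + 1, which is
  exactly the denominator in the recursion for the squared moduli.\<close>

lemma expcoef_norm_le:
  fixes c :: "nat \<Rightarrow> complex"
  shows "(norm (expcoef c k))\<^sup>2 \<le> expcoef (\<lambda>j. (norm (c j))\<^sup>2) k"
proof (induction k rule: less_induct)
  case (less k)
  define b where "b j = (norm (c j))\<^sup>2" for j
  show ?case
  proof (cases k)
    case (Suc j)
    have "norm (of_nat (Suc j) * expcoef c (Suc j)) \<le> (\<Sum>l\<le>j. norm (c (Suc l) * expcoef c (j - l)))"
      unfolding expcoef_Suc by (rule norm_sum)
    then have "(norm (of_nat (Suc j) * expcoef c (Suc j)))\<^sup>2 \<le> (\<Sum>l\<le>j. 1 * norm (c (Suc l) * expcoef c (j - l)))\<^sup>2"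
      by (intro power_mono) auto
    also have "\<dots> \<le> (\<Sum>l\<le>j. 1\<^sup>2) * (\<Sum>l\<le>j. (norm (c (Suc l) * expcoef c (j - l)))\<^sup>2)"
      by (rule Cauchy_Schwarz_ineq_sum)
    also have "\<dots> \<le> of_nat (Suc j) * (\<Sum>l\<le>j. b (Suc l) * expcoef b (j - l))"
    proof -
      have "(norm (c (Suc l) * expcoef c (j - l)))\<^sup>2 \<le> b (Suc l) * expcoef b (j - l)" if "l \<le> j" for l
        unfolding norm_mult power_mult_distrib b_def using less[of "j - l"] Suc by (intro mult_left_mono) auto
      then show ?thesis by (intro mult_mono sum_mono sum_nonneg) auto
    qed
    also have "\<dots> = (of_nat (Suc j))\<^sup>2 * expcoef b (Suc j)"
      by (simp only: expcoef_Suc[symmetric] power2_eq_square mult.assoc)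
    finally show ?thesis unfolding Suc norm_mult power_mult_distrib b_def by (simp del: of_nat_Suc)
  qed simp
qed

text \<open>The inductive proof of the bound is an equality exactly when all Cauchy--Schwarz steps are,
  which forces a geometric sequence.\<close>

lemma expcoef_equality:
  fixes c :: "nat \<Rightarrow> complex"
  assumes eq: "\<And>k. (norm (expcoef c k))\<^sup>2 = expcoef (\<lambda>j. (norm (c j))\<^sup>2) k"
  shows "c (Suc k) = c 1 ^ Suc k"
proof -
  define b where "b j = (norm (c j))\<^sup>2" for j
  have const: "c (Suc l) * expcoef c (k - l) = expcoef c (Suc k)" if l: "l \<le> k" for l k
  proof -
    define v where "v l = c (Suc l) * expcoef c (k - l)" for l
    define e where "e = expcoef c (Suc k)"
    have sv: "(\<Sum>l\<le>k. v l) = of_nat (Suc k) * e"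
      unfolding v_def e_def expcoef_Suc ..
    have "(\<Sum>l\<le>k. (norm (v l))\<^sup>2) = (\<Sum>l\<le>k. b (Suc l) * expcoef b (k - l))"
      unfolding v_def norm_mult power_mult_distrib b_def eq ..
    also have "\<dots> = of_nat (Suc k) * (norm e)\<^sup>2"
      unfolding e_def eq b_def expcoef_Suc ..
    finally have sn: "(\<Sum>l\<le>k. (norm (v l))\<^sup>2) = of_nat (Suc k) * (norm e)\<^sup>2" .
    \<comment> \<open>Here \<open>e\<close> is the mean of the \<open>v l\<close>. Equality in
      Cauchy--Schwarz makes their total squared deviation from it vanish.\<close>
    have "(\<Sum>l\<le>k. (norm (v l - e))\<^sup>2) = (\<Sum>l\<le>k. (norm (v l))\<^sup>2 + (norm e)\<^sup>2 - 2 * Re (v l * cnj e))"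
      by (intro sum.cong refl) (unfold cmod_power2, simp add: power2_eq_square algebra_simps)
    also have "\<dots> = of_nat (Suc k) * (norm e)\<^sup>2 + of_nat (Suc k) * (norm e)\<^sup>2 - 2 * Re ((\<Sum>l\<le>k. v l) * cnj e)"
      by (simp add: sum.distrib sum_subtractf sn sum_distrib_left[symmetric] sum_distrib_right)
    also have "Re ((\<Sum>l\<le>k. v l) * cnj e) = of_nat (Suc k) * (norm e)\<^sup>2"
      unfolding sv cmod_power2 by (simp add: power2_eq_square algebra_simps)
    finally have "(\<Sum>l\<le>k. (norm (v l - e))\<^sup>2) = 0" by simp
    then have "v l = e" using l by (subst (asm) sum_nonneg_eq_0_iff) auto
    then show ?thesis by (simp add: v_def e_def)
  qed
  show ?thesis
  proof (induction k)
    case (Suc k)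
    \<comment> \<open>The first and the last summand of the same recursion are equal.\<close>
    have "c (Suc (Suc k)) = c (Suc 0) * expcoef c (Suc k)"
      using const[of "Suc k" "Suc k"] const[of 0 "Suc k"] by simp
    also have "expcoef c (Suc k) = c (Suc k)" using const[of k k] by simp
    finally show ?case using Suc by simp
  qed simp
qed

lemma norm_sum_ech_squared:
  "cplx ((norm (\<Sum>k<n. b k * ech (int (m * k)) x))\<^sup>2) =
    (\<Sum>k<n. \<Sum>l<n. b k * cnj (b l) * ech (int (m * k) - int (m * l)) x)"
  unfolding complex_norm_square cnj_sum sum_product complex_cnj_mult cnj_ech
  by (intro sum.cong refl) (simp add: ech_mult[symmetric] diff_conv_add_uminus del: add_uminus_conv_diff)

lemma Parseval_sum:
  assumes "m > 0"
  shows "(\<integral>x. (norm (\<Sum>k<n. b k * ech (int (m * k)) x))\<^sup>2 \<partial>LT) = (\<Sum>k<n. (norm (b k))\<^sup>2)"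
proof -
  have "cplx (\<integral>x. (norm (\<Sum>k<n. b k * ech (int (m * k)) x))\<^sup>2 \<partial>LT)
     = (\<integral>x. cplx ((norm (\<Sum>k<n. b k * ech (int (m * k)) x))\<^sup>2) \<partial>LT)"
    by (rule integral_complex_of_real[symmetric])
  also have "\<dots> = (\<integral>x. (\<Sum>k<n. \<Sum>l<n. b k * cnj (b l) * ech (int (m * k) - int (m * l)) x) \<partial>LT)"
    unfolding norm_sum_ech_squared ..
  also have "\<dots> = (\<Sum>k<n. \<Sum>l<n. b k * cnj (b l) * (if k = l then 1 else 0))"
    using assms by (simp add: Bochner_Integration.integral_sum integral_ech flip: of_nat_mult)
  also have "\<dots> = (\<Sum>k<n. b k * cnj (b k))"
    by (intro sum.cong refl) (simp add: if_distrib[of "\<lambda>x. _ * x"] cong: if_cong)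
  also have "\<dots> = cplx (\<Sum>k<n. (norm (b k))\<^sup>2)"
    by (simp add: complex_norm_square del: of_real_power)
  finally show ?thesis by (simp only: of_real_eq_iff)
qed

text \<open>The integrand is |exp S|^2 for the sum S inside, so by Parseval the integral is the sum
  of the |\<open>expcoef c i\<close>|^2. Bounding them termwise by \<open>expcoef_norm_le\<close>
  gives exp of the weighted sum; the loss at the single index \<open>k\<close> is retained.\<close>

lemma Lebedev_Milin:
  fixes c :: "nat \<Rightarrow> complex"
  assumes c: "\<And>j. j > N \<Longrightarrow> c j = 0" and m: "m > 0"
  shows "(\<integral>x. exp (2 * Re (\<Sum>j=1..N. c j * ech (int (m * j)) x / of_nat j)) \<partial>LT)
    \<le> exp (\<Sum>j=1..N. (norm (c j))\<^sup>2 / real j)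
       - (expcoef (\<lambda>j. (norm (c j))\<^sup>2) k - (norm (expcoef c k))\<^sup>2)" (is "?I \<le> _")
proof -
  let ?S = "\<lambda>x. \<Sum>j=1..N. c j * ech (int (m * j)) x / of_nat j"
  define b where "b = expcoef c"
  define \<gamma> where "\<gamma> = expcoef (\<lambda>j. (norm (c j))\<^sup>2)"
  define S where "S n x = (\<Sum>k<n. b k * ech (int (m * k)) x)" for n x
  define B where "B = (\<Sum>k. norm (b k))"
  have sb: "summable (\<lambda>k. norm (b k))" unfolding b_def by (rule expcoef_norm_summable[OF c])
  have lim: "(\<lambda>n. S n x) \<longlonglongrightarrow> exp (?S x)" for x
    using expcoef_sums[OF c, where z="ech (int m) x"] unfolding sums_def S_def b_def by (simp add: ech_power)
  have bd: "norm (S n x) \<le> B" for n x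
  proof -
    have "norm (S n x) \<le> (\<Sum>k<n. norm (b k))" unfolding S_def by (rule sum_norm_le) (simp add: norm_mult)
    also have "\<dots> \<le> B" unfolding B_def by (rule sum_le_suminf[OF sb]) auto
    finally show ?thesis .
  qed
  have [measurable]: "S n \<in> borel_measurable LT" for n unfolding S_def by measurable
  have "(\<lambda>n. \<integral>x. (norm (S n x))\<^sup>2 \<partial>LT) \<longlonglongrightarrow> (\<integral>x. (norm (exp (?S x)))\<^sup>2 \<partial>LT)"
  proof (rule integral_dominated_convergence[where w="\<lambda>x. B\<^sup>2"])
    show "AE x in LT. (\<lambda>n. (norm (S n x))\<^sup>2) \<longlonglongrightarrow> (norm (exp (?S x)))\<^sup>2"
      by (intro AE_I2 tendsto_intros lim)
    show "AE x in LT. norm ((norm (S n x))\<^sup>2) \<le> B\<^sup>2" for n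
      using bd by (auto intro!: power_mono)
  qed auto
  moreover have "(norm (exp z))\<^sup>2 = exp (2 * Re z)" for z
    by (simp add: exp_double[symmetric])
  ultimately have l1: "(\<lambda>n. \<Sum>k<n. (norm (b k))\<^sup>2) \<longlonglongrightarrow> ?I"
    unfolding S_def by (simp only: Parseval_sum[OF m])
  have \<gamma>: "\<gamma> sums exp (\<Sum>j=1..N. (norm (c j))\<^sup>2 / real j)"
    unfolding \<gamma>_def using c by (intro expcoef_real_sums) simp
  have le: "(norm (b i))\<^sup>2 \<le> \<gamma> i" for i unfolding b_def \<gamma>_def by (rule expcoef_norm_le)
  have ev: "\<forall>n\<ge>Suc k. (\<Sum>i<n. (norm (b i))\<^sup>2) \<le> (\<Sum>i<n. \<gamma> i) - (\<gamma> k - (norm (b k))\<^sup>2)"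
  proof (intro allI impI)
    fix n assume "Suc k \<le> n"
    then have "\<gamma> k - (norm (b k))\<^sup>2 \<le> (\<Sum>i<n. \<gamma> i - (norm (b i))\<^sup>2)"
      using le by (intro member_le_sum) auto
    then show "(\<Sum>i<n. (norm (b i))\<^sup>2) \<le> (\<Sum>i<n. \<gamma> i) - (\<gamma> k - (norm (b k))\<^sup>2)"
      by (simp add: sum_subtractf)
  qed
  have "?I \<le> exp (\<Sum>j=1..N. (norm (c j))\<^sup>2 / real j) - (\<gamma> k - (norm (b k))\<^sup>2)"
    by (rule LIMSEQ_le[OF l1 tendsto_diff[OF \<gamma>[unfolded sums_def] tendsto_const]]) (use ev in blast)
  then show ?thesis by (simp add: b_def \<gamma>_def)
qed

subsection \<open>Entropy and energy of densities\<close>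

lemma Tor_in_LT [simp, measurable]: "Tor \<in> sets LT"
  by (simp add: sets_LT_iff)

lemma prob_Tor [simp]: "measure LT Tor = 1" "emeasure LT Tor = 1"
  using LT.prob_space LT.emeasure_space_1 by simp_all

text \<open>The Legendre pair x ln x and exp (\<phi> - 1), obtained from ln t \<le> t - 1 at t = exp
  (\<phi> - 1) / x.\<close>

lemma Young_entropy:
  fixes x \<phi> :: real
  assumes "0 \<le> x" shows "\<phi> * x \<le> x * ln x + exp (\<phi> - 1)"
proof (cases "x = 0")
  case False
  then have x: "x > 0" using assms by simp
  have "ln (exp (\<phi> - 1) / x) \<le> exp (\<phi> - 1) / x - 1"
    using x by (intro ln_le_minus_one) auto
  then have "\<phi> - ln x \<le> exp (\<phi> - 1) / x" using x by (simp add: ln_div)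
  then have "(\<phi> - ln x) * x \<le> exp (\<phi> - 1)" using x by (simp add: pos_le_divide_eq)
  then show ?thesis by (simp add: algebra_simps)
qed auto

lemma xlnx_ge: "0 \<le> x \<Longrightarrow> - 1 \<le> x * ln x" for x :: real
proof -
  assume "0 \<le> x"
  then have "0 * x \<le> x * ln x + exp (0 - 1)" by (rule Young_entropy)
  moreover have "exp (0 - 1) \<le> (1::real)" by simp
  ultimately show ?thesis by linarith
qed

text \<open>The pointwise form of relative entropy dominating the squared Hellinger distance: ln t
  \<le> t - 1 at t = 1 / sqrt x.\<close>

lemma xlnx_sqrt:
  fixes x :: real
  assumes "0 \<le> x" shows "(sqrt x - 1)\<^sup>2 \<le> x * ln x - x + 1"
proof (cases "x = 0")
  case False
  then have x: "x > 0" using assms by simp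
  have s: "sqrt x > 0" "sqrt x * sqrt x = x" using x by auto
  have "ln (1 / sqrt x) \<le> 1 / sqrt x - 1" using s by (intro ln_le_minus_one) auto
  then have "- (ln x / 2) \<le> 1 / sqrt x - 1" using x by (simp add: ln_div ln_sqrt)
  then have "x * (1 - 1 / sqrt x) \<le> x * (ln x / 2)" using x by (intro mult_left_mono) auto
  moreover have "x / sqrt x = sqrt x" using s by (metis nonzero_mult_div_cancel_left less_irrefl)
  ultimately have "2 * (x - sqrt x) \<le> x * ln x" by (simp add: algebra_simps)
  then show ?thesis using x by (simp add: power2_eq_square algebra_simps)
qed simp

text \<open>A substitute for Pinsker's inequality. With s = |sqrt x - 1| the left side is at most
  s^2 + 2 s, and splitting 2 s with a free \<epsilon> keeps the bound linear in the entropy density,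
  ready to be integrated.\<close>

lemma abs_le_xlnx:
  fixes x :: real
  assumes "0 \<le> x" and e: "0 < \<epsilon>" shows "\<bar>x - 1\<bar> \<le> \<epsilon> + (1 + 1 / \<epsilon>) * (x * ln x - x + 1)"
proof -
  define s where "s = \<bar>sqrt x - 1\<bar>"
  have "x - 1 = (sqrt x - 1) * (sqrt x + 1)" using assms by (simp add: algebra_simps)
  then have "\<bar>x - 1\<bar> = s * \<bar>sqrt x + 1\<bar>" by (simp add: s_def abs_mult)
  also have "\<dots> \<le> s * (s + 2)" by (intro mult_left_mono) (auto simp: s_def assms)
  also have "\<dots> = s\<^sup>2 + 2 * s" by (simp add: power2_eq_square algebra_simps)
  also have "2 * s \<le> s\<^sup>2 / \<epsilon> + \<epsilon>"
  proof -
    have "0 \<le> (s - \<epsilon>)\<^sup>2 / \<epsilon>" using e by simp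
    then show ?thesis using e by (simp add: power2_eq_square field_simps)
  qed
  also have "s\<^sup>2 + (s\<^sup>2 / \<epsilon> + \<epsilon>) = \<epsilon> + (1 + 1 / \<epsilon>) * s\<^sup>2" by (simp add: algebra_simps)
  also have "s\<^sup>2 \<le> x * ln x - x + 1" using xlnx_sqrt[OF assms(1)] by (simp add: s_def)
  finally show ?thesis using e by (simp add: mult_left_mono)
qed

text \<open>Only 0 needs an argument. There \<open>xlnx_sqrt\<close> controls the negative part by 2
  sqrt y and ln y \<le> y - 1 the positive part.\<close>

lemma continuous_xlnx: "continuous_on {0..} (\<lambda>x::real. x * ln x)"
proof -
  have "((\<lambda>x. x * ln x) \<longlongrightarrow> x * ln x) (at x within {0..})" if "x \<ge> 0" for x :: real
  proof (cases "x = 0")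
    case False
    then show ?thesis using that by (intro tendsto_intros) auto
  next
    case True
    have "norm (y * ln y) \<le> 2 * sqrt y + \<bar>y\<bar> * \<bar>y - 1\<bar>" if "y \<in> {0..}" for y :: real
    proof (cases "y = 0")
      case False
      then have y: "y > 0" using that by simp
      have "ln y \<le> y - 1" using y by (rule ln_le_minus_one)
      then have "y * ln y \<le> y * (y - 1)" using y by (intro mult_left_mono) auto
      moreover have "y * (y - 1) \<le> \<bar>y\<bar> * \<bar>y - 1\<bar>" by (metis abs_ge_self abs_mult)
      moreover have "- (y * ln y) \<le> 2 * sqrt y"
      proof -
        have "(sqrt y - 1)\<^sup>2 \<le> y * ln y - y + 1" using xlnx_sqrt that by auto
        then show ?thesis using y by (simp add: power2_eq_square algebra_simps)
      qed
      moreover have "0 \<le> \<bar>y\<bar> * \<bar>y - 1\<bar>" "0 \<le> sqrt y" using y by auto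
      ultimately show ?thesis unfolding real_norm_def by linarith
    qed simp
    then have "\<forall>\<^sub>F y in at 0 within {0..}. norm (y * ln y) \<le> 2 * sqrt y + \<bar>y\<bar> * \<bar>y - 1\<bar>"
      by (auto simp: eventually_at_filter)
    moreover have "((\<lambda>y::real. 2 * sqrt y + \<bar>y\<bar> * \<bar>y - 1\<bar>) \<longlongrightarrow> 2 * sqrt 0 + \<bar>0\<bar> * \<bar>0 - 1\<bar>) (at 0 within {0..})"
      by (intro tendsto_intros)
    ultimately have "((\<lambda>y. y * ln y) \<longlongrightarrow> (0::real)) (at 0 within {0..})"
      by (intro Lim_null_comparison[of "\<lambda>y. y * ln y" "\<lambda>y. 2 * sqrt y + \<bar>y\<bar> * \<bar>y - 1\<bar>"]) auto
    then show ?thesis using True by simp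
  qed
  then show ?thesis by (auto simp: continuous_on_def)
qed

lemma tendsto_xlnx:
  fixes x :: "nat \<Rightarrow> real"
  assumes "x \<longlonglongrightarrow> l" "\<And>n. 0 \<le> x n"
  shows "(\<lambda>n. x n * ln (x n)) \<longlonglongrightarrow> l * ln l"
  using continuous_on_tendsto_compose[OF continuous_xlnx assms(1)] assms LIMSEQ_le_const[OF assms(1), of 0] by auto

section \<open>Entropy as a real number\<close>

lemma ereal_integral:
  assumes "integrable M g"
  shows "enn2ereal (\<integral>\<^sup>+x. ennreal (g x) \<partial>M) - enn2ereal (\<integral>\<^sup>+x. ennreal (- g x) \<partial>M) = ereal (\<integral>x. g x \<partial>M)"
proof -
  have "(\<integral>\<^sup>+x. ennreal (g x) \<partial>M) < \<infinity>" "(\<integral>\<^sup>+x. ennreal (- g x) \<partial>M) < \<infinity>"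
    using real_integrable_def[of M g] assms by (auto simp: less_top)
  then have "enn2ereal (\<integral>\<^sup>+x. ennreal (g x) \<partial>M) = ereal (enn2real (\<integral>\<^sup>+x. ennreal (g x) \<partial>M))"
    "enn2ereal (\<integral>\<^sup>+x. ennreal (- g x) \<partial>M) = ereal (enn2real (\<integral>\<^sup>+x. ennreal (- g x) \<partial>M))"
    by (metis ennreal_enn2real enn2ereal_ennreal enn2real_nonneg infinity_ennreal_def)+
  then show ?thesis by (simp add: real_lebesgue_integral_def[OF assms])
qed

abbreviation finite_ent :: "(real \<Rightarrow> real) \<Rightarrow> bool" where
  "finite_ent q \<equiv> integrable LT (\<lambda>x. q x * ln (q x))"

definition Ent :: "(real \<Rightarrow> real) \<Rightarrow> real" where
  "Ent q = (\<integral>x. q x * ln (q x) \<partial>LT)"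

lemma densityD:
  assumes "is_density q"
  shows "q \<in> borel_measurable LT" "AE x in LT. 0 \<le> q x" "integrable LT q" "(\<integral>x. q x \<partial>LT) = 1"
  using assms by (auto simp: is_density_def)

lemma entropy_eq_Ent: "finite_ent q \<Longrightarrow> entropy q = ereal (Ent q)"
  unfolding entropy_def Ent_def by (rule ereal_integral)

text \<open>When \<open>abs_le_xlnx\<close> is integrated, the contributions of - q and 1 cancel
  because \<open>q\<close> has mass 1.\<close>

lemma Ent_L1:
  assumes q: "is_density q" and int: "finite_ent q" and e: "\<epsilon> > 0"
  shows "(\<integral>x. \<bar>q x - 1\<bar> \<partial>LT) \<le> \<epsilon> + (1 + 1 / \<epsilon>) * Ent q"
proof -
  note d = densityD[OF q]
  have "(\<integral>x. \<bar>q x - 1\<bar> \<partial>LT) \<le> (\<integral>x. \<epsilon> + (1 + 1 / \<epsilon>) * (q x * ln (q x) - q x + 1) \<partial>LT)"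
  proof (rule integral_mono_AE)
    show "AE x in LT. \<bar>q x - 1\<bar> \<le> \<epsilon> + (1 + 1 / \<epsilon>) * (q x * ln (q x) - q x + 1)"
      using d(2) by eventually_elim (rule abs_le_xlnx[OF _ e])
  qed (use d int in auto)
  also have "\<dots> = \<epsilon> + (1 + 1 / \<epsilon>) * Ent q"
    using d int by (simp add: Ent_def LT.prob_space)
  finally show ?thesis .
qed

lemma Ent_nonneg:
  assumes q: "is_density q" and int: "finite_ent q"
  shows "0 \<le> Ent q"
proof -
  note d = densityD[OF q]
  have "0 \<le> (\<integral>x. q x * ln (q x) - q x + 1 \<partial>LT)"
  proof (rule integral_nonneg_AE)
    show "AE x in LT. 0 \<le> q x * ln (q x) - q x + 1"
      using d(2)
    proof eventually_elim
      case (elim x)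
      then show ?case using xlnx_sqrt[of "q x"] zero_le_power2[of "sqrt (q x) - 1"] by linarith
    qed
  qed
  also have "\<dots> = Ent q"
    using d int by (simp add: Ent_def LT.prob_space)
  finally show ?thesis .
qed

lemma L1_zero_imp_AE_one:
  assumes q: "is_density q" and "(\<integral>x. \<bar>q x - 1\<bar> \<partial>LT) \<le> 0"
  shows "AE x in LT. q x = 1"
proof -
  have i: "integrable LT (\<lambda>x. \<bar>q x - 1\<bar>)" using densityD[OF q] by auto
  have "0 \<le> (\<integral>x. \<bar>q x - 1\<bar> \<partial>LT)" by (rule Bochner_Integration.integral_nonneg) simp
  then have "(\<integral>x. \<bar>q x - 1\<bar> \<partial>LT) = 0" using assms by linarith
  then have "AE x in LT. \<bar>q x - 1\<bar> = 0" using integral_nonneg_eq_0_iff_AE[OF i] by auto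
  then show ?thesis by auto
qed

lemma Ent_zero_imp_AE_one:
  assumes q: "is_density q" and int: "finite_ent q" and "Ent q \<le> 0"
  shows "AE x in LT. q x = 1"
proof (rule L1_zero_imp_AE_one[OF q], rule field_le_epsilon)
  fix e :: real assume e: "0 < e"
  have "(\<integral>x. \<bar>q x - 1\<bar> \<partial>LT) \<le> e + (1 + 1 / e) * Ent q" by (rule Ent_L1[OF q int e])
  also have "(1 + 1 / e) * Ent q \<le> 0" using e assms(3) by (intro mult_nonneg_nonpos) auto
  finally show "(\<integral>x. \<bar>q x - 1\<bar> \<partial>LT) \<le> 0 + e" by simp
qed

text \<open>Since x ln x \<ge> -1 on a probability space, the negative part is finite;
  non-integrability can only come from the positive part.\<close>

lemma entropy_cases:
  assumes q: "is_density q"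
  obtains "entropy q = \<infinity>" | "finite_ent q" "entropy q = ereal (Ent q)" "0 \<le> Ent q"
proof (cases "finite_ent q")
  case True
  then show ?thesis using that(2) entropy_eq_Ent Ent_nonneg[OF q] by blast
next
  case False
  note d = densityD[OF q]
  have [measurable]: "q \<in> borel_measurable LT" using d by simp
  have "(\<integral>\<^sup>+x. ennreal (- (q x * ln (q x))) \<partial>LT) \<le> (\<integral>\<^sup>+x. 1 \<partial>LT)"
    by (rule nn_integral_mono_AE) (use d(2) in \<open>eventually_elim; use xlnx_ge in \<open>force\<close>\<close>)
  also have "\<dots> < \<infinity>" by (simp add: LT.emeasure_space_1[simplified])
  finally have neg: "(\<integral>\<^sup>+x. ennreal (- (q x * ln (q x))) \<partial>LT) < \<infinity>" .
  have "(\<integral>\<^sup>+x. ennreal (q x * ln (q x)) \<partial>LT) = \<infinity>"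
    using False neg by (auto simp: real_integrable_def)
  then have "entropy q = \<infinity>"
    unfolding entropy_def using neg by (simp add: ereal_minus_eq_PInfty_iff)
  then show ?thesis by (rule that(1))
qed

section \<open>Product densities and the energy\<close>

lemma AE_fst_LT: assumes "AE x in LT. P x" shows "AE z in LL. P (fst z)"
proof -
  obtain N where N: "N \<in> null_sets LT" "{x \<in> space LT. \<not> P x} \<subseteq> N"
    using assms by (auto simp: eventually_ae_filter)
  have "N \<times> space LT \<in> null_sets LL"
    using N by (auto simp: null_sets_def LT.emeasure_pair_measure_Times simp del: space_LT)
  moreover have "{z \<in> space LL. \<not> P (fst z)} \<subseteq> N \<times> space LT"
    using N by (auto simp: space_pair_measure)
  ultimately show ?thesis by (rule AE_I')
qed

lemma AE_snd_LT: assumes "AE x in LT. P x" shows "AE z in LL. P (snd z)"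
proof -
  obtain N where N: "N \<in> null_sets LT" "{x \<in> space LT. \<not> P x} \<subseteq> N"
    using assms by (auto simp: eventually_ae_filter)
  have "space LT \<times> N \<in> null_sets LL"
    using N by (auto simp: null_sets_def LT.emeasure_pair_measure_Times simp del: space_LT)
  moreover have "{z \<in> space LL. \<not> P (snd z)} \<subseteq> space LT \<times> N"
    using N by (auto simp: space_pair_measure)
  ultimately show ?thesis by (rule AE_I')
qed

lemma prob_space_dmeas:
  assumes q: "is_density q" shows "prob_space (dmeas q)"
proof (rule prob_spaceI)
  note d = densityD[OF q]
  have [measurable]: "q \<in> borel_measurable LT" using d by simp
  have "emeasure (dmeas q) (space (dmeas q)) = (\<integral>\<^sup>+x. ennreal (q x) \<partial>LT)"
    unfolding dmeas_def by (subst emeasure_density) (auto intro!: nn_integral_cong simp: indicator_def)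
  also have "\<dots> = ennreal (\<integral>x. q x \<partial>LT)" using d by (intro nn_integral_eq_integral) auto
  finally show "emeasure (dmeas q) (space (dmeas q)) = 1" using d by simp
qed

lemma dmeas_PT: "is_density q \<Longrightarrow> dmeas q \<in> PT"
  using prob_space_dmeas by (simp add: PT_def dmeas_def)

lemma integral_dmeas:
  fixes f :: "real \<Rightarrow> real"
  assumes q: "is_density q" and [measurable]: "f \<in> borel_measurable borel"
  shows "(\<integral>x. f x \<partial>(dmeas q)) = (\<integral>x. q x * f x \<partial>LT)"
  unfolding dmeas_def using densityD[OF q] measurable_LT_borel[of f]
  by (subst integral_density) auto

lemma integrable_density_prod:
  fixes p q :: "real \<Rightarrow> real"
  assumes "integrable LT p" "integrable LT q"
  shows "integrable LL (\<lambda>z. p (fst z) * q (snd z))"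
  by (rule LT2.Fubini_integrable) (use assms in \<open>auto simp: abs_mult\<close>)

lemma integral_density_prod:
  fixes p q :: "real \<Rightarrow> real"
  assumes "integrable LT p" "integrable LT q"
  shows "(\<integral>z. p (fst z) * q (snd z) \<partial>LL) = (\<integral>x. p x \<partial>LT) * (\<integral>x. q x \<partial>LT)"
  using LT2.integral_fst'[OF integrable_density_prod[OF assms]] by simp

text \<open>One-sided on purpose: upper semicontinuity yields a bound from above, and from below
  \<open>W\<close> is only integrable.\<close>

locale potential_bdd = potential +
  fixes C :: real
  assumes W_le: "\<And>x. W x \<le> C" and C_nonneg: "0 \<le> C"
begin

text \<open>The upper bound on \<open>W\<close> makes the positive part of the kernel integrable, so
  an energy that is not a real number can only be minus infinity.\<close>

lemma energy_cases:
  assumes q: "is_density q"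
  obtains "energy W (dmeas q) = -\<infinity>"
    "\<not> integrable LL (ker W q q)"
  | "integrable LL (ker W q q)"
    "energy W (dmeas q) = ereal (bil W q q)" "bil W q q \<le> C"
proof -
  note d = densityD[OF q]
  have [measurable]: "q \<in> borel_measurable LT" using d by simp
  define g where "g z = ker W q q z" for z
  have [measurable]: "g \<in> borel_measurable LL" unfolding g_def by measurable
  have AE2: "AE z in LL. 0 \<le> q (fst z) \<and> 0 \<le> q (snd z)"
    using AE_fst_LT[OF d(2)] AE_snd_LT[OF d(2)] by eventually_elim simp
  have pm: "dmeas q \<Otimes>\<^sub>M dmeas q = density LL (\<lambda>(x, y). ennreal (q x) * ennreal (q y))"
  proof -
    interpret D: prob_space "density LT (\<lambda>x. ennreal (q x))"
      using prob_space_dmeas[OF q] by (simp add: dmeas_def)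
    show ?thesis unfolding dmeas_def
      by (rule pair_measure_density) (auto intro: LT.sigma_finite_measure_axioms D.sigma_finite_measure_axioms)
  qed
  \<comment> \<open>The sign \<open>s\<close> handles the positive and the negative part of the
    energy together, with s = 1 and s = -1.\<close>
  have nn: "(\<integral>\<^sup>+z. ennreal (s * W (fst z - snd z)) \<partial>(dmeas q \<Otimes>\<^sub>M dmeas q)) = (\<integral>\<^sup>+z. ennreal (s * g z) \<partial>LL)" for s
  proof -
    have "(\<integral>\<^sup>+z. ennreal (s * W (fst z - snd z)) \<partial>(dmeas q \<Otimes>\<^sub>M dmeas q))
       = (\<integral>\<^sup>+z. (ennreal (q (fst z)) * ennreal (q (snd z))) * ennreal (s * W (fst z - snd z)) \<partial>LL)"
      unfolding pm by (subst nn_integral_density) (auto simp: case_prod_unfold)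
    also have "\<dots> = (\<integral>\<^sup>+z. ennreal (s * g z) \<partial>LL)"
    proof (rule nn_integral_cong_AE)
      show "AE z in LL. ennreal (q (fst z)) * ennreal (q (snd z)) * ennreal (s * W (fst z - snd z)) = ennreal (s * g z)"
        using AE2
      proof eventually_elim
        case (elim z)
        then show ?case
          by (simp add: g_def ennreal_mult'[symmetric] mult_ac flip: ennreal_mult)
      qed
    qed
    finally show ?thesis .
  qed
  have en: "energy W (dmeas q) = enn2ereal (\<integral>\<^sup>+z. ennreal (g z) \<partial>LL) - enn2ereal (\<integral>\<^sup>+z. ennreal (- g z) \<partial>LL)"
    unfolding energy_def using nn[of 1] nn[of "-1"] by simp
  have qq: "integrable LL (\<lambda>z. q (fst z) * q (snd z))" using d by (intro integrable_density_prod)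
  have gle: "AE z in LL. g z \<le> C * (q (fst z) * q (snd z))"
    using AE2
  proof eventually_elim
    case (elim z)
    then show ?case unfolding g_def mult.assoc using W_le by (intro mult_right_mono) auto
  qed
  have "(\<integral>\<^sup>+z. ennreal (g z) \<partial>LL) \<le> (\<integral>\<^sup>+z. ennreal (norm (C * (q (fst z) * q (snd z)))) \<partial>LL)"
    by (rule nn_integral_mono_AE) (use gle in \<open>eventually_elim; auto intro!: ennreal_leI\<close>)
  also have "\<dots> < \<infinity>"
    using integrable_mult_right[OF qq, of C] unfolding integrable_iff_bounded by blast
  finally have pos: "(\<integral>\<^sup>+z. ennreal (g z) \<partial>LL) < \<infinity>" .
  show ?thesis
  proof (cases "integrable LL g")
    case True
    have "bil W q q = (\<integral>z. g z \<partial>LL)" by (simp add: bil_def g_def)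
    moreover have "\<dots> \<le> (\<integral>z. C * (q (fst z) * q (snd z)) \<partial>LL)"
      using qq gle True by (intro integral_mono_AE) auto
    moreover have "\<dots> = C" using d integral_density_prod[of q q] by simp
    ultimately have "bil W q q \<le> C" "energy W (dmeas q) = ereal (bil W q q)"
      using en ereal_integral[OF True] by auto
    then show ?thesis using that(2) True by (simp add: g_def[abs_def])
  next
    case False
    then have "(\<integral>\<^sup>+z. ennreal (- g z) \<partial>LL) = \<infinity>"
      using pos by (auto simp: real_integrable_def)
    then have "energy W (dmeas q) = -\<infinity>"
      unfolding en using pos by (cases "\<integral>\<^sup>+z. ennreal (g z) \<partial>LL" rule: ennreal_cases) auto
    then show ?thesis using False that(1) by (simp add: g_def[abs_def])
  qed
qed

end

subsection \<open>Approximation by trigonometric polynomials\<close>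

lemma continuous_periodic_bounded:
  fixes f :: "real \<Rightarrow> real"
  assumes "continuous_on UNIV f" "\<And>x. f (x + 1) = f x"
  obtains B where "\<And>x. \<bar>f x\<bar> \<le> B"
proof -
  have "compact (f ` {-1/2..1/2})"
    by (intro compact_continuous_image continuous_on_subset[OF assms(1)]) auto
  then obtain B where B: "\<And>x. x \<in> {-1/2..1/2} \<Longrightarrow> norm (f x) \<le> B"
    using compact_imp_bounded bounded_iff by (metis imageI)
  have "\<bar>f x\<bar> \<le> B" for x
  proof -
    have "wrap x \<in> {-1/2..1/2}" using wrap_Tor[of x] by (auto simp: Tor_def)
    then show ?thesis using B periodic_wrap[of f x, OF assms(2)] by fastforce
  qed
  then show ?thesis by (rule that)
qed

lemma trig_poly_real_polynomial:
  fixes p :: "complex \<Rightarrow> real"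
  assumes "real_polynomial_function p" shows "trig_poly (\<lambda>x. p (cis (2 * pi * x)))"
  using assms
proof (induction rule: real_polynomial_function.induct)
  case (linear f)
  have "f (cis (2 * pi * x)) = f 1 * cos (2 * pi * of_int 1 * x) + f \<i> * sin (2 * pi * of_int 1 * x)" for x
  proof -
    have "cis (2 * pi * x) = cos (2 * pi * x) *\<^sub>R 1 + sin (2 * pi * x) *\<^sub>R \<i>"
      by (simp add: complex_eq_iff)
    then show ?thesis
      using linear by (simp add: linear_simps bounded_linear.linear mult.commute)
  qed
  then show ?case
    using trig_poly_add[OF trig_poly_mult[OF trig_poly_const trig_poly_cos] trig_poly_mult[OF trig_poly_const trig_poly_sin]]
    by presburger
qed (auto intro: trig_poly_const trig_poly_add trig_poly_mult)

text \<open>Real polynomials in the plane restrict to trigonometric polynomials on the unit circle,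
  so this is Stone--Weierstrass there.\<close>

lemma trig_poly_approx:
  fixes G :: "complex \<Rightarrow> real"
  assumes "continuous_on (sphere 0 1) G" "0 < e"
  obtains P where "trig_poly P" "\<And>x. \<bar>G (cis (2 * pi * x)) - P x\<bar> < e"
proof -
  obtain p where "real_polynomial_function p" "\<And>z. z \<in> sphere 0 1 \<Longrightarrow> \<bar>G z - p z\<bar> < e"
    using Stone_Weierstrass_real_polynomial_function[OF compact_sphere assms] by blast
  then show ?thesis using trig_poly_real_polynomial by (intro that) auto
qed

text \<open>The factor vanishing at \<open>-1\<close> removes the jump of the argument there.\<close>

lemma continuous_on_circle_cutoff:
  fixes h :: "real \<Rightarrow> real"
  assumes h: "continuous_on UNIV h" and bd: "\<And>x. \<bar>h x\<bar> \<le> M" and a: "0 \<le> a"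
  shows "continuous_on (sphere 0 1) (\<lambda>z. h (Arg z / (2 * pi)) * min 1 (a * (1 + Re z)))"
  unfolding continuous_on_eq_continuous_within
proof
  fix z :: complex assume z: "z \<in> sphere 0 1"
  have M: "0 \<le> M" using bd[of 0] by linarith
  show "continuous (at z within sphere 0 1) (\<lambda>z. h (Arg z / (2 * pi)) * min 1 (a * (1 + Re z)))"
  proof (cases "z = -1")
    case False
    have "z \<notin> \<real>\<^sub>\<le>\<^sub>0"
    proof
      assume "z \<in> \<real>\<^sub>\<le>\<^sub>0"
      then obtain r where "z = cplx r" "r \<le> 0" by (auto simp: nonpos_Reals_def)
      then show False using z False by (auto simp: abs_if split: if_splits)
    qed
    then have "isCont Arg z" by (rule continuous_at_Arg)
    then have "isCont (\<lambda>z. h (Arg z / (2 * pi))) z"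
      using h by (intro isCont_o2[of z "\<lambda>z. Arg z / (2 * pi)" h] continuous_intros) (auto simp: continuous_on_eq_continuous_at)
    then have "isCont (\<lambda>z. h (Arg z / (2 * pi)) * min 1 (a * (1 + Re z))) z"
      by (intro continuous_intros linear_continuous_at[OF bounded_linear_Re])
    then show ?thesis by (rule continuous_at_imp_continuous_within)
  next
    case True
    have "norm (h (Arg w / (2 * pi)) * min 1 (a * (1 + Re w))) \<le> M * (a * (1 + Re w))" if "w \<in> sphere 0 1" for w
    proof -
      have "- 1 \<le> Re w" using that abs_Re_le_cmod[of w] by auto
      then have "0 \<le> a * (1 + Re w)" using a by simp
      then show ?thesis unfolding norm_mult using bd M by (intro mult_mono) auto
    qed
    then have "\<forall>\<^sub>F w in at z within sphere 0 1. norm (h (Arg w / (2 * pi)) * min 1 (a * (1 + Re w))) \<le> M * (a * (1 + Re w))"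
      by (auto simp: eventually_at_filter)
    moreover have "((\<lambda>w. M * (a * (1 + Re w))) \<longlongrightarrow> M * (a * (1 + Re z))) (at z within sphere 0 1)"
      by (intro tendsto_intros)
    then have "((\<lambda>w. M * (a * (1 + Re w))) \<longlongrightarrow> 0) (at z within sphere 0 1)"
      by (simp only: True uminus_complex.simps one_complex.simps) simp
    ultimately have "((\<lambda>w. h (Arg w / (2 * pi)) * min 1 (a * (1 + Re w))) \<longlongrightarrow> 0) (at z within sphere 0 1)"
      by (rule Lim_null_comparison)
    moreover have "h (Arg z / (2 * pi)) * min 1 (a * (1 + Re z)) = 0"
      by (simp only: True uminus_complex.simps one_complex.simps) simp
    ultimately show ?thesis unfolding continuous_within by (simp only:)
  qed
qed

text \<open>Lebesgue measurability supplies continuous functions converging off a null set. They are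
  clipped to \<open>{0..M}\<close>, cut off near the point -1 of the circle and approximated
  uniformly to within 1 / (n + 1). The uniform bounds serve dominated convergence later.\<close>

lemma trig_poly_AE_approx:
  assumes g: "g \<in> borel_measurable LT" and bd: "\<And>x. 0 \<le> g x" "\<And>x. g x \<le> M"
  obtains P where "\<And>i::nat. trig_poly (P i)" "\<And>i x. 0 \<le> P i x" "\<And>i x. P i x \<le> M + 2"
    "AE x in LT. (\<lambda>i. P i x) \<longlonglongrightarrow> g x"
proof -
  have "(\<lambda>x. if x \<in> Tor then g x else 0) \<in> borel_measurable borel"
    using g measurable_restrict_space_iff[of Tor borel 0 borel g]
    by (simp add: measurable_cong_sets[OF sets_LT refl])
  then have "(\<lambda>x. if x \<in> Tor then g x else 0) \<in> borel_measurable lebesgue"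
    by (simp add: measurable_completion)
  then have "(\<lambda>x. if x \<in> Tor then g x else 0) measurable_on UNIV"
    by (rule lebesgue_measurable_imp_measurable_on_real) simp
  then obtain N h where N: "negligible N" and h: "\<And>n::nat. continuous_on UNIV (h n)"
    and lim: "\<And>x. x \<notin> N \<Longrightarrow> (\<lambda>n. h n x) \<longlonglongrightarrow> (if x \<in> Tor then g x else 0)"
    unfolding measurable_on_def by auto
  have M: "0 \<le> M" using bd order_trans by blast
  define k where "k n x = max 0 (min M (h n x))" for n x
  \<comment> \<open>The clipped function carried to the circle; away from -1 the cutoff factor
    equals 1 for all large \<open>n\<close>.\<close>
  define G where "G n z = k n (Arg z / (2 * pi)) * min 1 (real n * (1 + Re z))" for n z
  have "continuous_on (sphere 0 1) (G n)" for n
    unfolding G_def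
  proof (rule continuous_on_circle_cutoff)
    show "continuous_on UNIV (k n)" unfolding k_def by (intro continuous_intros h)
    show "\<bar>k n x\<bar> \<le> M" for x using M by (auto simp: k_def)
  qed simp
  then have "\<exists>P. trig_poly P \<and> (\<forall>x. \<bar>G n (cis (2 * pi * x)) - P x\<bar> < 1 / real (Suc n))" for n
    using trig_poly_approx[of "G n" "1 / real (Suc n)"] by (metis of_nat_0_less_iff zero_less_Suc zero_less_divide_1_iff)
  then obtain Q where Q: "\<And>n. trig_poly (Q n)" "\<And>n x. \<bar>G n (cis (2 * pi * x)) - Q n x\<bar> < 1 / real (Suc n)"
    by metis
  \<comment> \<open>Raising by the approximation error restores nonnegativity; two errors of at most
    1 account for the bound \<open>M + 2\<close>.\<close>
  define P where "P n x = Q n x + 1 / real (Suc n)" for n x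
  have G: "0 \<le> G n (cis (2 * pi * x)) \<and> G n (cis (2 * pi * x)) \<le> M" for n x
  proof -
    have k: "0 \<le> k n y" "k n y \<le> M" for y using M by (auto simp: k_def)
    have "0 \<le> 1 + cos (2 * pi * x)" using cos_ge_minus_one[of "2 * pi * x"] by linarith
    then have "0 \<le> min 1 (real n * (1 + Re (cis (2 * pi * x))))" by simp
    then show ?thesis unfolding G_def
      using k mult_mono[OF k(2), of "min 1 (real n * (1 + Re (cis (2 * pi * x))))" 1 "Arg (cis (2 * pi * x)) / (2 * pi)"] M by auto
  qed
  have small: "1 / real (Suc n) \<le> 1" for n by simp
  have P0: "0 \<le> P n x" for n x using Q(2)[where n=n and x=x] G[of n x] unfolding P_def by linarith
  have P1: "P n x \<le> M + 2" for n x using Q(2)[where n=n and x=x] G[of n x] small[of n] unfolding P_def by linarith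
  have "AE x in lborel. x \<notin> N"
    using N negligible_iff_null_sets[of N] AE_not_in[of N lebesgue] by (simp add: AE_completion_iff)
  then have "AE x in LT. x \<notin> N" unfolding LT_def by (subst AE_restrict_space_iff) auto
  moreover have "AE x in LT. x \<noteq> -1/2"
  proof -
    have "AE x in lborel. x \<noteq> (-1/2 :: real)" by (rule AE_lborel_singleton)
    then show ?thesis unfolding LT_def by (subst AE_restrict_space_iff) auto
  qed
  ultimately have "AE x in LT. x \<notin> N \<and> x \<noteq> -1/2 \<and> x \<in> Tor"
    using AE_space[of LT] by eventually_elim simp
  then have lim: "AE x in LT. (\<lambda>i. P i x) \<longlonglongrightarrow> g x"
  proof eventually_elim
    case (elim x)
    then have x: "-1/2 < x" "x < 1/2" by (auto simp: Tor_def)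
    have Arg: "Arg (cis (2 * pi * x)) / (2 * pi) = x"
    proof (subst Arg_cis)
      have "pi * (- 1) < pi * (2 * x)" "pi * (2 * x) < pi * 1"
        using x by (intro mult_strict_left_mono; simp)+
      then show "2 * pi * x \<in> {- pi<..pi}" by (simp add: mult_ac)
    qed simp
    have kx: "(\<lambda>n. k n x) \<longlonglongrightarrow> g x"
    proof -
      have "(\<lambda>n. k n x) \<longlonglongrightarrow> max 0 (min M (g x))"
        unfolding k_def using lim[of x] elim by (intro tendsto_intros) auto
      moreover have "max 0 (min M (g x)) = g x"
        using bd(1)[of x] bd(2)[of x] by (simp only: min_absorb2 max_absorb2)
      ultimately show ?thesis by simp
    qed
    have cpos: "0 < 1 + cos (2 * pi * x)"
    proof -
      have "pi * (- 1 / 2) < pi * x" "pi * x < pi * (1 / 2)"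
        using x by (intro mult_strict_left_mono; simp)+
      then have "cos (pi * x) > 0" by (intro cos_gt_zero_pi) auto
      moreover have "1 + cos (2 * pi * x) = 2 * (cos (pi * x))\<^sup>2"
        using cos_double_cos[of "pi * x"] by (simp add: mult.assoc)
      ultimately show ?thesis by simp
    qed
    obtain n0 where n0: "1 / (1 + cos (2 * pi * x)) \<le> real n0" using real_arch_simple by blast
    have "\<forall>\<^sub>F n in sequentially. G n (cis (2 * pi * x)) = k n x"
      using eventually_ge_at_top[of n0]
    proof eventually_elim
      case (elim n)
      then have "1 / (1 + cos (2 * pi * x)) \<le> real n" using n0 by linarith
      then have "1 \<le> real n * (1 + cos (2 * pi * x))" using cpos by (simp add: pos_divide_le_eq)
      then show ?case by (simp add: G_def Arg)
    qed
    then have Glim: "(\<lambda>n. G n (cis (2 * pi * x))) \<longlonglongrightarrow> g x" using kx by (rule tendsto_cong[THEN iffD2])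
    have "(\<lambda>n. P n x - G n (cis (2 * pi * x))) \<longlonglongrightarrow> 0"
    proof (rule Lim_null_comparison)
      show "\<forall>\<^sub>F n in sequentially. norm (P n x - G n (cis (2 * pi * x))) \<le> 2 * (1 / real (Suc n))"
      proof (intro always_eventually allI)
        fix n show "norm (P n x - G n (cis (2 * pi * x))) \<le> 2 * (1 / real (Suc n))"
          using Q(2)[where n=n and x=x] unfolding P_def real_norm_def by linarith
      qed
      show "(\<lambda>n. 2 * (1 / real (Suc n))) \<longlonglongrightarrow> 0"
        by (intro tendsto_mult_right_zero lim_1_over_n[THEN LIMSEQ_Suc])
    qed
    from tendsto_add[OF this Glim] show ?case by simp
  qed
  have tp: "trig_poly (P n)" for n
    unfolding P_def[abs_def] by (intro trig_poly_add Q trig_poly_const)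
  show ?thesis by (rule that[of P, OF tp P0 P1 lim])
qed

subsection \<open>The energy-entropy inequality\<close>

text \<open>What the coefficientwise Lebedev--Milin bound gives away at index \<open>k\<close>; by
  \<open>expcoef_equality\<close> it vanishes at all indices only for geometric sequences.\<close>

definition defect :: "(nat \<Rightarrow> complex) \<Rightarrow> nat \<Rightarrow> real" where
  "defect c k = expcoef (\<lambda>j. (norm (c j))\<^sup>2) k - (norm (expcoef c k))\<^sup>2"

lemma defect_nonneg: "0 \<le> defect c k"
  using expcoef_norm_le[of c k] by (simp add: defect_def)

text \<open>Integrating \<open>Young_entropy\<close> at f - ln Z + 1 gives 2 H - ln Z \<le>
  \<open>Ent q\<close>, and the retained defect improves the bound ln Z \<le> H. Cutting the
  coefficients off at \<open>N\<close> keeps f bounded and makes \<open>Lebedev_Milin\<close>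
  applicable.\<close>

lemma entropy_Lebedev_Milin:
  assumes q: "is_density q" and int: "finite_ent q" and m: "m > 0"
    and c: "\<And>j. c j = (if j \<le> N then fourier q (int (m * j)) else 0)"
  shows "(\<Sum>j=1..N. (norm (c j))\<^sup>2 / real j) + defect c k * exp (- Ent q) \<le> Ent q"
proof -
  let ?S = "\<lambda>x. \<Sum>j=1..N. c j * ech (int (m * j)) x / of_nat j"
  note d = densityD[OF q]
  define H where "H = (\<Sum>j=1..N. (norm (c j))\<^sup>2 / real j)"
  define f where "f x = 2 * Re (?S x)" for x
  define Z where "Z = (\<integral>x. exp (f x) \<partial>LT)"
  have fcont: "continuous_on UNIV f" unfolding f_def by (intro continuous_intros) auto
  then have fmeas [measurable]: "f \<in> borel_measurable LT"
    by (intro measurable_LT_borel borel_measurable_continuous_onI)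
  define B where "B = 2 * (\<Sum>j=1..N. norm (c j))"
  have fB: "\<bar>f x\<bar> \<le> B" for x
  proof -
    have "\<bar>f x\<bar> \<le> 2 * norm (?S x)"
      using abs_Re_le_cmod[of "?S x"] unfolding f_def by linarith
    also have "\<dots> \<le> B" unfolding B_def
    proof (intro mult_left_mono sum_norm_le)
      fix j assume "j \<in> {1..N}"
      then show "norm (c j * ech (int (m * j)) x / of_nat j) \<le> norm (c j)"
        by (simp add: norm_mult norm_divide divide_le_eq mult_le_cancel_left1)
    qed simp
    finally show ?thesis .
  qed
  have iexp: "integrable LT (\<lambda>x. exp (f x))"
    using fB by (intro LT.integrable_const_bound[where B="exp B"]) (auto intro: order_trans[OF abs_ge_self])
  have Zpos: "Z > 0"
  proof -
    have "exp (- B) \<le> Z"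
      unfolding Z_def using iexp
    proof (intro LT.integral_ge_const AE_I2)
      show "exp (- B) \<le> exp (f x)" for x using fB[of x] by (simp add: abs_le_iff)
    qed
    then show ?thesis using exp_gt_zero[of "-B"] by linarith
  qed
  have Zle: "Z \<le> exp H - defect c k"
    unfolding Z_def f_def H_def defect_def by (rule Lebedev_Milin[OF _ m]) (simp add: c)
  \<comment> \<open>ln t \<le> t - 1 at t = Z exp (-H) turns the defect inside the logarithm into an
    additive term.\<close>
  have lnZ: "ln Z \<le> H - defect c k * exp (- H)"
  proof -
    have "ln (Z * exp (- H)) \<le> Z * exp (- H) - 1" using Zpos by (intro ln_le_minus_one) simp
    moreover have "ln (Z * exp (- H)) = ln Z - H" using Zpos by (simp add: ln_mult)
    moreover have "Z * exp (- H) \<le> (exp H - defect c k) * exp (- H)" using Zle by (intro mult_right_mono) auto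
    moreover have "(exp H - defect c k) * exp (- H) = 1 - defect c k * exp (- H)"
      by (simp add: algebra_simps flip: exp_add)
    ultimately show ?thesis by linarith
  qed
  have iqf: "integrable LT (\<lambda>x. q x * f x)"
    by (rule Bochner_Integration.integrable_bound[OF integrable_mult_right[OF d(3), of B]])
       (use d(1) fB abs_ge_self[of B] in \<open>auto simp: abs_mult mult.commute[of "\<bar>B\<bar>"] intro!: mult_left_mono AE_I2 intro: order_trans[OF fB]\<close>)
  have qf: "(\<integral>x. q x * f x \<partial>LT) = 2 * H"
  proof -
    have ie: "integrable LT (\<lambda>x. cplx (q x) * ech k x)" for k
      using d(3) by (intro integrable_mult_ech) simp
    have sw: "cplx (q x) * (?S x)
       = (\<Sum>j=1..N. c j / of_nat j * (cplx (q x) * ech (int (m * j)) x))" for x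
      by (simp add: sum_distrib_left algebra_simps)
    then have "(\<integral>x. cplx (q x) * (?S x) \<partial>LT)
      = (\<Sum>j=1..N. c j / of_nat j * (\<integral>x. cplx (q x) * ech (int (m * j)) x \<partial>LT))"
      using ie by (simp only:) (subst Bochner_Integration.integral_sum, auto)
    also have "\<dots> = (\<Sum>j=1..N. c j / of_nat j * cnj (c j))"
    proof (intro sum.cong refl)
      fix j assume "j \<in> {1..N}"
      then have "cnj (c j) = fourier q (- int (m * j))" using c[of j] fourier_cnj[of q "int (m * j)"] by simp
      then show "c j / of_nat j * (\<integral>x. cplx (q x) * ech (int (m * j)) x \<partial>LT) = c j / of_nat j * cnj (c j)"
        by (simp add: fourier_ech)
    qed
    also have "\<dots> = cplx H"
      unfolding H_def of_real_sum of_real_divide complex_norm_square by (simp add: field_simps)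
    finally have *: "(\<integral>x. cplx (q x) * (?S x) \<partial>LT) = cplx H" .
    have i: "integrable LT (\<lambda>x. cplx (q x) * (?S x))"
      unfolding sw by (intro Bochner_Integration.integrable_sum integrable_mult_right ie)
    have Re2: "a * (2 * Re z) = 2 * Re (cplx a * z)" for a z by simp
    have "(\<integral>x. q x * f x \<partial>LT) = (\<integral>x. 2 * Re (cplx (q x) * (?S x)) \<partial>LT)"
      unfolding f_def Re2 ..
    also have "\<dots> = 2 * Re (\<integral>x. cplx (q x) * (?S x) \<partial>LT)"
      by (subst integral_mult_right_zero) (simp only: integral_Re[OF i])
    finally show ?thesis unfolding * by simp
  qed
  have "2 * H - ln Z + 1 = (\<integral>x. (f x - ln Z + 1) * q x \<partial>LT)"
  proof -
    have "(\<integral>x. (f x - ln Z + 1) * q x \<partial>LT) = (\<integral>x. q x * f x + (1 - ln Z) * q x \<partial>LT)"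
      by (intro Bochner_Integration.integral_cong) (auto simp: algebra_simps)
    also have "\<dots> = 2 * H + (1 - ln Z)"
      using iqf d qf by simp
    finally show ?thesis by simp
  qed
  also have "\<dots> \<le> (\<integral>x. q x * ln (q x) + exp (f x) / Z \<partial>LT)"
  proof (rule integral_mono_AE)
    have "integrable LT (\<lambda>x. q x * f x + (1 - ln Z) * q x)" using iqf d by simp
    then show "integrable LT (\<lambda>x. (f x - ln Z + 1) * q x)" by (simp add: algebra_simps)
    show "AE x in LT. (f x - ln Z + 1) * q x \<le> q x * ln (q x) + exp (f x) / Z"
      using d(2)
    proof eventually_elim
      case (elim x)
      then show ?case using Young_entropy[of "q x" "f x - ln Z + 1"] Zpos by (simp add: exp_diff)
    qed
  qed (use int iexp in auto)
  also have "\<dots> = Ent q + 1"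
    using int iexp Zpos by (simp add: Ent_def Z_def[symmetric])
  finally have E1: "2 * H - ln Z \<le> Ent q" by simp
  then have E2: "H + defect c k * exp (- H) \<le> Ent q" using lnZ by linarith
  have "0 \<le> defect c k * exp (- H)" using defect_nonneg by simp
  then have "H \<le> Ent q" using E2 by linarith
  \<comment> \<open>H \<le> \<open>Ent q\<close> trades exp (-H), which depends on \<open>N\<close>,
    for a weight in terms of the entropy that passes to limits.\<close>
  then have "defect c k * exp (- Ent q) \<le> defect c k * exp (- H)"
    using defect_nonneg by (intro mult_left_mono) auto
  then show ?thesis using E2 by (simp add: H_def)
qed

text \<open>Each \<open>expcoef c k\<close> is a polynomial in finitely many of the
  \<open>c j\<close>.\<close>

lemma tendsto_expcoef:
  fixes c :: "nat \<Rightarrow> nat \<Rightarrow> 'a::real_normed_field"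
  assumes "\<And>j. (\<lambda>i. c i j) \<longlonglongrightarrow> d j"
  shows "(\<lambda>i. expcoef (c i) k) \<longlonglongrightarrow> expcoef d k"
proof (induction k rule: less_induct)
  case (less k)
  show ?case
  proof (cases k)
    case (Suc j)
    have "(\<lambda>i. expcoef (c i) (j - l)) \<longlonglongrightarrow> expcoef d (j - l)" for l
      using less Suc by simp
    then show ?thesis unfolding Suc expcoef.simps(2)
      by (intro tendsto_divide tendsto_sum tendsto_mult tendsto_const assms) (auto simp del: of_nat_Suc)
  qed simp
qed

lemma tendsto_defect:
  assumes "\<And>j. (\<lambda>i. c i j) \<longlonglongrightarrow> d j"
  shows "(\<lambda>i. defect (c i) k) \<longlonglongrightarrow> defect d k"
  unfolding defect_def by (intro tendsto_intros tendsto_expcoef assms)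

lemma sum_symmetric_int:
  fixes f :: "int \<Rightarrow> 'a::comm_ring_1"
  assumes "\<And>k. f (- k) = f k" "f 0 = 0"
  shows "(\<Sum>k\<in>{-int M..int M}. f k) = 2 * (\<Sum>k=1..M. f (int k))"
proof (induction M)
  case (Suc M)
  have "{-int (Suc M)..int (Suc M)} = insert (- int (Suc M)) (insert (int (Suc M)) {-int M..int M})" by auto
  then show ?case using Suc assms(1)[of "int (Suc M)"] by (simp add: algebra_simps del: of_nat_Suc)
qed (use assms in simp)

lemma sum_multiples:
  fixes g :: "nat \<Rightarrow> 'a::comm_monoid_add"
  assumes m: "m > 0" and g: "\<And>k. \<not> m dvd k \<Longrightarrow> g k = 0"
  shows "(\<Sum>k=1..m*N. g k) = (\<Sum>j=1..N. g (m * j))"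
proof -
  have "(\<Sum>k=1..m*N. g k) = (\<Sum>k\<in>(*) m ` {1..N}. g k)"
  proof (rule sum.mono_neutral_right)
    show "\<forall>i\<in>{1..m * N} - (*) m ` {1..N}. g i = 0"
    proof
      fix i assume i: "i \<in> {1..m * N} - (*) m ` {1..N}"
      have "\<not> m dvd i"
      proof
        assume "m dvd i"
        then obtain j where j: "i = m * j" by (elim dvdE)
        then have "1 \<le> m * j" "m * j \<le> m * N" using i by auto
        then have "1 \<le> j" "j \<le> N" using m by (simp_all add: Suc_le_eq)
        then have "j \<in> {1..N}" by simp
        then show False using i j by blast
      qed
      then show "g i = 0" by (rule g)
    qed
  qed (use m in auto)
  also have "\<dots> = (\<Sum>j=1..N. g (m * j))"
    using m by (subst sum.reindex) (auto simp: inj_on_def)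
  finally show ?thesis .
qed

text \<open>The hypotheses of the theorem in Fourier form, with the surviving frequencies written as
  \<open>m * j\<close>. The bound 1 / j is the coefficient of the logarithmic kernel.\<close>

locale crit_potential = potential_bdd +
  fixes m :: nat
  assumes m_pos: "0 < m"
    and What_0: "What W 0 = 0"
    and What_not_dvd: "\<And>k. \<not> m dvd k \<Longrightarrow> What W k = 0"
    and What_le: "\<And>j. 1 \<le> j \<Longrightarrow> 2 * What W (m * j) \<le> 1 / real j"
begin

definition fc :: "(real \<Rightarrow> real) \<Rightarrow> nat \<Rightarrow> complex" where
  "fc q j = fourier q (int (m * j))"

text \<open>How far \<open>W\<close> falls short of the logarithmic potential at frequency
  \<open>m * j\<close>.\<close>

definition gap :: "nat \<Rightarrow> real" where
  "gap j = 1 / real j - 2 * What W (m * j)"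

lemma gap_nonneg: "1 \<le> j \<Longrightarrow> 0 \<le> gap j"
  using What_le by (simp add: gap_def)

text \<open>Energy plus deficits at most entropy. Restricting to a partial sum of gaps and one
  defect at a time makes each instance a closed condition in \<open>B\<close>, \<open>E\<close> and
  finitely many \<open>c j\<close>.\<close>

definition core :: "real \<Rightarrow> real \<Rightarrow> (nat \<Rightarrow> complex) \<Rightarrow> bool" where
  "core B E c \<longleftrightarrow> (\<forall>N k. B + (\<Sum>j=1..N. gap j * (norm (c j))\<^sup>2) + defect c k * exp (- E) \<le> E)"

lemma bil_trig_poly:
  assumes P: "trig_poly P"
  obtains L where "bil W P P = (\<Sum>j=1..L. 2 * What W (m*j) * (norm (fc P j))\<^sup>2)"
    "\<And>j. j > L \<Longrightarrow> fc P j = 0"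
proof -
  have i: "integrable LT P"
    using continuous_periodic_bounded[OF trig_poly_continuous[OF P] trig_poly_periodic[OF P]]
      measurable_LT_borel[OF trig_poly_measurable[OF P]] LT.integrable_const_bound[of P] by (metis AE_I2 real_norm_def)
  obtain L where L: "\<And>x. cplx (P x) = (\<Sum>k\<in>{-int L..int L}. fourier P k * ech k x)"
    "\<And>k. \<bar>k\<bar> > int L \<Longrightarrow> fourier P k = 0"
    using trig_polyE[OF P] by blast
  have m1: "1 \<le> m" using m_pos by simp
  have Lm: "int L \<le> int (m * L)" using m1 by (metis mult_le_mono1 nat_mult_1 of_nat_le_iff)
  \<comment> \<open>Widening the window to \<open>m * L\<close> makes the positive multiples of
    \<open>m\<close> in it exactly the \<open>m * j\<close> with 1 \<le> j \<le> L.\<close>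
  have LM: "cplx (P x) = (\<Sum>k\<in>{-int (m * L)..int (m * L)}. fourier P k * ech k x)" for x
    unfolding L(1) by (rule sum.mono_neutral_left) (use Lm L(2) in auto)
  have "cplx (bil W P P) = (\<Sum>k\<in>{-int (m*L)..int (m*L)}. cplx (What W (nat \<bar>k\<bar>)) * fourier P k * cnj (fourier P k))"
    by (rule bil_trig[OF LM i])
  also have "\<dots> = (\<Sum>k\<in>{-int (m*L)..int (m*L)}. cplx (What W (nat \<bar>k\<bar>) * (norm (fourier P k))\<^sup>2))"
    by (intro sum.cong refl) (simp only: of_real_mult complex_norm_square mult.assoc)
  also have "\<dots> = cplx (\<Sum>k\<in>{-int (m*L)..int (m*L)}. What W (nat \<bar>k\<bar>) * (norm (fourier P k))\<^sup>2)"
    by simp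
  finally have "bil W P P = (\<Sum>k\<in>{-int (m*L)..int (m*L)}. What W (nat \<bar>k\<bar>) * (norm (fourier P k))\<^sup>2)"
    by (simp only: of_real_eq_iff)
  also have "\<dots> = 2 * (\<Sum>k=1..m*L. What W (nat \<bar>int k\<bar>) * (norm (fourier P (int k)))\<^sup>2)"
    by (rule sum_symmetric_int) (auto simp: fourier_cnj What_0)
  also have "(\<Sum>k=1..m*L. What W (nat \<bar>int k\<bar>) * (norm (fourier P (int k)))\<^sup>2)
     = (\<Sum>j=1..L. What W (nat \<bar>int (m*j)\<bar>) * (norm (fourier P (int (m*j))))\<^sup>2)"
    by (rule sum_multiples[OF m_pos]) (auto simp: What_not_dvd)
  finally have bil: "bil W P P = (\<Sum>j=1..L. 2 * What W (m*j) * (norm (fc P j))\<^sup>2)"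
    by (simp add: fc_def sum_distrib_left mult.assoc nat_mult_distrib)
  have fc0: "fc P j = 0" if "j > L" for j
  proof -
    have "int L < int j" using that by simp
    also have "int j \<le> int (m * j)" using m1 by (metis mult_le_mono1 nat_mult_1 of_nat_le_iff)
    finally show ?thesis unfolding fc_def by (intro L(2)) simp
  qed
  show ?thesis by (rule that[OF bil fc0])
qed

text \<open>Writing 1 / j as \<open>2 * What W (m * j) + gap j\<close> splits the sum in
  \<open>entropy_Lebedev_Milin\<close> into energy and gaps. The coefficients vanish beyond
  \<open>L\<close>, so the cutoff there changes nothing.\<close>

lemma core_trig_poly:
  assumes P: "trig_poly P" and dens: "is_density P" and int: "finite_ent P"
  shows "core (bil W P P) (Ent P) (fc P)"
  unfolding core_def
proof (intro allI)
  fix N k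
  obtain L where bil: "bil W P P = (\<Sum>j=1..L. 2 * What W (m*j) * (norm (fc P j))\<^sup>2)"
    and fc0: "\<And>j. j > L \<Longrightarrow> fc P j = 0"
    using bil_trig_poly[OF P] by blast
  have "(\<Sum>j=1..L. (norm (fc P j))\<^sup>2 / real j) + defect (fc P) k * exp (- Ent P) \<le> Ent P"
    by (rule entropy_Lebedev_Milin[OF dens int m_pos]) (use fc0 in \<open>auto simp: fc_def\<close>)
  moreover have "(\<Sum>j=1..L. (norm (fc P j))\<^sup>2 / real j) = bil W P P + (\<Sum>j=1..L. gap j * (norm (fc P j))\<^sup>2)"
    unfolding bil sum.distrib[symmetric] by (intro sum.cong) (auto simp: gap_def algebra_simps)
  moreover have "(\<Sum>j=1..N. gap j * (norm (fc P j))\<^sup>2) \<le> (\<Sum>j=1..max L N. gap j * (norm (fc P j))\<^sup>2)"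
    by (rule sum_mono2) (auto intro!: mult_nonneg_nonneg gap_nonneg)
  moreover have "\<dots> = (\<Sum>j=1..L. gap j * (norm (fc P j))\<^sup>2)"
    by (rule sum.mono_neutral_right) (auto simp: fc0)
  ultimately show "bil W P P + (\<Sum>j=1..N. gap j * (norm (fc P j))\<^sup>2) + defect (fc P) k * exp (- Ent P) \<le> Ent P"
    by linarith
qed

lemma core_limit:
  assumes "\<forall>\<^sub>F i in sequentially. core (B i) (E i) (c i)"
    and "B \<longlonglongrightarrow> B'" "E \<longlonglongrightarrow> E'" "\<And>j. (\<lambda>i. c i j) \<longlonglongrightarrow> c' j"
  shows "core B' E' c'"
  unfolding core_def
proof (intro allI)
  fix N k
  show "B' + (\<Sum>j=1..N. gap j * (norm (c' j))\<^sup>2) + defect c' k * exp (- E') \<le> E'"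
  proof (rule tendsto_le[OF _ assms(3)])
    show "(\<lambda>i. B i + (\<Sum>j=1..N. gap j * (norm (c i j))\<^sup>2) + defect (c i) k * exp (- E i))
       \<longlonglongrightarrow> B' + (\<Sum>j=1..N. gap j * (norm (c' j))\<^sup>2) + defect c' k * exp (- E')"
      by (intro tendsto_intros tendsto_defect assms)
    show "\<forall>\<^sub>F i in sequentially. B i + (\<Sum>j=1..N. gap j * (norm (c i j))\<^sup>2) + defect (c i) k * exp (- E i) \<le> E i"
      using assms(1) by eventually_elim (simp add: core_def)
  qed simp
qed

end

section \<open>Extension of the inequality to general densities\<close>

lemma xlnx_abs_le: "0 \<le> y \<Longrightarrow> \<bar>y * ln y\<bar> \<le> 1 + y\<^sup>2" for y :: real
proof (cases "y = 0")
  case False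
  assume "0 \<le> y"
  then have "y * ln y \<le> y * (y - 1)" using False by (intro mult_left_mono ln_le_minus_one) auto
  then have "y * ln y \<le> y\<^sup>2" using \<open>0 \<le> y\<close> by (simp add: power2_eq_square algebra_simps)
  then show ?thesis using xlnx_ge[OF \<open>0 \<le> y\<close>] zero_le_power2[of y] by linarith
qed simp

lemma integrable_xlnx_bounded:
  fixes q :: "real \<Rightarrow> real"
  assumes "q \<in> borel_measurable LT" "\<And>x. 0 \<le> q x" "\<And>x. q x \<le> M"
  shows "finite_ent q"
proof (rule LT.integrable_const_bound[where B="1 + M\<^sup>2"])
  show "AE x in LT. norm (q x * ln (q x)) \<le> 1 + M\<^sup>2"
  proof (rule AE_I2)
    fix x
    have "(q x)\<^sup>2 \<le> M\<^sup>2" using assms by (intro power_mono)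
    then show "norm (q x * ln (q x)) \<le> 1 + M\<^sup>2" using xlnx_abs_le[OF assms(2), of x] by simp
  qed
qed (use assms in simp)

lemma tendsto_fourier:
  assumes [measurable]: "\<And>i. q i \<in> borel_measurable LT" and u: "integrable LT u"
    and lim: "AE x in LT. (\<lambda>i. q i x) \<longlonglongrightarrow> p x" and bd: "\<And>i. AE x in LT. \<bar>q i x\<bar> \<le> u x"
    and [measurable]: "p \<in> borel_measurable LT"
  shows "(\<lambda>i. fourier (q i) k) \<longlonglongrightarrow> fourier p k"
  unfolding fourier_ech
proof (rule integral_dominated_convergence[where w=u])
  show "AE x in LT. (\<lambda>i. cplx (q i x) * ech (- k) x) \<longlonglongrightarrow> cplx (p x) * ech (- k) x"
    using lim by eventually_elim (intro tendsto_intros)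
  show "AE x in LT. norm (cplx (q i x) * ech (- k) x) \<le> u x" for i
    using bd by (simp add: norm_mult)
qed (use u in auto)

lemma tendsto_truncate: "(\<lambda>i. min a (real (Suc i))) \<longlonglongrightarrow> a"
proof (rule tendsto_eventually)
  obtain n where n: "a \<le> real n" using real_arch_simple by blast
  show "\<forall>\<^sub>F i in sequentially. min a (real (Suc i)) = a"
    using eventually_ge_at_top[of n]
  proof eventually_elim
    case (elim i)
    then have "real n \<le> real (Suc i)" by simp
    then show ?case using n by linarith
  qed
qed

text \<open>The factor normalising \<open>p\<close> to unit mass, kept within \<open>(0, 2]\<close> by a junk value.\<close>

definition nrm :: "(real \<Rightarrow> real) \<Rightarrow> real" where
  "nrm p = (if 1/2 < (\<integral>x. p x \<partial>LT) then 1 / (\<integral>x. p x \<partial>LT) else 1)"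

lemma nrm_bounds: "0 < nrm p" "nrm p \<le> 2"
proof -
  have "0 < nrm p \<and> nrm p \<le> 2"
  proof (cases "1/2 < (\<integral>x. p x \<partial>LT)")
    case True
    then have pos: "0 < (\<integral>x. p x \<partial>LT)" by linarith
    then have "1 / (\<integral>x. p x \<partial>LT) \<le> 2" using True by (simp only: pos_divide_le_eq)
    then show ?thesis using True pos by (simp only: nrm_def if_True) simp
  qed (simp only: nrm_def if_False, simp)
  then show "0 < nrm p" "nrm p \<le> 2" by auto
qed

lemma nrm_ge_1: "(\<integral>x. p x \<partial>LT) \<le> 1 \<Longrightarrow> 1 \<le> nrm p"
  by (simp add: nrm_def le_divide_eq_1)

lemma
  assumes "(\<lambda>i. \<integral>x. p i x \<partial>LT) \<longlonglongrightarrow> 1"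
    and "\<And>i. integrable LT (p i)" "\<And>i. AE x in LT. 0 \<le> p i x"
  shows nrm_tendsto: "(\<lambda>i. nrm (p i)) \<longlonglongrightarrow> 1"
    and nrm_density: "\<forall>\<^sub>F i in sequentially. is_density (\<lambda>x. nrm (p i) * p i x)"
proof -
  have ev: "\<forall>\<^sub>F i in sequentially. 1/2 < (\<integral>x. p i x \<partial>LT)"
    using order_tendstoD(1)[OF assms(1), of "1/2"] by simp
  then have "\<forall>\<^sub>F i in sequentially. 1 / (\<integral>x. p i x \<partial>LT) = nrm (p i)"
    by eventually_elim (simp add: nrm_def)
  moreover have "(\<lambda>i. 1 / (\<integral>x. p i x \<partial>LT)) \<longlonglongrightarrow> 1 / 1"
    by (intro tendsto_intros assms) simp
  ultimately show "(\<lambda>i. nrm (p i)) \<longlonglongrightarrow> 1"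
    using Lim_transform_eventually by fastforce
  show "\<forall>\<^sub>F i in sequentially. is_density (\<lambda>x. nrm (p i) * p i x)"
    using ev
  proof eventually_elim
    case (elim i)
    have "AE x in LT. 0 \<le> nrm (p i) * p i x" using assms(3)[of i] nrm_bounds(1)[of "p i"] by auto
    moreover have "(\<integral>x. nrm (p i) * p i x \<partial>LT) = 1" using elim by (simp add: nrm_def)
    ultimately show ?case using assms(2)[of i] by (auto simp: is_density_def)
  qed
qed

context crit_potential
begin

text \<open>The two arguments vary independently because \<open>bil_zero\<close> moves only one of
  them.\<close>

lemma bil_tendsto:
  assumes q: "\<And>i. q i \<in> borel_measurable LT" "p \<in> borel_measurable LT"
    "\<And>i. r i \<in> borel_measurable LT" "s \<in> borel_measurable LT"
    and lim: "AE x in LT. (\<lambda>i. q i x) \<longlonglongrightarrow> p x" "AE x in LT. (\<lambda>i. r i x) \<longlonglongrightarrow> s x"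
    and w: "integrable LL w"
    and bd: "\<And>i. AE z in LL. \<bar>ker W (q i) (r i) z\<bar> \<le> w z"
  shows "(\<lambda>i. bil W (q i) (r i)) \<longlonglongrightarrow> bil W p s"
  unfolding bil_def
proof (rule integral_dominated_convergence[where w=w])
  note [measurable] = q
  show "(ker W p s) \<in> borel_measurable LL" by measurable
  show "(\<lambda>z. ker W (q i) (r i) z) \<in> borel_measurable LL" for i by measurable
  show "AE z in LL. (\<lambda>i. ker W (q i) (r i) z) \<longlonglongrightarrow> ker W p s z"
    using AE_fst_LT[OF lim(1)] AE_snd_LT[OF lim(2)] by eventually_elim (intro tendsto_intros)
qed (use w bd in auto)

text \<open>The approximating polynomials are nonnegative but have mass 1 only in the limit, hence
  the rescaling by \<open>nrm\<close>. Uniform bounds let constants and multiples of |W| dominate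
  every term.\<close>

lemma core_bounded:
  assumes q: "is_density q" and bd: "\<And>x. 0 \<le> q x" "\<And>x. q x \<le> M"
  shows "core (bil W q q) (Ent q) (fc q)"
proof -
  note d = densityD[OF q]
  have [measurable]: "q \<in> borel_measurable LT" using d by simp
  obtain P where P: "\<And>i::nat. trig_poly (P i)" "\<And>i x. 0 \<le> P i x" "\<And>i x. P i x \<le> M + 2"
    and lim: "AE x in LT. (\<lambda>i. P i x) \<longlonglongrightarrow> q x"
    using trig_poly_AE_approx[OF d(1) bd] by blast
  have M: "0 \<le> M" using bd order_trans by blast
  have Pm [measurable]: "P i \<in> borel_measurable LT" for i
    using trig_poly_measurable[OF P(1)] by (rule measurable_LT_borel)
  have Pi: "integrable LT (P i)" for i
    by (rule LT.integrable_const_bound[where B="M + 2"]) (use P in auto)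
  have "(\<lambda>i. \<integral>x. P i x \<partial>LT) \<longlonglongrightarrow> (\<integral>x. q x \<partial>LT)"
    by (rule integral_dominated_convergence[where w="\<lambda>x. M + 2"]) (use lim P in auto)
  then have I: "(\<lambda>i. \<integral>x. P i x \<partial>LT) \<longlonglongrightarrow> 1" using d by simp
  define Q where "Q i x = nrm (P i) * P i x" for i x
  have Q0: "0 \<le> Q i x" for i x using nrm_bounds(1)[of "P i"] P(2)[of i x] by (simp add: Q_def)
  define B where "B = 2 * (M + 2)"
  have QB: "Q i x \<le> B" for i x
    unfolding Q_def B_def using nrm_bounds[of "P i"] P(2,3)[of i x] by (intro mult_mono) auto
  have Qm [measurable]: "Q i \<in> borel_measurable LT" for i unfolding Q_def by measurable
  have QL: "AE x in LT. (\<lambda>i. Q i x) \<longlonglongrightarrow> q x"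
    using lim
  proof eventually_elim
    case (elim x)
    then have "(\<lambda>i. nrm (P i) * P i x) \<longlonglongrightarrow> 1 * q x"
      using nrm_tendsto[OF I Pi] P(2) by (intro tendsto_mult) auto
    then show ?case by (simp add: Q_def)
  qed
  show ?thesis
  proof (rule core_limit)
    have "\<forall>\<^sub>F i in sequentially. is_density (Q i)"
      unfolding Q_def[abs_def] by (rule nrm_density[OF I Pi]) (use P in auto)
    then show "\<forall>\<^sub>F i in sequentially. core (bil W (Q i) (Q i)) (Ent (Q i)) (fc (Q i))"
    proof eventually_elim
      case (elim i)
      show ?case
      proof (rule core_trig_poly[OF _ elim])
        show "trig_poly (Q i)" unfolding Q_def[abs_def] by (intro trig_poly_mult trig_poly_const P)
        show "finite_ent (Q i)"
          by (rule integrable_xlnx_bounded[OF Qm Q0 QB])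
      qed
    qed
    show "(\<lambda>i. bil W (Q i) (Q i)) \<longlonglongrightarrow> bil W q q"
    proof (rule bil_tendsto[OF Qm d(1) Qm d(1) QL QL])
      show "integrable LL (\<lambda>z. B\<^sup>2 * \<bar>W (fst z - snd z)\<bar>)"
        using integrable_W_fst[of "\<lambda>x. 1"] by simp
      show "AE z in LL. \<bar>ker W (Q i) (Q i) z\<bar> \<le> B\<^sup>2 * \<bar>W (fst z - snd z)\<bar>" for i
      proof (rule AE_I2)
        fix z
        have "\<bar>Q i (fst z) * Q i (snd z)\<bar> \<le> B * B"
          unfolding abs_mult using Q0[of i] QB[of i] by (intro mult_mono) (auto intro: order_trans)
        then have "\<bar>W (fst z - snd z)\<bar> * \<bar>Q i (fst z) * Q i (snd z)\<bar> \<le> \<bar>W (fst z - snd z)\<bar> * (B * B)"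
          by (intro mult_left_mono) auto
        then show "\<bar>ker W (Q i) (Q i) z\<bar> \<le> B\<^sup>2 * \<bar>W (fst z - snd z)\<bar>"
          by (simp add: abs_mult power2_eq_square mult_ac)
      qed
    qed
    show "(\<lambda>i. Ent (Q i)) \<longlonglongrightarrow> Ent q"
      unfolding Ent_def
    proof (rule integral_dominated_convergence[where w="\<lambda>x. 1 + B\<^sup>2"])
      show "AE x in LT. (\<lambda>i. Q i x * ln (Q i x)) \<longlonglongrightarrow> q x * ln (q x)"
        using QL by eventually_elim (rule tendsto_xlnx[OF _ Q0])
      show "AE x in LT. norm (Q i x * ln (Q i x)) \<le> 1 + B\<^sup>2" for i
      proof (rule AE_I2)
        fix x
        have "(Q i x)\<^sup>2 \<le> B\<^sup>2" using Q0 QB by (intro power_mono)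
        then show "norm (Q i x * ln (Q i x)) \<le> 1 + B\<^sup>2" using xlnx_abs_le[OF Q0, of i x] by simp
      qed
    qed auto
    show "(\<lambda>i. fc (Q i) j) \<longlonglongrightarrow> fc q j" for j
      unfolding fc_def by (rule tendsto_fourier[where u="\<lambda>x. B"]) (use QL Q0 QB in auto)
  qed
qed

text \<open>Truncations of \<open>q\<close>, rescaled to mass 1, are bounded densities below
  \<open>2 * q\<close>; the energy kernel and the entropy of \<open>q\<close> itself then
  dominate.\<close>

lemma core_nonneg:
  assumes q: "is_density q" and q0: "\<And>x. 0 \<le> q x"
    and ient: "finite_ent q"
    and iW: "integrable LL (ker W q q)"
  shows "core (bil W q q) (Ent q) (fc q)"
proof -
  note d = densityD[OF q]
  have [measurable]: "q \<in> borel_measurable LT" using d by simp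
  define T where "T i x = min (q x) (real (Suc i))" for i x
  have T0: "0 \<le> T i x" and Tq: "T i x \<le> q x" for i x using q0 by (auto simp: T_def)
  have Tm [measurable]: "T i \<in> borel_measurable LT" for i unfolding T_def by measurable
  have Ti: "integrable LT (T i)" for i
    by (rule Bochner_Integration.integrable_bound[OF d(3)])
       (use T0 in \<open>auto intro!: AE_I2 order_trans[OF Tq abs_ge_self]\<close>)
  have TL: "(\<lambda>i. T i x) \<longlonglongrightarrow> q x" for x
    unfolding T_def by (rule tendsto_truncate)
  have "(\<lambda>i. \<integral>x. T i x \<partial>LT) \<longlonglongrightarrow> (\<integral>x. q x \<partial>LT)"
    by (rule integral_dominated_convergence[where w=q]) (use TL T0 Tq d in \<open>auto intro: order_trans\<close>)
  then have I: "(\<lambda>i. \<integral>x. T i x \<partial>LT) \<longlonglongrightarrow> 1" using d by simp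
  have I1: "(\<integral>x. T i x \<partial>LT) \<le> 1" for i
    using integral_mono[OF Ti d(3)] Tq d by simp
  define Q where "Q i x = nrm (T i) * T i x" for i x
  have Q0: "0 \<le> Q i x" for i x using nrm_bounds(1)[of "T i"] T0[of i x] by (simp add: Q_def)
  have Qq: "Q i x \<le> 2 * q x" for i x
    unfolding Q_def using nrm_bounds[of "T i"] T0[of i x] Tq[of i x] by (intro mult_mono) auto
  have QB: "Q i x \<le> 2 * real (Suc i)" for i x
    unfolding Q_def using nrm_bounds[of "T i"] T0[of i x] by (intro mult_mono) (auto simp: T_def)
  have Qm [measurable]: "Q i \<in> borel_measurable LT" for i unfolding Q_def by measurable
  have QL: "(\<lambda>i. Q i x) \<longlonglongrightarrow> q x" for x
  proof -
    have "(\<lambda>i. nrm (T i) * T i x) \<longlonglongrightarrow> 1 * q x"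
      using nrm_tendsto[OF I Ti] T0 by (intro tendsto_mult TL) auto
    then show ?thesis by (simp add: Q_def)
  qed
  show ?thesis
  proof (rule core_limit)
    have "\<forall>\<^sub>F i in sequentially. is_density (Q i)"
      unfolding Q_def[abs_def] by (rule nrm_density[OF I Ti]) (use T0 in auto)
    then show "\<forall>\<^sub>F i in sequentially. core (bil W (Q i) (Q i)) (Ent (Q i)) (fc (Q i))"
      by eventually_elim (rule core_bounded[OF _ Q0 QB])
    show "(\<lambda>i. bil W (Q i) (Q i)) \<longlonglongrightarrow> bil W q q"
    proof (rule bil_tendsto[OF Qm d(1) Qm d(1) AE_I2[OF QL] AE_I2[OF QL]])
      show "integrable LL (\<lambda>z. 4 * \<bar>ker W q q z\<bar>)"
        using iW by simp
      show "AE z in LL. \<bar>ker W (Q i) (Q i) z\<bar> \<le> 4 * \<bar>ker W q q z\<bar>" for i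
      proof (rule AE_I2)
        fix z
        have "Q i (fst z) * Q i (snd z) \<le> (2 * q (fst z)) * (2 * q (snd z))"
          using Q0[of i] Qq[of i] q0 by (intro mult_mono) auto
        then have "\<bar>W (fst z - snd z)\<bar> * (Q i (fst z) * Q i (snd z)) \<le> \<bar>W (fst z - snd z)\<bar> * ((2 * q (fst z)) * (2 * q (snd z)))"
          by (intro mult_left_mono) auto
        then show "\<bar>ker W (Q i) (Q i) z\<bar> \<le> 4 * \<bar>ker W q q z\<bar>"
          using Q0[of i] q0 by (simp add: abs_mult mult_ac)
      qed
    qed
    show "(\<lambda>i. Ent (Q i)) \<longlonglongrightarrow> Ent q"
      unfolding Ent_def
    proof (rule integral_dominated_convergence[where w="\<lambda>x. 2 * \<bar>q x * ln (q x)\<bar> + 2 * q x"])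
      show "AE x in LT. (\<lambda>i. Q i x * ln (Q i x)) \<longlonglongrightarrow> q x * ln (q x)"
        using QL by (intro AE_I2 tendsto_xlnx[OF _ Q0])
      show "AE x in LT. norm (Q i x * ln (Q i x)) \<le> 2 * \<bar>q x * ln (q x)\<bar> + 2 * q x" for i
      proof (rule AE_I2)
        fix x
        show "norm (Q i x * ln (Q i x)) \<le> 2 * \<bar>q x * ln (q x)\<bar> + 2 * q x"
        proof (cases "q x = 0")
          case True
          then have "Q i x = 0" using Qq[of i x] Q0[of i x] by simp
          then show ?thesis using True by simp
        next
          case False
          then have qp: "q x > 0" using q0[of x] by simp
          then have Tp: "T i x > 0" by (simp add: T_def)
          \<comment> \<open>Truncation only loses mass, so the normalising factor is at least 1 and
            its logarithm lies in [0, 1].\<close>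
          have n: "1 \<le> nrm (T i)" "nrm (T i) \<le> 2" using nrm_ge_1[OF I1] nrm_bounds by auto
          have "ln (nrm (T i)) \<le> nrm (T i) - 1" using n by (intro ln_le_minus_one) auto
          then have l: "0 \<le> ln (nrm (T i))" "ln (nrm (T i)) \<le> 1" using n by auto
          \<comment> \<open>The truncation level is at least 1: where it acts, 1 \<le> T \<le> q,
            and x ln x increases there. A lower level could break this domination.\<close>
          have T: "\<bar>T i x * ln (T i x)\<bar> \<le> \<bar>q x * ln (q x)\<bar>"
          proof (cases "q x \<le> real (Suc i)")
            case False
            then have t: "T i x = real (Suc i)" by (simp add: T_def)
            have "0 \<le> real (Suc i) * ln (real (Suc i))" by simp
            moreover have "real (Suc i) * ln (real (Suc i)) \<le> q x * ln (q x)"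
              using False qp by (intro mult_mono) auto
            ultimately show ?thesis unfolding t by linarith
          qed (simp add: T_def)
          have "Q i x * ln (Q i x) = nrm (T i) * (T i x * ln (T i x)) + nrm (T i) * T i x * ln (nrm (T i))"
            unfolding Q_def using Tp n by (simp add: ln_mult algebra_simps)
          then have "\<bar>Q i x * ln (Q i x)\<bar> \<le> nrm (T i) * \<bar>T i x * ln (T i x)\<bar> + nrm (T i) * T i x * ln (nrm (T i))"
            using n l Tp by (simp add: abs_mult order_trans[OF abs_triangle_ineq])
          moreover have "nrm (T i) * \<bar>T i x * ln (T i x)\<bar> \<le> 2 * \<bar>q x * ln (q x)\<bar>"
            using n T by (intro mult_mono) auto
          moreover have "(nrm (T i) * T i x) * ln (nrm (T i)) \<le> (2 * q x) * 1"
            using n l Tp Tq[of i x] qp by (intro mult_mono) auto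
          ultimately show ?thesis by simp
        qed
      qed
    qed (use ient d in auto)
    show "(\<lambda>i. fc (Q i) j) \<longlonglongrightarrow> fc q j" for j
      unfolding fc_def by (rule tendsto_fourier[where u="\<lambda>x. 2 * q x"]) (use QL Q0 Qq d in auto)
  qed
qed

text \<open>With one argument kept equal to \<open>q\<close>, the form vanishes on trigonometric
  polynomials by \<open>bil_trig\<close>, then on bounded functions by approximation, and finally on
  the truncations of \<open>q\<close>.\<close>

lemma bil_zero:
  assumes q: "is_density q" and q0: "\<And>x. 0 \<le> q x"
    and iW: "integrable LL (ker W q q)"
    and c: "\<And>j. 1 \<le> j \<Longrightarrow> fc q j = 0"
  shows "bil W q q = 0"
proof -
  note d = densityD[OF q]
  have [measurable]: "q \<in> borel_measurable LT" using d by simp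
  have Wq: "integrable LL (\<lambda>z. \<bar>W (fst z - snd z) * q (snd z)\<bar>)"
    using integrable_W_snd[OF d(3)] by simp
  have z: "cplx (What W (nat \<bar>k\<bar>)) * cnj (fourier q k) = 0" for k
  proof (cases "m dvd nat \<bar>k\<bar> \<and> k \<noteq> 0")
    case True
    then obtain j where j: "nat \<bar>k\<bar> = m * j" by (blast elim: dvdE)
    then have "1 \<le> j" using True m_pos by (cases j) auto
    then have "fourier q (int (m * j)) = 0" using c by (simp add: fc_def)
    moreover have "k = int (m * j) \<or> k = - int (m * j)" using j by linarith
    ultimately show ?thesis using fourier_cnj[of q "int (m * j)"] by auto
  next
    case False
    then have "What W (nat \<bar>k\<bar>) = 0" using What_0 What_not_dvd by (cases "k = 0") auto
    then show ?thesis by simp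
  qed
  have tp: "bil W P q = 0" if "trig_poly P" for P
  proof -
    obtain L where L: "\<And>x. cplx (P x) = (\<Sum>k\<in>{-int L..int L}. fourier P k * ech k x)"
      using trig_polyE[OF \<open>trig_poly P\<close>] by blast
    have "cplx (bil W P q) = (\<Sum>k\<in>{-int L..int L}. fourier P k * (cplx (What W (nat \<bar>k\<bar>)) * cnj (fourier q k)))"
      unfolding bil_trig[OF L d(3)] by (simp only: ac_simps)
    then show ?thesis unfolding z by simp
  qed
  have bdd: "bil W g q = 0" if gm: "g \<in> borel_measurable LT" and g: "\<And>x. 0 \<le> g x" "\<And>x. g x \<le> M" for g M
  proof -
    obtain P where P: "\<And>i::nat. trig_poly (P i)" "\<And>i x. 0 \<le> P i x" "\<And>i x. P i x \<le> M + 2"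
      and lim: "AE x in LT. (\<lambda>i. P i x) \<longlonglongrightarrow> g x"
      using trig_poly_AE_approx[OF gm g] by blast
    have Pm: "P i \<in> borel_measurable LT" for i
      using trig_poly_measurable[OF P(1)] by (rule measurable_LT_borel)
    have "(\<lambda>i. bil W (P i) q) \<longlonglongrightarrow> bil W g q"
    proof (rule bil_tendsto[OF Pm gm d(1) d(1) lim AE_I2[OF tendsto_const]])
      show "integrable LL (\<lambda>z. (M + 2) * \<bar>W (fst z - snd z) * q (snd z)\<bar>)" using Wq by simp
      show "AE z in LL. \<bar>ker W (P i) q z\<bar> \<le> (M + 2) * \<bar>W (fst z - snd z) * q (snd z)\<bar>" for i
      proof (rule AE_I2)
        fix z
        have "P i (fst z) * \<bar>W (fst z - snd z) * q (snd z)\<bar> \<le> (M + 2) * \<bar>W (fst z - snd z) * q (snd z)\<bar>"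
          using P by (intro mult_right_mono) auto
        then show "\<bar>ker W (P i) q z\<bar> \<le> (M + 2) * \<bar>W (fst z - snd z) * q (snd z)\<bar>"
          using P(2)[of i "fst z"] by (simp add: abs_mult mult_ac)
      qed
    qed
    then have "(\<lambda>i. 0) \<longlonglongrightarrow> bil W g q" using tp[OF P(1)] by simp
    then show ?thesis using LIMSEQ_unique tendsto_const by blast
  qed
  define T where "T i x = min (q x) (real (Suc i))" for i x
  have T0: "0 \<le> T i x" and Tq: "T i x \<le> q x" for i x using q0 by (auto simp: T_def)
  have Tm [measurable]: "T i \<in> borel_measurable LT" for i unfolding T_def by measurable
  have TL: "(\<lambda>i. T i x) \<longlonglongrightarrow> q x" for x
    unfolding T_def by (rule tendsto_truncate)
  have "(\<lambda>i. bil W (T i) q) \<longlonglongrightarrow> bil W q q"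
  proof (rule bil_tendsto[OF Tm d(1) d(1) d(1) AE_I2[OF TL] AE_I2[OF tendsto_const]])
    show "integrable LL (\<lambda>z. \<bar>ker W q q z\<bar>)" using iW by simp
    show "AE z in LL. \<bar>ker W (T i) q z\<bar> \<le> \<bar>ker W q q z\<bar>" for i
      using T0[of i] Tq[of i] q0 by (intro AE_I2) (auto simp: abs_mult intro!: mult_mono)
  qed
  moreover have "bil W (T i) q = 0" for i
    by (rule bdd[where M="real (Suc i)"]) (use T0 in \<open>auto simp: T_def\<close>)
  ultimately have "(\<lambda>i. 0) \<longlonglongrightarrow> bil W q q" by simp
  then show ?thesis using LIMSEQ_unique tendsto_const by blast
qed

end

lemma bil_cong_AE:
  assumes "W \<in> borel_measurable borel" "p \<in> borel_measurable LT" "q \<in> borel_measurable LT" "AE x in LT. p x = q x"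
  shows "bil W p p = bil W q q"
    and "integrable LL (ker W p p) \<longleftrightarrow>
      integrable LL (ker W q q)"
proof -
  note [measurable] = assms(1-3)
  have AE: "AE z in LL. ker W p p z = ker W q q z"
    using AE_fst_LT[OF assms(4)] AE_snd_LT[OF assms(4)] by eventually_elim simp
  show "bil W p p = bil W q q"
    unfolding bil_def using AE by (intro integral_cong_AE) auto
  show "integrable LL (ker W p p) \<longleftrightarrow>
      integrable LL (ker W q q)"
    using AE by (intro integrable_cong_AE) auto
qed

context crit_potential
begin

text \<open>Testing \<open>W \<le> C\<close> against Fejer kernels rules out the borderline potential
  \<open>- ln (2 * \<bar>sin (pi * m * x)\<bar>)\<close>.\<close>

lemma ex_gap_pos: "\<exists>j\<ge>1. 0 < gap j"
proof (rule ccontr)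
  assume "\<not> ?thesis"
  then have gap0: "gap j = 0" if "1 \<le> j" for j
    using gap_nonneg[OF that] that by (meson not_less order_antisym)
  then have Wh: "What W (m * j) = 1 / (2 * real j)" if "1 \<le> j" for j
    using that by (simp add: gap_def field_simps)
  \<comment> \<open>|S|^2 is \<open>N\<close> times a Fejer kernel and has integral
    \<open>N\<close>, so its pairing with \<open>W\<close> is at most \<open>C * N\<close>. The same
    pairing is a double sum of the coefficients at m |k - l|.\<close>
  have bound: "(\<Sum>k<N. (harm k :: real)) \<le> 2 * (C * real N)" for N
  proof -
    define S where "S x = (\<Sum>k<N. 1 * ech (int (m * k)) x)" for x
    have Scont: "continuous_on UNIV (\<lambda>x. (norm (S x))\<^sup>2)" unfolding S_def by (intro continuous_intros)
    have [measurable]: "(\<lambda>x. (norm (S x))\<^sup>2) \<in> borel_measurable LT"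
      by (rule measurable_LT_borel[OF borel_measurable_continuous_onI[OF Scont]])
    have WL: "W \<in> borel_measurable LT" using W_integrable by simp
    have SN: "(norm (S x))\<^sup>2 \<le> (real N)\<^sup>2" for x
    proof (intro power_mono)
      show "norm (S x) \<le> real N" unfolding S_def
        using sum_norm_le[of "{..<N}" "\<lambda>k. 1 * ech (int (m * k)) x" "\<lambda>k. 1"] by simp
    qed simp
    have iS: "integrable LT (\<lambda>x. (norm (S x))\<^sup>2)"
      by (rule LT.integrable_const_bound[where B="(real N)\<^sup>2"]) (use SN in auto)
    have iWS: "integrable LT (\<lambda>x. W x * (norm (S x))\<^sup>2)"
      by (rule Bochner_Integration.integrable_bound[OF integrable_mult_right[OF W_integrable, of "(real N)\<^sup>2"]])
        (use WL SN in \<open>auto simp: abs_mult mult.commute[of "(real N)\<^sup>2"] intro!: mult_left_mono AE_I2\<close>)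
    have "cplx (\<integral>x. W x * (norm (S x))\<^sup>2 \<partial>LT) = (\<integral>x. cplx (W x * (norm (S x))\<^sup>2) \<partial>LT)"
      by (rule integral_complex_of_real[symmetric])
    also have "\<dots> = (\<integral>x. (\<Sum>k<N. \<Sum>l<N. cplx (W x) * ech (int (m * k) - int (m * l)) x) \<partial>LT)"
    proof (rule Bochner_Integration.integral_cong)
      fix x
      show "cplx (W x * (norm (S x))\<^sup>2) = (\<Sum>k<N. \<Sum>l<N. cplx (W x) * ech (int (m * k) - int (m * l)) x)"
        unfolding S_def of_real_mult norm_sum_ech_squared sum_distrib_left by simp
    qed simp
    also have "\<dots> = (\<Sum>k<N. \<Sum>l<N. cplx (What W (nat \<bar>int (m * k) - int (m * l)\<bar>)))"
    proof -
      have i: "integrable LT (\<lambda>x. cplx (W x) * ech k x)" for k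
        using W_integrable by (intro integrable_mult_ech) simp
      show ?thesis
        using i by (simp only: Bochner_Integration.integral_sum Bochner_Integration.integrable_sum integral_W_ech)
    qed
    also have "\<dots> = cplx (\<Sum>k<N. \<Sum>l<N. What W (nat \<bar>int (m * k) - int (m * l)\<bar>))"
      by simp
    finally have eq: "(\<integral>x. W x * (norm (S x))\<^sup>2 \<partial>LT) = (\<Sum>k<N. \<Sum>l<N. What W (nat \<bar>int (m * k) - int (m * l)\<bar>))"
      by (simp only: of_real_eq_iff)
    have What': "What W (nat \<bar>int (m * k) - int (m * l)\<bar>) = What W (m * nat \<bar>int k - int l\<bar>)" for k l
      by (simp add: nat_mult_distrib abs_mult flip: right_diff_distrib)
    have What_nonneg: "0 \<le> What W (m * j)" for j
      using Wh[of j] What_0 by (cases j) auto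
    \<comment> \<open>Row \<open>k\<close> below the diagonal runs through the differences 1 to k
      and sums to \<open>harm k / 2\<close>; the other entries are nonnegative.\<close>
    have "(\<Sum>k<N. (harm k :: real)) / 2 = (\<Sum>k<N. \<Sum>l<k. What W (m * nat \<bar>int k - int l\<bar>))"
      unfolding sum_divide_distrib
    proof (intro sum.cong refl)
      fix k
      have "(\<Sum>l<k. What W (m * nat \<bar>int k - int l\<bar>)) = (\<Sum>j=1..k. 1 / (2 * real j))"
        by (rule sum.reindex_bij_witness[of _ "\<lambda>j. k - j" "\<lambda>l. k - l"]) (auto simp: Wh of_nat_diff nat_diff_distrib)
      also have "\<dots> = harm k / 2" by (simp add: harm_def sum_divide_distrib field_simps)
      finally show "(harm k :: real) / 2 = (\<Sum>l<k. What W (m * nat \<bar>int k - int l\<bar>))" by simp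
    qed
    also have "\<dots> \<le> (\<Sum>k<N. \<Sum>l<N. What W (m * nat \<bar>int k - int l\<bar>))"
      by (intro sum_mono sum_mono2) (auto simp: What_nonneg)
    also have "\<dots> = (\<integral>x. W x * (norm (S x))\<^sup>2 \<partial>LT)" unfolding eq What' ..
    also have "\<dots> \<le> (\<integral>x. C * (norm (S x))\<^sup>2 \<partial>LT)"
      using iS iWS W_le by (intro integral_mono) (auto intro!: mult_right_mono)
    also have "\<dots> = C * real N"
      using Parseval_sum[OF m_pos, of "\<lambda>k. 1" N] by (simp add: S_def)
    finally show ?thesis by simp
  qed
  \<comment> \<open>Summing over n \<le> k < 2 n turns the bound on sums into one on
    \<open>harm n\<close>, against the divergence of the harmonic series.\<close>
  have "(harm n :: real) \<le> 4 * C" if "1 \<le> n" for n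
  proof -
    have "real n * harm n = (\<Sum>k\<in>{n..<n + n}. (harm n :: real))" by simp
    also have "\<dots> \<le> (\<Sum>k\<in>{n..<n + n}. harm k)"
      by (intro sum_mono harm_mono) auto
    also have "\<dots> \<le> (\<Sum>k<n + n. harm k)"
      by (intro sum_mono2) (auto simp: harm_nonneg)
    also have "\<dots> \<le> real n * (4 * C)" using bound[of "n + n"] by (simp add: algebra_simps)
    finally show ?thesis using that by (simp add: mult_le_cancel_left)
  qed
  moreover have "\<forall>\<^sub>F n in sequentially. 4 * C < (harm n :: real)"
    using harm_at_top unfolding filterlim_at_top_dense by blast
  then obtain n :: nat where "4 * C < (harm n :: real)" "1 \<le> n"
    using eventually_conj[OF _ eventually_ge_at_top[of "1::nat"]] eventually_happens'[OF sequentially_bot] by blast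
  ultimately show False by (meson not_less)
qed

theorem energy_entropy:
  assumes q: "is_density q" and ient: "finite_ent q"
    and iW: "integrable LL (ker W q q)"
  shows "bil W q q \<le> Ent q" and "bil W q q = Ent q \<Longrightarrow> AE x in LT. q x = 1"
proof -
  note d = densityD[OF q]
  \<comment> \<open>A representative that is nonnegative everywhere, as \<open>core_nonneg\<close>
    and \<open>bil_zero\<close> ask.\<close>
  define p where "p x = max 0 (q x)" for x
  have p0: "0 \<le> p x" for x by (simp add: p_def)
  have [measurable]: "q \<in> borel_measurable LT" using d by simp
  have pm [measurable]: "p \<in> borel_measurable LT" unfolding p_def by measurable
  have pq: "AE x in LT. p x = q x" using d(2) by eventually_elim (simp add: p_def)
  have "integrable LT p" "(\<integral>x. p x \<partial>LT) = 1"
    using integrable_cong_AE[OF pm d(1) pq] integral_cong_AE[OF pm d(1) pq] d by auto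
  then have p: "is_density p" using p0 by (simp add: is_density_def)
  have AEent: "AE x in LT. p x * ln (p x) = q x * ln (q x)" using pq by eventually_elim simp
  have pent: "finite_ent p"
    using ient AEent by (subst integrable_cong_AE[of _ _ "\<lambda>x. q x * ln (q x)"]) auto
  have Ent: "Ent p = Ent q" unfolding Ent_def using AEent by (intro integral_cong_AE) auto
  have bil: "bil W p p = bil W q q" by (rule bil_cong_AE[OF W_measurable pm d(1) pq])
  have pW: "integrable LL (ker W p p)"
    using bil_cong_AE(2)[OF W_measurable pm d(1) pq] iW by simp
  have core: "core (bil W q q) (Ent q) (fc p)"
    using core_nonneg[OF p p0 pent pW] by (simp add: Ent bil)
  have nn: "0 \<le> (\<Sum>j=1..N. gap j * (norm (fc p j))\<^sup>2)" "0 \<le> defect (fc p) k * exp (- Ent q)" for N k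
    by (auto intro!: sum_nonneg mult_nonneg_nonneg gap_nonneg defect_nonneg)
  show "bil W q q \<le> Ent q"
    using core[unfolded core_def, rule_format, of 0 0] nn(1)[of 0] nn(2)[of 0] by linarith
  assume eq: "bil W q q = Ent q"
  have z: "(\<Sum>j=1..N. gap j * (norm (fc p j))\<^sup>2) = 0" "defect (fc p) k * exp (- Ent q) = 0" for N k
    using core[unfolded core_def, rule_format, of N k] nn(1)[of N] nn(2)[of k] eq by linarith+
  have geo: "fc p (Suc k) = fc p 1 ^ Suc k" for k
    by (rule expcoef_equality) (use z(2) in \<open>simp add: defect_def\<close>)
  have "fc p j = 0" if "1 \<le> j" for j
  proof (rule ccontr)
    assume "fc p j \<noteq> 0"
    then have "fc p 1 \<noteq> 0" using geo[of "j - 1"] that by auto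
    \<comment> \<open>A positive gap at \<open>i\<close> forces \<open>fc p i\<close> to vanish, yet
      it is a power of the nonzero \<open>fc p 1\<close>.\<close>
    obtain i where i: "1 \<le> i" "0 < gap i" using ex_gap_pos by blast
    have "fc p i \<noteq> 0" using geo[of "i - 1"] i \<open>fc p 1 \<noteq> 0\<close> by simp
    then have "0 < gap i * (norm (fc p i))\<^sup>2" using i by simp
    also have "\<dots> \<le> (\<Sum>j=1..i. gap j * (norm (fc p j))\<^sup>2)"
      using i by (intro member_le_sum) (auto intro!: mult_nonneg_nonneg gap_nonneg)
    finally show False using z(1) by simp
  qed
  \<comment> \<open>Without coefficients there is no energy, and equality makes the entropy 0 as
    well.\<close>
  then have "bil W p p = 0" by (intro bil_zero[OF p p0 pW])
  then have "Ent q \<le> 0" using eq bil by simp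
  then show "AE x in LT. q x = 1" by (rule Ent_zero_imp_AE_one[OF q ient])
qed

end

subsection \<open>Weak compactness of entropy sublevel sets\<close>

text \<open>Seen on the whole line, where Helly selection for distributions applies. A weak limit
  might charge the excluded endpoint 1/2; absolute continuity rules this out afterwards.\<close>

definition bmeas :: "(real \<Rightarrow> real) \<Rightarrow> real measure" where
  "bmeas q = distr (dmeas q) borel (\<lambda>x. x)"

lemma measurable_dmeas: "f \<in> borel_measurable borel \<Longrightarrow> f \<in> borel_measurable (dmeas q)"
  using measurable_LT_borel by (simp add: dmeas_def)

lemma real_distribution_bmeas: "is_density q \<Longrightarrow> real_distribution (bmeas q)"
  unfolding bmeas_def
  by (intro prob_space.real_distribution_distr prob_space_dmeas measurable_dmeas) auto

lemma integral_bmeas: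
  fixes f :: "real \<Rightarrow> real"
  assumes q: "is_density q" and f: "f \<in> borel_measurable borel"
  shows "(\<integral>x. f x \<partial>(bmeas q)) = (\<integral>x. q x * f x \<partial>LT)"
  unfolding bmeas_def using integral_dmeas[OF q f] measurable_dmeas[of "\<lambda>x. x" q] f
  by (subst integral_distr) auto

lemma tight_bmeas:
  assumes "\<And>i. is_density (q i)" shows "tight (\<lambda>i. bmeas (q i))"
  unfolding tight_def
proof (intro conjI allI impI)
  fix \<epsilon> :: real assume \<epsilon>: "0 < \<epsilon>"
  have "measure (bmeas (q n)) {-1<..1} = 1" for n
  proof -
    interpret prob_space "dmeas (q n)" by (rule prob_space_dmeas[OF assms])
    have "measure (bmeas (q n)) {-1<..1} = measure (dmeas (q n)) ((\<lambda>x. x) -` {-1<..1} \<inter> space (dmeas (q n)))"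
      unfolding bmeas_def by (rule measure_distr) (auto intro: measurable_dmeas)
    also have "(\<lambda>x. x) -` {-1<..1} \<inter> space (dmeas (q n)) = space (dmeas (q n))"
      by (auto simp: dmeas_def Tor_def)
    finally show ?thesis by (simp add: prob_space)
  qed
  then show "\<exists>a b::real. a < b \<and> (\<forall>n. measure (bmeas (q n)) {a<..b} > 1 - \<epsilon>)"
    using \<epsilon> by (intro exI[of _ "-1"] exI[of _ 1]) auto
qed (rule real_distribution_bmeas[OF assms])

definition BT :: "real measure" where
  "BT = distr LT borel (\<lambda>x. x)"

lemma sets_BT [simp, measurable_cong]: "sets BT = sets borel" and space_BT [simp]: "space BT = UNIV"
  by (simp_all add: BT_def)

interpretation BT: prob_space BT
  unfolding BT_def by (rule LT.prob_space_distr) (rule measurable_ident_LT_borel)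

lemma integral_BT:
  fixes f :: "real \<Rightarrow> real"
  assumes "f \<in> borel_measurable borel"
  shows "(\<integral>x. f x \<partial>BT) = (\<integral>x. f x \<partial>LT)" "integrable BT f \<longleftrightarrow> integrable LT f"
  unfolding BT_def using assms measurable_ident_LT_borel
  by (auto simp: integral_distr integrable_distr_eq)

lemma integrable_density_mult:
  assumes p: "is_density p" and f: "f \<in> borel_measurable LT" and bd: "\<And>x. \<bar>f x\<bar> \<le> (B::real)"
  shows "integrable LT (\<lambda>x. p x * f x)"
proof (rule Bochner_Integration.integrable_bound)
  note d = densityD[OF p]
  show "integrable LT (\<lambda>x. B * p x)" using d by simp
  show "AE x in LT. norm (p x * f x) \<le> norm (B * p x)"
  proof (rule AE_I2)
    fix x
    have "\<bar>f x\<bar> \<le> \<bar>B\<bar>" using bd[of x] by linarith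
    then show "norm (p x * f x) \<le> norm (B * p x)" by (simp add: abs_mult mult.commute[of "\<bar>B\<bar>"] mult_left_mono)
  qed
qed (use densityD[OF p] f in simp)

text \<open>The integrated \<open>Young_entropy\<close>. It turns an entropy bound into inequalities
  linear in the density, which survive weak limits.\<close>

lemma entropy_dual:
  assumes p: "is_density p" and ent: "finite_ent p"
    and f: "f \<in> borel_measurable LT" and bd: "\<And>x. \<bar>f x\<bar> \<le> B"
  shows "(\<integral>x. p x * f x \<partial>LT) \<le> Ent p + (\<integral>x. exp (f x - 1) \<partial>LT)"
proof -
  note d = densityD[OF p]
  have ie: "integrable LT (\<lambda>x. exp (f x - 1))"
  proof (rule LT.integrable_const_bound[where B="exp B"])
    show "AE x in LT. norm (exp (f x - 1)) \<le> exp B"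
    proof (rule AE_I2)
      fix x show "norm (exp (f x - 1)) \<le> exp B" using bd[of x] by simp
    qed
  qed (use f in simp)
  have "(\<integral>x. p x * f x \<partial>LT) \<le> (\<integral>x. p x * ln (p x) + exp (f x - 1) \<partial>LT)"
  proof (rule integral_mono_AE)
    show "AE x in LT. p x * f x \<le> p x * ln (p x) + exp (f x - 1)"
      using d(2) by eventually_elim (subst mult.commute, rule Young_entropy)
  qed (use integrable_density_mult[OF p f bd] ent ie in auto)
  also have "\<dots> = Ent p + (\<integral>x. exp (f x - 1) \<partial>LT)" using ent ie by (simp add: Ent_def)
  finally show ?thesis .
qed

text \<open>Testing the dual bound with \<open>N\<close> times the indicator of a small open \<open>U \<supseteq> E\<close> gives \<open>N * M E \<le> R + 2\<close>.\<close>

lemma entropy_bound_absolutely_continuous: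
  fixes R :: real
  assumes M: "real_distribution M"
    and bound: "\<And>f B. continuous_on UNIV f \<Longrightarrow> (\<And>x. \<bar>f x\<bar> \<le> B) \<Longrightarrow>
      (\<integral>x. f x \<partial>M) \<le> R + (\<integral>x. exp (f x - 1) \<partial>BT)"
  shows "absolutely_continuous BT M"
  unfolding absolutely_continuous_def
proof
  interpret M: real_distribution M by fact
  fix E assume "E \<in> null_sets BT"
  then have E: "E \<in> sets borel" "emeasure BT E = 0" by auto
  have key: "real N * measure M E \<le> R + 2" for N :: nat
  proof -
    \<comment> \<open>Chosen so that exp N times the mass of \<open>U\<close> is at most 1/2; being
      below 1, it also keeps \<open>U\<close> from being the whole line.\<close>
    define e where "e = exp (- real N) / 2"
    have e: "0 < e" "e < 1"
    proof -
      have "exp (- real N) \<le> 1" by simp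
      then show "0 < e" "e < 1" unfolding e_def using exp_gt_zero[of "- real N"] by linarith+
    qed
    have "(INF U \<in> {U. E \<subseteq> U \<and> open U}. emeasure BT U) < ennreal e"
      using outer_regular[of BT E] E e by (simp add: BT.emeasure_finite)
    then obtain U where U: "E \<subseteq> U" "open U" "emeasure BT U < ennreal e" by (auto simp: INF_less_iff)
    have Ub [measurable]: "U \<in> sets borel" using U by simp
    have mU: "measure BT U < e" using U(3) e by (simp add: BT.emeasure_eq_measure ennreal_less_iff)
    \<comment> \<open>\<open>infdist\<close> to the empty set is 0 by convention, so the complement
      must be nonempty for the functions below to detect \<open>U\<close>.\<close>
    have ne: "- U \<noteq> {}"
    proof
      assume "- U = {}"
      then have "measure BT U = 1" using BT.prob_space by (simp add: Compl_eq_Diff_UNIV) (metis Diff_eq_empty_iff top.extremum_unique)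
      then show False using mU e by simp
    qed
    \<comment> \<open>Continuous functions increasing in \<open>k\<close> to \<open>N\<close> times
      the indicator of the open set \<open>U\<close>.\<close>
    define f where "f k x = real N * min 1 (real k * infdist x (- U))" for k x
    have fc: "continuous_on UNIV (f k)" for k unfolding f_def by (intro continuous_intros)
    have f01: "0 \<le> f k x" "f k x \<le> real N" for k x
      unfolding f_def using infdist_nonneg[of x "- U"]
        mult_left_mono[of "min 1 (real k * infdist x (- U))" 1 "real N"] by auto
    have fU: "f k x = 0" if "x \<notin> U" for k x
      using that by (simp add: f_def)
    have flim: "(\<lambda>k. f k x) \<longlonglongrightarrow> real N * indicator U x" for x
    proof (cases "x \<in> U")
      case False
      then show ?thesis by (simp add: fU)
    next
      case True
      have cl: "closed (- U)" using U(2) by (simp add: closed_Compl)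
      have pos: "0 < infdist x (- U)"
        using in_closed_iff_infdist_zero[OF cl ne, of x] infdist_nonneg[of x "- U"] True by auto
      obtain n where n: "1 / infdist x (- U) \<le> real n" using real_arch_simple by blast
      have "\<forall>\<^sub>F k in sequentially. f k x = real N * indicator U x"
        using eventually_ge_at_top[of n]
      proof eventually_elim
        case (elim k)
        then have "1 / infdist x (- U) \<le> real k" using n by linarith
        then have "1 \<le> real k * infdist x (- U)" using pos by (simp add: pos_divide_le_eq)
        then show ?case using True by (simp add: f_def)
      qed
      then show ?thesis by (rule tendsto_eventually)
    qed
    have fm: "f k \<in> borel_measurable borel" for k using fc by (rule borel_measurable_continuous_onI)
    have iU: "integrable BT (indicator U :: real \<Rightarrow> real)"
      by (rule BT.integrable_const_bound[where B=1]) auto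
    have "(\<integral>x. f k x \<partial>M) \<le> R + 2" for k
    proof -
      have "(\<integral>x. f k x \<partial>M) \<le> R + (\<integral>x. exp (f k x - 1) \<partial>BT)"
        by (rule bound[OF fc, where B="real N"]) (use f01 in \<open>auto simp: abs_le_iff intro: order_trans[of _ 0]\<close>)
      also have "(\<integral>x. exp (f k x - 1) \<partial>BT) \<le> (\<integral>x. 1 + exp (real N) * indicator U x \<partial>BT)"
      proof (rule integral_mono)
        have fm' [measurable]: "f k \<in> borel_measurable BT" using fm[of k] by simp
        show "integrable BT (\<lambda>x. exp (f k x - 1))"
        proof (rule BT.integrable_const_bound[where B="exp (real N)"])
          show "AE x in BT. norm (exp (f k x - 1)) \<le> exp (real N)"
          proof (rule AE_I2)
            fix x show "norm (exp (f k x - 1)) \<le> exp (real N)" using f01(2)[of k x] by simp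
          qed
        qed simp
        show "integrable BT (\<lambda>x. 1 + exp (real N) * indicator U x)"
          by (intro Bochner_Integration.integrable_add integrable_mult_right iU) simp
        show "exp (f k x - 1) \<le> 1 + exp (real N) * indicator U x" for x
        proof (cases "x \<in> U")
          case True
          have "exp (f k x - 1) \<le> exp (real N)" using f01(2)[of k x] by simp
          then have "exp (f k x - 1) \<le> 1 + exp (real N)" by linarith
          then show ?thesis using True by simp
        qed (simp add: fU)
      qed
      also have "\<dots> = 1 + exp (real N) * measure BT U" using BT.prob_space iU by simp
      also have "exp (real N) * measure BT U \<le> exp (real N) * e" using mU by (intro mult_left_mono) auto
      also have "exp (real N) * e = 1 / 2" by (simp add: e_def exp_minus field_simps)
      finally show ?thesis by simp
    qed
    moreover have "(\<lambda>k. \<integral>x. f k x \<partial>M) \<longlonglongrightarrow> (\<integral>x. real N * indicator U x \<partial>M)"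
      by (rule integral_dominated_convergence[where w="\<lambda>x. real N"])
        (use fm flim f01 in auto)
    ultimately have "(\<integral>x. real N * indicator U x \<partial>M) \<le> R + 2"
      by (intro LIMSEQ_le_const2[of "\<lambda>k. \<integral>x. f k x \<partial>M"]) auto
    then have "real N * measure M U \<le> R + 2" by simp
    moreover have "measure M E \<le> measure M U" using U(1) by (intro M.finite_measure_mono) auto
    ultimately show ?thesis by (meson mult_left_mono of_nat_0_le_iff order_trans)
  qed
  have "measure M E = 0"
  proof (rule ccontr)
    assume "measure M E \<noteq> 0"
    then have "0 < measure M E" using measure_nonneg[of M E] by linarith
    then obtain N where "R + 2 < real N * measure M E" using reals_Archimedean3 by blast
    then show False using key[of N] by linarith
  qed
  then show "E \<in> null_sets M" using E by (auto simp: null_sets_def M.emeasure_eq_measure)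
qed

text \<open>The optimal test function is 1 + ln p. To make it bounded, \<open>p\<close> is clipped
  between 1 / (k + 1) and k + 1; Fatou's lemma then removes the clipping.\<close>

lemma entropy_bound_from_dual:
  assumes p: "is_density p"
    and bound: "\<And>T B. trig_poly T \<Longrightarrow> (\<And>x. \<bar>T x\<bar> \<le> B) \<Longrightarrow>
      (\<integral>x. p x * T x \<partial>LT) \<le> R + (\<integral>x. exp (T x - 1) \<partial>LT)"
  shows "finite_ent p" "Ent p \<le> R"
proof -
  note d = densityD[OF p]
  have [measurable]: "p \<in> borel_measurable LT" using d by simp
  \<comment> \<open>Bounded measurable functions are a.e. limits of uniformly bounded trigonometric
    polynomials. Adding \<open>B\<close> makes the target nonnegative for the approximation, and
    \<open>T\<close> subtracts it again.\<close>
  have step: "(\<integral>x. p x * f x \<partial>LT) \<le> R + (\<integral>x. exp (f x - 1) \<partial>LT)"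
    if f: "f \<in> borel_measurable LT" and bd: "\<And>x. \<bar>f x\<bar> \<le> B" for f B
  proof -
    have g: "(\<lambda>x. f x + B) \<in> borel_measurable LT" using f by simp
    have g1: "0 \<le> f x + B" "f x + B \<le> 2 * B" for x using bd[of x] by (auto simp: abs_le_iff)
    obtain P where P: "\<And>i::nat. trig_poly (P i)" "\<And>i x. 0 \<le> P i x" "\<And>i x. P i x \<le> 2 * B + 2"
      and lim: "AE x in LT. (\<lambda>i. P i x) \<longlonglongrightarrow> f x + B"
      using trig_poly_AE_approx[OF g g1] by blast
    define T where "T i x = P i x + (- B)" for i x
    have T: "trig_poly (T i)" for i unfolding T_def[abs_def] by (intro trig_poly_add P trig_poly_const)
    have Tm [measurable]: "T i \<in> borel_measurable LT" for i
      by (rule measurable_LT_borel[OF trig_poly_measurable[OF T]])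
    have Tb: "\<bar>T i x\<bar> \<le> B + 2" for i x
      unfolding T_def using P(2,3)[of i x] by (simp add: abs_le_iff)
    have Tl: "AE x in LT. (\<lambda>i. T i x) \<longlonglongrightarrow> f x"
      using lim
    proof eventually_elim
      case (elim x)
      then have "(\<lambda>i. P i x + (- B)) \<longlonglongrightarrow> (f x + B) + (- B)" by (intro tendsto_intros)
      then show ?case by (simp add: T_def)
    qed
    show ?thesis
    proof (rule LIMSEQ_le)
      show "(\<lambda>i. \<integral>x. p x * T i x \<partial>LT) \<longlonglongrightarrow> (\<integral>x. p x * f x \<partial>LT)"
      proof (rule integral_dominated_convergence[where w="\<lambda>x. (B + 2) * \<bar>p x\<bar>"])
        show "AE x in LT. (\<lambda>i. p x * T i x) \<longlonglongrightarrow> p x * f x" using Tl by eventually_elim (intro tendsto_intros)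
        show "AE x in LT. norm (p x * T i x) \<le> (B + 2) * \<bar>p x\<bar>" for i
          using Tb by (auto simp: abs_mult mult.commute[of "B + 2"] intro!: mult_left_mono)
      qed (use d f in auto)
      show "(\<lambda>i. R + (\<integral>x. exp (T i x - 1) \<partial>LT)) \<longlonglongrightarrow> R + (\<integral>x. exp (f x - 1) \<partial>LT)"
      proof (intro tendsto_add tendsto_const integral_dominated_convergence[where w="\<lambda>x. exp (B + 2)"])
        show "AE x in LT. (\<lambda>i. exp (T i x - 1)) \<longlonglongrightarrow> exp (f x - 1)" using Tl by eventually_elim (intro tendsto_intros)
        show "AE x in LT. norm (exp (T i x - 1)) \<le> exp (B + 2)" for i
        proof (rule AE_I2)
          fix x show "norm (exp (T i x - 1)) \<le> exp (B + 2)" using Tb[of i x] by simp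
        qed
      qed (use f in auto)
      show "\<exists>N. \<forall>n\<ge>N. (\<integral>x. p x * T n x \<partial>LT) \<le> R + (\<integral>x. exp (T n x - 1) \<partial>LT)"
        using bound[OF T Tb] by blast
    qed
  qed
  define cl where "cl k x = max (1 / real (Suc k)) (min (p x) (real (Suc k)))" for k x
  define u where "u k x = p x * ln (cl k x)" for k x
  have clm [measurable]: "cl k \<in> borel_measurable LT" for k unfolding cl_def by measurable
  have cl0: "0 < cl k x" for k x unfolding cl_def by (simp add: less_max_iff_disj)
  have cl_le: "cl k x \<le> real (Suc k)" "1 / real (Suc k) \<le> cl k x" for k x
  proof -
    have "1 / real (Suc k) \<le> 1" "1 \<le> real (Suc k)" by simp_all
    then show "cl k x \<le> real (Suc k)" "1 / real (Suc k) \<le> cl k x" unfolding cl_def by linarith+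
  qed
  have lnb: "\<bar>ln (cl k x)\<bar> \<le> ln (real (Suc k))" for k x
  proof -
    have "ln (cl k x) \<le> ln (real (Suc k))" using cl_le(1) cl0 by (subst ln_le_cancel_iff) auto
    moreover have "ln (1 / real (Suc k)) \<le> ln (cl k x)" using cl_le(2)[of k x] cl0[of k x] by (subst ln_le_cancel_iff) auto
    then have "- ln (real (Suc k)) \<le> ln (cl k x)" by (simp add: ln_div)
    ultimately show ?thesis by (simp add: abs_le_iff)
  qed
  have ui: "integrable LT (u k)" for k
    unfolding u_def by (rule integrable_density_mult[OF p _ lnb]) simp
  have cli: "integrable LT (cl k)" for k
    by (rule LT.integrable_const_bound[where B="real (Suc k)"]) (use cl_le cl0 in \<open>auto simp: abs_of_pos\<close>)
  have ubound: "(\<integral>x. u k x \<partial>LT) + 1 \<le> R + (\<integral>x. cl k x \<partial>LT)" for k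
  proof -
    \<comment> \<open>For this test function exp (f - 1) is \<open>cl k\<close>, whose integral
      tends to the mass 1 of \<open>p\<close>.\<close>
    have "(\<integral>x. p x * (1 + ln (cl k x)) \<partial>LT) \<le> R + (\<integral>x. exp (1 + ln (cl k x) - 1) \<partial>LT)"
    proof (rule step)
      show "\<bar>1 + ln (cl k x)\<bar> \<le> 1 + ln (real (Suc k))" for x
        using lnb[of k x] by linarith
    qed simp
    moreover have "(\<integral>x. p x * (1 + ln (cl k x)) \<partial>LT) = (\<integral>x. u k x \<partial>LT) + 1"
      using ui[of k] d by (simp add: u_def[abs_def] algebra_simps)
    ultimately show ?thesis using cl0 by simp
  qed
  have cllim: "(\<lambda>k. cl k x) \<longlonglongrightarrow> max 0 (p x)" for x
    unfolding cl_def by (intro tendsto_max tendsto_truncate lim_1_over_n[THEN LIMSEQ_Suc])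
  have "(\<lambda>k. \<integral>x. cl k x \<partial>LT) \<longlonglongrightarrow> (\<integral>x. max 0 (p x) \<partial>LT)"
  proof (rule integral_dominated_convergence[where w="\<lambda>x. 1 + \<bar>p x\<bar>"])
    show "AE x in LT. norm (cl k x) \<le> 1 + \<bar>p x\<bar>" for k
    proof (rule AE_I2)
      fix x
      have "1 / real (Suc k) \<le> 1" by simp
      then have "cl k x \<le> 1 + \<bar>p x\<bar>" unfolding cl_def by linarith
      then show "norm (cl k x) \<le> 1 + \<bar>p x\<bar>" using cl0[of k x] by simp
    qed
  qed (use cllim d in auto)
  moreover have "(\<integral>x. max 0 (p x) \<partial>LT) = (\<integral>x. p x \<partial>LT)"
    using d(2) by (intro integral_cong_AE) (auto elim!: eventually_mono)
  ultimately have clI: "(\<lambda>k. \<integral>x. cl k x \<partial>LT) \<longlonglongrightarrow> 1" using d by simp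
  have ulim: "AE x in LT. (\<lambda>k. u k x) \<longlonglongrightarrow> p x * ln (p x)"
    using d(2)
  proof eventually_elim
    case (elim x)
    show ?case
    proof (cases "p x = 0")
      case False
      then show ?thesis unfolding u_def using cllim[of x] elim by (intro tendsto_intros) auto
    qed (simp add: u_def)
  qed
  \<comment> \<open>The lower bound for Fatou. Where \<open>p x \<le> cl k x\<close>, clipping only
    raised the logarithm; elsewhere \<open>cl k x\<close> is at least 1.\<close>
  have uge: "AE x in LT. - 1 \<le> u k x" for k
    using d(2)
  proof eventually_elim
    case (elim x)
    show ?case
    proof (cases "p x \<le> cl k x")
      case True
      have "p x * ln (p x) \<le> u k x"
      proof (cases "p x = 0")
        case False
        then show ?thesis unfolding u_def using elim True by (intro mult_left_mono ln_mono) auto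
      qed (simp add: u_def)
      then show ?thesis using xlnx_ge[OF elim] by linarith
    next
      case False
      moreover have "1 \<le> real (Suc k)" by simp
      ultimately have "1 \<le> cl k x" unfolding cl_def by linarith
      then have "0 \<le> u k x" unfolding u_def using elim by simp
      then show ?thesis by simp
    qed
  qed
  have "(\<integral>\<^sup>+x. ennreal (p x * ln (p x) + 1) \<partial>LT) \<le> (\<integral>\<^sup>+x. liminf (\<lambda>k. ennreal (u k x + 1)) \<partial>LT)"
  proof (rule nn_integral_mono_AE)
    show "AE x in LT. ennreal (p x * ln (p x) + 1) \<le> liminf (\<lambda>k. ennreal (u k x + 1))"
      using ulim
    proof eventually_elim
      case (elim x)
      then have "(\<lambda>k. ennreal (u k x + 1)) \<longlonglongrightarrow> ennreal (p x * ln (p x) + 1)"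
        by (intro tendsto_ennrealI tendsto_intros)
      then show ?case by (simp add: lim_imp_Liminf)
    qed
  qed
  also have "\<dots> \<le> liminf (\<lambda>k. \<integral>\<^sup>+x. ennreal (u k x + 1) \<partial>LT)"
    unfolding u_def by (rule nn_integral_liminf) measurable
  also have "\<dots> \<le> liminf (\<lambda>k. ennreal (R + (\<integral>x. cl k x \<partial>LT)))"
  proof (rule Liminf_mono, rule always_eventually, rule allI)
    fix k
    have "(\<integral>\<^sup>+x. ennreal (u k x + 1) \<partial>LT) = ennreal (\<integral>x. u k x + 1 \<partial>LT)"
    proof (rule nn_integral_eq_integral)
      show "AE x in LT. 0 \<le> u k x + 1" using uge[of k] by eventually_elim linarith
    qed (use ui in simp)
    also have "(\<integral>x. u k x + 1 \<partial>LT) = (\<integral>x. u k x \<partial>LT) + 1" using ui by simp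
    finally show "(\<integral>\<^sup>+x. ennreal (u k x + 1) \<partial>LT) \<le> ennreal (R + (\<integral>x. cl k x \<partial>LT))"
      using ubound[of k] by (simp add: ennreal_leI)
  qed
  also have "\<dots> = ennreal (R + 1)"
    using tendsto_ennrealI[OF tendsto_add[OF tendsto_const[of R] clI]] by (intro lim_imp_Liminf) auto
  finally have fin: "(\<integral>\<^sup>+x. ennreal (p x * ln (p x) + 1) \<partial>LT) \<le> ennreal (R + 1)" .
  have nn: "AE x in LT. 0 \<le> p x * ln (p x) + 1"
    using d(2)
  proof eventually_elim
    case (elim x)
    then show ?case using xlnx_ge[of "p x"] by linarith
  qed
  have i1: "integrable LT (\<lambda>x. p x * ln (p x) + 1)"
    by (rule integrableI_nonneg) (use nn fin in \<open>auto intro: order.strict_trans1 ennreal_less_top\<close>)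
  then have "integrable LT (\<lambda>x. (p x * ln (p x) + 1) - 1)" by (intro Bochner_Integration.integrable_diff) auto
  then show i: "finite_ent p" by simp
  \<comment> \<open>\<open>ennreal\<close> sends negative numbers to 0, so comparing back in the
    reals requires this sign.\<close>
  have R1: "0 \<le> R + 1"
  proof -
    have "0 \<le> R + (\<integral>x. cl k x \<partial>LT)" for k
    proof -
      have "0 \<le> (\<integral>x. u k x + 1 \<partial>LT)"
        using uge[of k] by (intro integral_nonneg_AE) (auto elim!: eventually_mono)
      also have "\<dots> = (\<integral>x. u k x \<partial>LT) + 1" using ui[of k] by simp
      finally show ?thesis using ubound[of k] by linarith
    qed
    then show ?thesis using LIMSEQ_le_const[OF tendsto_add[OF tendsto_const[of R] clI], of 0] by auto
  qed
  have "ennreal (\<integral>x. p x * ln (p x) + 1 \<partial>LT) \<le> ennreal (R + 1)"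
    using fin nn_integral_eq_integral[OF i1 nn] by simp
  then have "(\<integral>x. p x * ln (p x) + 1 \<partial>LT) \<le> R + 1" using R1 by (simp add: ennreal_le_iff)
  then show "Ent p \<le> R" using i by (simp add: Ent_def)
qed

text \<open>The dual inequalities are used twice: in the limit they give a density by absolute
  continuity, and read backwards they bound its entropy. The bounds \<open>R i\<close> may vary, so
  that lower semicontinuity of the entropy comes with compactness.\<close>

theorem entropy_sublevel_compact:
  assumes q: "\<And>i. is_density (q i)" and ent: "\<And>i. finite_ent (q i)"
    and R: "\<And>i. Ent (q i) \<le> R i" "R \<longlonglongrightarrow> R0"
  obtains r p where "strict_mono r" "is_density p" "finite_ent p" "Ent p \<le> R0"
    "weak_conv_T (\<lambda>i. dmeas (q (r i))) (dmeas p)"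
proof -
  define \<mu> where "\<mu> i = bmeas (q i)" for i
  obtain r M where r: "strict_mono r" and M: "real_distribution M" and conv: "weak_conv_m (\<mu> \<circ> id \<circ> r) M"
    using tight_imp_convergent_subsubsequence[of \<mu> id] tight_bmeas[of q, OF q] unfolding \<mu>_def
    by (auto simp: strict_mono_def)
  interpret M: real_distribution M by fact
  have lim: "(\<lambda>i. \<integral>x. q (r i) x * f x \<partial>LT) \<longlonglongrightarrow> (\<integral>x. f x \<partial>M)"
    if f: "continuous_on UNIV f" and bd: "\<And>x. \<bar>f x\<bar> \<le> B" for f :: "real \<Rightarrow> real" and B
  proof -
    have "(\<lambda>i. \<integral>x. f x \<partial>((\<mu> \<circ> id \<circ> r) i)) \<longlonglongrightarrow> (\<integral>x. f x \<partial>M)"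
    proof (rule weak_conv_imp_integral_bdd_continuous_conv[OF _ M conv])
      show "real_distribution ((\<mu> \<circ> id \<circ> r) n)" for n by (simp add: \<mu>_def real_distribution_bmeas[OF q])
      show "isCont f x" for x using f by (simp add: continuous_on_eq_continuous_at)
      show "norm (f x) \<le> B" for x using bd by simp
    qed
    then show ?thesis
      using integral_bmeas[OF q borel_measurable_continuous_onI[OF f]] by (simp add: \<mu>_def)
  qed
  have bound: "(\<integral>x. f x \<partial>M) \<le> R0 + (\<integral>x. exp (f x - 1) \<partial>BT)"
    if f: "continuous_on UNIV f" and bd: "\<And>x. \<bar>f x\<bar> \<le> B" for f :: "real \<Rightarrow> real" and B
  proof (rule LIMSEQ_le[OF lim[OF f bd]])
    have fm: "f \<in> borel_measurable borel" using f by (rule borel_measurable_continuous_onI)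
    have R': "(\<lambda>i. R (r i)) \<longlonglongrightarrow> R0" using LIMSEQ_subseq_LIMSEQ[OF R(2) r] by (simp add: comp_def)
    show "(\<lambda>i. R (r i) + (\<integral>x. exp (f x - 1) \<partial>BT)) \<longlonglongrightarrow> R0 + (\<integral>x. exp (f x - 1) \<partial>BT)"
      by (intro tendsto_intros R')
    have "(\<integral>x. exp (f x - 1) \<partial>BT) = (\<integral>x. exp (f x - 1) \<partial>LT)"
      using fm by (intro integral_BT) simp
    moreover have "(\<integral>x. q (r n) x * f x \<partial>LT) \<le> R (r n) + (\<integral>x. exp (f x - 1) \<partial>LT)" for n
      using entropy_dual[OF q ent measurable_LT_borel[OF fm] bd, of "r n"] R(1)[of "r n"] by linarith
    ultimately show "\<exists>N. \<forall>n\<ge>N. (\<integral>x. q (r n) x * f x \<partial>LT) \<le> R (r n) + (\<integral>x. exp (f x - 1) \<partial>BT)"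
      by simp
  qed
  have ac: "absolutely_continuous BT M" by (rule entropy_bound_absolutely_continuous[OF M bound])
  obtain h where h [measurable]: "h \<in> borel_measurable BT" and hM: "density BT h = M"
    using BT.Radon_Nikodym[OF ac] by (auto simp: M.events_eq_borel)
  define p where "p x = enn2real (h x)" for x
  have hb [measurable]: "h \<in> borel_measurable borel" using h by simp
  have pm [measurable]: "p \<in> borel_measurable borel" unfolding p_def by measurable
  have pL: "p \<in> borel_measurable LT" using pm by (rule measurable_LT_borel)
  have p0: "0 \<le> p x" for x by (simp add: p_def)
  have "(\<integral>\<^sup>+x. h x \<partial>BT) = emeasure M UNIV"
    unfolding hM[symmetric] by (subst emeasure_density) auto
  also have "\<dots> = 1" using M.emeasure_space_1 by simp
  finally have "AE x in BT. h x \<noteq> \<infinity>" by (intro nn_integral_PInf_AE) auto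
  then have "AE x in BT. h x = ennreal (p x)" by eventually_elim (simp add: p_def less_top)
  then have Mp: "M = density BT (\<lambda>x. ennreal (p x))"
    unfolding hM[symmetric] by (intro density_cong) auto
  have intM: "(\<integral>x. f x \<partial>M) = (\<integral>x. p x * f x \<partial>LT)" if [measurable]: "f \<in> borel_measurable borel" for f :: "real \<Rightarrow> real"
    unfolding Mp using p0 integral_BT[of "\<lambda>x. p x * f x"] by (subst integral_density) auto
  have "integrable M (\<lambda>x. 1::real)" by simp
  then have "integrable BT p" unfolding Mp using p0 by (subst (asm) integrable_density) auto
  then have "integrable LT p" using integral_BT(2)[OF pm] by simp
  moreover have "(\<integral>x. p x \<partial>LT) = 1" using intM[of "\<lambda>x. 1"] M.prob_space by simp
  ultimately have p: "is_density p" using p0 pL by (simp add: is_density_def)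
  have dual: "(\<integral>x. p x * T x \<partial>LT) \<le> R0 + (\<integral>x. exp (T x - 1) \<partial>LT)"
    if T: "trig_poly T" and bd: "\<And>x. \<bar>T x\<bar> \<le> B" for T B
  proof -
    have Tm [measurable]: "T \<in> borel_measurable borel" by (rule trig_poly_measurable[OF T])
    show ?thesis
      using bound[OF trig_poly_continuous[OF T] bd] intM[OF Tm] integral_BT(1)[of "\<lambda>x. exp (T x - 1)"] by simp
  qed
  have "weak_conv_T (\<lambda>i. dmeas (q (r i))) (dmeas p)"
    unfolding weak_conv_T_def
  proof (intro allI impI, elim conjE)
    fix f :: "real \<Rightarrow> real" assume f: "continuous_on UNIV f" "\<forall>x. f (x + 1) = f x"
    obtain B where B: "\<And>x. \<bar>f x\<bar> \<le> B" using continuous_periodic_bounded[OF f(1)] f(2) by blast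
    have fm: "f \<in> borel_measurable borel" using f(1) by (rule borel_measurable_continuous_onI)
    show "(\<lambda>i. \<integral>x. f x \<partial>dmeas (q (r i))) \<longlonglongrightarrow> (\<integral>x. f x \<partial>dmeas p)"
      using lim[OF f(1) B] by (simp add: integral_dmeas[OF q fm] integral_dmeas[OF p fm] intM[OF fm])
  qed
  moreover have "finite_ent p" "Ent p \<le> R0"
    by (rule entropy_bound_from_dual[OF p]; rule dual; assumption)+
  ultimately show ?thesis using that[OF r p] by blast
qed

subsection \<open>Upper semicontinuity bounds the potential from above\<close>

text \<open>Half a unit mass at each of 0 and \<open>x\<close>. Its energy, the mean of
  \<open>W 0\<close> and \<open>W x\<close>, is finite and exposes a single value of
  \<open>W\<close>; one atom alone would see only \<open>W 0\<close>.\<close>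

definition two_point :: "real \<Rightarrow> real measure" where
  "two_point x = distr (measure_pmf (bernoulli_pmf (1/2))) LT (\<lambda>b. if b then wrap 0 else wrap x)"

lemma two_point_measurable: "(\<lambda>b. if b then wrap 0 else wrap x) \<in> measurable (measure_pmf (bernoulli_pmf (1/2))) LT"
  using wrap_Tor by (auto simp: measurable_def)

lemma two_point_PT: "two_point x \<in> PT"
proof -
  have "prob_space (two_point x)" unfolding two_point_def
    by (intro prob_space.prob_space_distr two_point_measurable measure_pmf.prob_space_axioms)
  then show ?thesis by (simp add: PT_def two_point_def)
qed

lemma nn_integral_two_point:
  assumes "f \<in> borel_measurable LT"
  shows "(\<integral>\<^sup>+y. f y \<partial>two_point x) = (f (wrap 0) + f (wrap x)) * ennreal (1/2)"
  unfolding two_point_def using assms two_point_measurable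
  by (subst nn_integral_distr) (auto simp: distrib_right)

lemma integral_two_point:
  fixes f :: "real \<Rightarrow> real"
  assumes "f \<in> borel_measurable borel" "\<And>x. f (x + 1) = f x"
  shows "(\<integral>y. f y \<partial>two_point x) = (f 0 + f x) / 2"
  unfolding two_point_def using measurable_LT_borel[OF assms(1)] two_point_measurable periodic_wrap[of f, OF assms(2)]
  by (subst integral_distr) (auto simp: field_simps)

lemma weak_conv_two_point:
  assumes "x \<longlonglongrightarrow> l" shows "weak_conv_T (\<lambda>i. two_point (x i)) (two_point l)"
  unfolding weak_conv_T_def
proof (intro allI impI, elim conjE)
  fix f :: "real \<Rightarrow> real" assume f: "continuous_on UNIV f" "\<forall>x. f (x + 1) = f x"
  have fm: "f \<in> borel_measurable borel" using f(1) by (rule borel_measurable_continuous_onI)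
  have "(\<lambda>i. f (x i)) \<longlonglongrightarrow> f l"
    using f(1) assms by (auto intro: continuous_on_tendsto_compose)
  then have "(\<lambda>i. (f 0 + f (x i)) / 2) \<longlonglongrightarrow> (f 0 + f l) / 2" by (intro tendsto_intros) auto
  then show "(\<lambda>i. \<integral>x. f x \<partial>two_point (x i)) \<longlonglongrightarrow> (\<integral>x. f x \<partial>two_point l)"
    unfolding integral_two_point[OF fm f(2)[rule_format]] .
qed

context potential
begin

lemma nn_integral_two_point_diff:
  assumes [measurable]: "g \<in> borel_measurable borel"
  shows "(\<integral>\<^sup>+z. g (W (fst z - snd z)) \<partial>(two_point x \<Otimes>\<^sub>M two_point x)) = (g (W 0) + g (W x)) * ennreal (1/2)"
proof -
  interpret T: prob_space "two_point x" using two_point_PT[of x] by (simp add: PT_def)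
  have sets: "sets (two_point x) = sets LT" by (simp add: two_point_def)
  have m: "(\<lambda>z. g (W (fst z - snd z))) \<in> borel_measurable LL" by measurable
  then have m': "(\<lambda>z. g (W (fst z - snd z))) \<in> borel_measurable (two_point x \<Otimes>\<^sub>M two_point x)"
    by (simp add: measurable_cong_sets[OF sets_pair_measure_cong[OF sets sets] refl])
  have gW: "g (W (wrap a - wrap b)) = g (W (a - b))" for a b
  proof -
    have "wrap a - wrap b = (a - b) + of_int (\<lfloor>b + 1/2\<rfloor> - \<lfloor>a + 1/2\<rfloor>)" by (simp add: wrap_def)
    then show ?thesis using periodic_int[of W "a - b", OF W_periodic] by metis
  qed
  have my: "(\<lambda>y. g (W (c - y))) \<in> borel_measurable LT" for c by (rule measurable_LT_borel) simp
  have mx: "(\<lambda>y. g (W (y - c))) \<in> borel_measurable LT" for c by (rule measurable_LT_borel) simp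
  have inner: "(\<integral>\<^sup>+y. g (W (a - y)) \<partial>two_point x) = (g (W (a - wrap 0)) + g (W (a - wrap x))) * ennreal (1/2)" for a
    by (rule nn_integral_two_point[OF my])
  have "(\<integral>\<^sup>+z. g (W (fst z - snd z)) \<partial>(two_point x \<Otimes>\<^sub>M two_point x))
     = (\<integral>\<^sup>+a. \<integral>\<^sup>+b. g (W (a - b)) \<partial>two_point x \<partial>two_point x)"
    using T.nn_integral_fst[OF m'] by simp
  also have "\<dots> = (\<integral>\<^sup>+a. (g (W (a - wrap 0)) + g (W (a - wrap x))) * ennreal (1/2) \<partial>two_point x)"
    by (simp only: inner)
  also have "\<dots> = ((g (W (wrap 0 - wrap 0)) + g (W (wrap 0 - wrap x))) * ennreal (1/2) +
      (g (W (wrap x - wrap 0)) + g (W (wrap x - wrap x))) * ennreal (1/2)) * ennreal (1/2)"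
    by (rule nn_integral_two_point) (use mx in auto)
  also have "\<dots> = ((g (W 0) + g (W x)) * ennreal (1/2) + (g (W x) + g (W 0)) * ennreal (1/2)) * ennreal (1/2)"
    unfolding gW using W_even[of x] by simp
  also have "\<dots> = (g (W 0) + g (W x)) * (ennreal (1/2) + ennreal (1/2)) * ennreal (1/2)"
    by (simp only: distrib_left add.commute[of "g (W x)"])
  also have "ennreal (1/2) + ennreal (1/2) = 1"
    using ennreal_plus[of "1/2" "1/2"] by simp
  finally show ?thesis by simp
qed

lemma energy_two_point: "energy W (two_point x) = ereal ((W 0 + W x) / 2)"
proof -
  have *: "(ennreal a + ennreal b) * ennreal (1/2) = ennreal ((max 0 a + max 0 b) / 2)" for a b
  proof -
    have "ennreal a = ennreal (max 0 a)" "ennreal b = ennreal (max 0 b)" by (auto simp: max_def ennreal_neg)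
    then have "(ennreal a + ennreal b) * ennreal (1/2) = (ennreal (max 0 a) + ennreal (max 0 b)) * ennreal (1/2)" by simp
    also have "\<dots> = ennreal ((max 0 a + max 0 b) * (1/2))"
      by (subst ennreal_plus[symmetric], simp, simp) (subst ennreal_mult', auto)
    finally show ?thesis by simp
  qed
  have "energy W (two_point x) = enn2ereal (ennreal ((max 0 (W 0) + max 0 (W x)) / 2))
      - enn2ereal (ennreal ((max 0 (- W 0) + max 0 (- W x)) / 2))"
    unfolding energy_def using nn_integral_two_point_diff[of ennreal x] nn_integral_two_point_diff[of "\<lambda>y. ennreal (- y)" x]
    by (simp only: *) simp
  also have "\<dots> = ereal ((max 0 (W 0) + max 0 (W x)) / 2 - (max 0 (- W 0) + max 0 (- W x)) / 2)"
    by (subst (1 2) enn2ereal_ennreal) auto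
  also have "(max 0 (W 0) + max 0 (W x)) / 2 - (max 0 (- W 0) + max 0 (- W x)) / 2 = (W 0 + W x) / 2"
    by (auto simp: max_def field_simps)
  finally show ?thesis .
qed

text \<open>Points where \<open>W\<close> exceeds every integer would accumulate at some
  \<open>l\<close>. The two-point energies would then tend to infinity although their weak limit has
  the finite energy of \<open>two_point l\<close>.\<close>

lemma bounded_above_of_usc:
  assumes usc: "\<And>\<mu>s \<mu>. (\<And>n. \<mu>s n \<in> PT) \<Longrightarrow> \<mu> \<in> PT \<Longrightarrow> weak_conv_T \<mu>s \<mu> \<Longrightarrow>
      limsup (\<lambda>n. energy W (\<mu>s n)) \<le> energy W \<mu>"
  obtains C where "0 \<le> C" "\<And>x. W x \<le> C"
proof -
  have "\<exists>C. \<forall>x. W x \<le> C"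
  proof (rule ccontr)
    assume "\<nexists>C. \<forall>x. W x \<le> C"
    then have "\<forall>n::nat. \<exists>x. real n < W x" by (meson not_le)
    then obtain y where y: "\<And>n. real n < W (y n)" by metis
    define x where "x n = wrap (y n)" for n
    have x: "real n < W (x n)" for n using y[of n] periodic_wrap[of W, OF W_periodic] by (simp add: x_def)
    have "x n \<in> {-1/2..1/2}" for n using wrap_Tor[of "y n"] by (auto simp: x_def Tor_def)
    then obtain l r where r: "strict_mono r" "(x \<circ> r) \<longlonglongrightarrow> l"
      using compact_Icc[of "-1/2" "1/2::real"] unfolding compact_def by blast
    have "weak_conv_T (\<lambda>i. two_point (x (r i))) (two_point l)"
      using r(2) by (intro weak_conv_two_point) (simp add: comp_def)
    then have le: "limsup (\<lambda>i. energy W (two_point (x (r i)))) \<le> energy W (two_point l)"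
      by (intro usc two_point_PT)
    have "filterlim (\<lambda>i. (W 0 + W (x (r i))) / 2) at_top sequentially"
    proof (rule filterlim_at_top_mono)
      have "filterlim (\<lambda>i::nat. W 0 / 2 + (1/2) * real i) at_top sequentially"
        by (intro filterlim_tendsto_add_at_top[OF tendsto_const] filterlim_tendsto_pos_mult_at_top[OF tendsto_const] filterlim_real_sequentially) auto
      then show "filterlim (\<lambda>i::nat. (W 0 + real i) / 2) at_top sequentially"
        by (simp add: add_divide_distrib)
      have "real i \<le> W (x (r i))" for i
        using x[of "r i"] seq_suble[OF r(1), of i] by (meson less_imp_le of_nat_le_iff order_trans)
      then show "\<forall>\<^sub>F i in sequentially. (W 0 + real i) / 2 \<le> (W 0 + W (x (r i))) / 2"
        by (intro always_eventually allI) (simp add: divide_right_mono)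
    qed
    then have "(\<lambda>i. energy W (two_point (x (r i)))) \<longlonglongrightarrow> \<infinity>"
      unfolding energy_two_point by (simp add: tendsto_PInfty_eq_at_top)
    then have "limsup (\<lambda>i. energy W (two_point (x (r i)))) = \<infinity>" by (intro lim_imp_Limsup) auto
    then show False using le by (simp add: energy_two_point)
  qed
  then obtain C where "\<And>x. W x \<le> C" by blast
  then have "W x \<le> max 0 C" for x by (meson max.coboundedI2)
  then show ?thesis using that[of "max 0 C"] by simp
qed

text \<open>Translation by 1 / m multiplies the coefficient at \<open>k\<close> by an m-th root of
  unity, which differs from 1 unless \<open>m\<close> divides \<open>k\<close>.\<close>

lemma What_not_dvd_of_periodic:
  assumes m: "m > 0" and per: "\<And>x. W (x + 1 / real m) = W x" and k: "\<not> m dvd k"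
  shows "What W k = 0"
proof -
  define I where "I = (\<integral>x. cplx (W x) * ech (int k) x \<partial>LT)"
  have "I = (\<integral>x. cplx (W (1 * x + 1 / real m)) * ech (int k) (1 * x + 1 / real m) \<partial>LT)"
    unfolding I_def by (rule integral_affine_LT[symmetric]) (auto simp: W_periodic ech_periodic)
  also have "\<dots> = (\<integral>x. ech (int k) (1 / real m) * (cplx (W x) * ech (int k) x) \<partial>LT)"
    using per by (simp add: ech_add mult_ac)
  also have "\<dots> = ech (int k) (1 / real m) * I" by (simp add: I_def)
  finally have "(1 - ech (int k) (1 / real m)) * I = 0" by (simp add: algebra_simps)
  moreover have "ech (int k) (1 / real m) \<noteq> 1"
  proof
    assume "ech (int k) (1 / real m) = 1"
    then have "Re (ech (int k) (1 / real m)) = 1" by simp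
    then have "cos (2 * pi * (real k / real m)) = 1" by (simp add: ech_def)
    then obtain n :: int where "2 * pi * (real k / real m) = of_int n * 2 * pi"
      unfolding cos_one_2pi_int by blast
    then have "pi * (2 * (real k / real m)) = pi * (2 * of_int n)" by (simp add: mult_ac)
    then have "real k / real m = of_int n" using pi_neq_zero unfolding mult_cancel_left by simp
    then have "real k = real m * of_int n" using m by (simp add: field_simps)
    then have "of_int (int k) = (of_int (int m * n) :: real)" by simp
    then have "int k = int m * n" by (simp only: of_int_eq_iff)
    then have "int m dvd int k" by simp
    then show False using k by simp
  qed
  ultimately have "I = 0" by simp
  then show ?thesis using integral_W_ech[of "int k"] by (simp add: I_def)
qed

end

subsection \<open>The phase transition\<close>

text \<open>The difference of the two sides has derivative x^3 / (1 + x), which has the sign of x,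
  so its minimum is at 0.\<close>

lemma ln_one_plus_le_cubic:
  fixes y :: real
  assumes "-1 < y" shows "ln (1 + y) \<le> y - y\<^sup>2 / 2 + y ^ 3 / 3"
proof -
  define g where "g y = y - y\<^sup>2 / 2 + y ^ 3 / 3 - ln (1 + y)" for y :: real
  have g': "(g has_real_derivative x ^ 3 / (1 + x)) (at x)" if "-1 < x" for x
  proof -
    have "(g has_real_derivative (1 - x + x\<^sup>2 - 1 / (1 + x))) (at x)"
      unfolding g_def using that by (auto intro!: derivative_eq_intros simp: power2_eq_square)
    moreover have "1 - x + x\<^sup>2 - 1 / (1 + x) = x ^ 3 / (1 + x)"
      using that by (simp add: field_simps power2_eq_square power3_eq_cube)
    ultimately show ?thesis by simp
  qed
  have "g 0 \<le> g y"
  proof (cases "0 \<le> y")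
    case True
    show ?thesis
    proof (rule DERIV_nonneg_imp_nondecreasing[OF True])
      fix x assume "0 \<le> x" "x \<le> y"
      then show "\<exists>d. (g has_real_derivative d) (at x) \<and> 0 \<le> d"
        using g'[of x] by (intro exI[of _ "x ^ 3 / (1 + x)"]) auto
    qed
  next
    case False
    show ?thesis
    proof (rule DERIV_nonpos_imp_nonincreasing[of y 0])
      fix x assume "y \<le> x" "x \<le> 0"
      then show "\<exists>d. (g has_real_derivative d) (at x) \<and> d \<le> 0"
        using g'[of x] assms
        by (intro exI[of _ "x ^ 3 / (1 + x)"]) (auto intro!: divide_nonpos_nonneg simp: power3_eq_cube mult_nonneg_nonpos mult_nonpos_nonpos)
    qed (use False in simp)
  qed
  then show ?thesis by (simp add: g_def)
qed

text \<open>Second-order expansion at the uniform density. The remainder y^4 / 3 - y^3 / 6 is at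
  most (1/3 + 1/6) |y|^3 for |y| \<le> 1.\<close>

lemma xlnx_one_plus_le:
  fixes y \<epsilon> :: real
  assumes y: "\<bar>y\<bar> \<le> \<epsilon>" and e: "\<epsilon> < 1"
  shows "(1 + y) * ln (1 + y) \<le> y + y\<^sup>2 / 2 + \<epsilon> ^ 3 / 2"
proof -
  have y1: "-1 < y" "\<bar>y\<bar> \<le> 1" using y e by linarith+
  have "(1 + y) * ln (1 + y) \<le> (1 + y) * (y - y\<^sup>2 / 2 + y ^ 3 / 3)"
    using ln_one_plus_le_cubic[OF y1(1)] y1 by (intro mult_left_mono) auto
  also have "\<dots> = y + y\<^sup>2 / 2 + (y ^ 4 / 3 - y ^ 3 / 6)"
    by (simp add: field_simps power2_eq_square power3_eq_cube power4_eq_xxxx)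
  also have "y ^ 4 / 3 - y ^ 3 / 6 \<le> \<bar>y\<bar> ^ 3 / 2"
  proof -
    have "y ^ 4 = \<bar>y\<bar> * \<bar>y\<bar> ^ 3" by (simp add: power_Suc[symmetric] del: power_Suc)
    also have "\<dots> \<le> 1 * \<bar>y\<bar> ^ 3" using y1 by (intro mult_right_mono) auto
    finally have "y ^ 4 \<le> \<bar>y\<bar> ^ 3" by simp
    moreover have "- (y ^ 3) \<le> \<bar>y\<bar> ^ 3" by (metis abs_ge_minus_self power_abs)
    ultimately show ?thesis by simp
  qed
  also have "\<bar>y\<bar> ^ 3 \<le> \<epsilon> ^ 3" using y by (intro power_mono) auto
  finally show ?thesis by simp
qed

lemma mult_le_of_le_one:
  fixes a b c :: real
  assumes "0 \<le> a" "a \<le> 1" "b \<le> c" "0 \<le> c"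
  shows "a * b \<le> c"
  using mult_left_mono[of b c a] mult_left_le_one_le[of c a] assms by linarith

lemma is_density_unif: "is_density unif"
  by (simp add: is_density_def unif_def)

locale usc_potential = crit_potential +
  assumes usc: "\<And>\<mu>s \<mu>. (\<And>n. \<mu>s n \<in> PT) \<Longrightarrow> \<mu> \<in> PT \<Longrightarrow> weak_conv_T \<mu>s \<mu> \<Longrightarrow>
      limsup (\<lambda>n. energy W (\<mu>s n)) \<le> energy W \<mu>"
    and What_m: "2 * What W m = 1"
begin

text \<open>The densities for which \<open>Ent\<close> and \<open>bil\<close> carry no default
  values, so that the free energy is a real number.\<close>

definition admissible :: "(real \<Rightarrow> real) \<Rightarrow> bool" where
  "admissible q \<longleftrightarrow> is_density q \<and> finite_ent q \<and>
     integrable LL (ker W q q)"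

lemma free_energy_admissible:
  assumes "admissible q" shows "free_energy W K q = ereal (Ent q - K * bil W q q)"
proof -
  have q: "is_density q" using assms by (simp add: admissible_def)
  have "entropy q = ereal (Ent q)" using assms entropy_eq_Ent by (simp add: admissible_def)
  moreover have "energy W (dmeas q) = ereal (bil W q q)"
    by (rule energy_cases[OF q]) (use assms in \<open>auto simp: admissible_def\<close>)
  ultimately show ?thesis by (simp add: free_energy_def)
qed

lemma admissible_bil_le: "admissible q \<Longrightarrow> bil W q q \<le> C"
  using energy_cases[of q] by (auto simp: admissible_def)

text \<open>The third case covers energy minus infinity at \<open>K = 0\<close>: the product 0 times
  infinity is 0 in \<open>ereal\<close>, so the entropy remains.\<close>

lemma free_energy_cases:
  assumes q: "is_density q" and K: "0 \<le> K"
  obtains "admissible q" | "free_energy W K q = \<infinity>" | "K = 0" "finite_ent q" "free_energy W K q = ereal (Ent q)"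
proof (cases rule: entropy_cases[OF q])
  case 1
  have "energy W (dmeas q) \<noteq> \<infinity>" by (rule energy_cases[OF q]) auto
  then have "ereal K * energy W (dmeas q) \<noteq> \<infinity>" using K by (cases "energy W (dmeas q)") auto
  then show ?thesis using that(2) 1 by (simp add: free_energy_def ereal_minus_eq_PInfty_iff)
next
  case 2
  show ?thesis
  proof (cases rule: energy_cases[OF q])
    case a: 1
    show ?thesis
    proof (cases "K = 0")
      case True
      then show ?thesis using that(3) 2 by (simp add: free_energy_def zero_ereal_def[symmetric])
    next
      case False
      then have "free_energy W K q = \<infinity>" using K 2 a by (simp add: free_energy_def)
      then show ?thesis by (rule that(2))
    qed
  next
    case b: 2
    then show ?thesis using that(1) 2 q by (simp add: admissible_def)
  qed
qed

lemma bil_le_Ent: "admissible q \<Longrightarrow> bil W q q \<le> Ent q"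
  using energy_entropy(1) by (simp add: admissible_def)

text \<open>For positive energy, K \<le> 1 and zero free energy force equality in
  \<open>energy_entropy\<close>. For nonpositive energy the entropy itself must be 0.\<close>

lemma free_energy_nonneg:
  assumes q: "is_density q" and K: "0 \<le> K" "K \<le> 1"
  shows "0 \<le> free_energy W K q" "free_energy W K q \<le> 0 \<Longrightarrow> AE x in LT. q x = 1"
proof -
  have *: "0 \<le> free_energy W K q \<and> (free_energy W K q \<le> 0 \<longrightarrow> (AE x in LT. q x = 1))"
  proof (cases rule: free_energy_cases[OF q K(1)])
    case 1
    then have ient: "finite_ent q" by (simp add: admissible_def)
    have E0: "0 \<le> Ent q" by (rule Ent_nonneg[OF q ient])
    have le: "K * bil W q q \<le> Ent q"
      using mult_le_of_le_one[OF K] bil_le_Ent[OF 1] E0 by blast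
    moreover have "AE x in LT. q x = 1" if le0: "Ent q - K * bil W q q \<le> 0"
    proof (cases "0 < bil W q q")
      case True
      then have "K * bil W q q \<le> 1 * bil W q q" using K by (intro mult_right_mono) auto
      then have "bil W q q = Ent q" using le0 bil_le_Ent[OF 1] by linarith
      then show ?thesis using energy_entropy(2) 1 by (simp add: admissible_def)
    next
      case False
      then have "K * bil W q q \<le> 0" using K by (intro mult_nonneg_nonpos) auto
      then have "Ent q \<le> 0" using le0 by linarith
      then show ?thesis by (rule Ent_zero_imp_AE_one[OF q ient])
    qed
    ultimately show ?thesis by (auto simp: free_energy_admissible[OF 1])
  next
    case 3
    then show ?thesis using Ent_nonneg[OF q 3(2)] Ent_zero_imp_AE_one[OF q 3(2)] by auto
  qed auto
  show "0 \<le> free_energy W K q" "free_energy W K q \<le> 0 \<Longrightarrow> AE x in LT. q x = 1"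
    using * by auto
qed

lemma bil_unif: "bil W unif unif = 0" "admissible unif"
proof -
  have i: "integrable LL (ker W unif unif)"
    using integrable_W_fst[of "\<lambda>x. 1"] by (simp add: unif_def)
  have "fc unif j = 0" if "1 \<le> j" for j
    using that m_pos by (simp add: fc_def fourier_ech unif_def integral_ech)
  then show "bil W unif unif = 0" by (intro bil_zero[OF is_density_unif _ i]) (auto simp: unif_def)
  show "admissible unif" using i is_density_unif by (simp add: admissible_def unif_def)
qed

lemma AE_one:
  assumes q: "is_density q" and 1: "AE x in LT. q x = 1"
  shows "bil W q q = 0" "Ent q = 0" "admissible q"
proof -
  have [measurable]: "q \<in> borel_measurable LT" using densityD[OF q] by simp
  have u: "unif \<in> borel_measurable LT" by (simp add: unif_def)
  have qu: "AE x in LT. q x = unif x" using 1 by (simp add: unif_def)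
  show "bil W q q = 0" using bil_cong_AE(1)[OF W_measurable _ u qu] bil_unif by simp
  have "AE x in LT. q x * ln (q x) = 0" using 1 by eventually_elim simp
  then have "finite_ent q \<longleftrightarrow> integrable LT (\<lambda>x. 0 :: real)" "Ent q = (\<integral>x. 0 \<partial>LT)"
    unfolding Ent_def by (intro integrable_cong_AE integral_cong_AE; simp)+
  then show "Ent q = 0" "admissible q"
    using bil_cong_AE(2)[OF W_measurable _ u qu] bil_unif(2) q by (auto simp: admissible_def)
qed

lemma free_energy_AE_one:
  assumes "is_density q" "AE x in LT. q x = 1" shows "free_energy W K q = 0"
  using free_energy_admissible AE_one[OF assms] by (simp add: zero_ereal_def)

lemma free_energy_unif: "free_energy W K unif = 0"
  by (rule free_energy_AE_one[OF is_density_unif]) (simp add: unif_def)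

lemma unif_unique_min:
  assumes K: "0 \<le> K" "K \<le> 1" shows "unique_global_min_unif W K"
proof -
  have "global_min W K unif"
    using is_density_unif free_energy_nonneg(1)[OF _ K] by (simp add: global_min_def free_energy_unif)
  moreover have "AE x in LT. q x = 1" if "global_min W K q" for q
  proof (rule free_energy_nonneg(2)[OF _ K])
    show "is_density q" using that by (simp add: global_min_def)
    have "free_energy W K q \<le> free_energy W K unif"
      using that is_density_unif unfolding global_min_def by blast
    then show "free_energy W K q \<le> 0" by (simp add: free_energy_unif)
  qed
  ultimately show ?thesis by (simp add: unique_global_min_unif_def)
qed

abbreviation cosk :: "int \<Rightarrow> real \<Rightarrow> real" where
  "cosk k x \<equiv> cos (2 * pi * of_int k * x)"

text \<open>A perturbation along the critical mode \<open>m\<close>: its energy is \<epsilon>^2 / 4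
  and its entropy at most \<epsilon>^2 / 4 + \<epsilon>^3 / 2, so any K > 1 tips the balance for
  small \<epsilon>.\<close>

lemma trial_density:
  assumes K: "1 < K" obtains p where "is_density p" "free_energy W K p < 0"
proof -
  \<comment> \<open>The bound 1/2 keeps \<open>p\<close> positive, and (K - 1) / 4 makes 1 - K + 2
    \<epsilon> negative.\<close>
  define \<epsilon> where "\<epsilon> = min (1/2) ((K - 1) / 4)"
  have e: "0 < \<epsilon>" using K by (simp add: \<epsilon>_def)
  have e': "\<epsilon> < 1" "\<epsilon> \<le> (K - 1) / 4" unfolding \<epsilon>_def by linarith+
  define p where "p x = 1 + \<epsilon> * cosk (int m) x" for x
  have tp: "trig_poly p" unfolding p_def[abs_def]
    by (intro trig_poly_add trig_poly_mult trig_poly_const trig_poly_cos)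
  have cosb: "\<bar>\<epsilon> * cosk (int m) x\<bar> \<le> \<epsilon>" for x
    using e abs_cos_le_one[of "2 * pi * of_int (int m) * x"] by (simp add: abs_mult mult_le_cancel_left2)
  have p01: "0 \<le> p x" "p x \<le> 2" for x using cosb[of x] e e' unfolding p_def by linarith+
  have pm: "p \<in> borel_measurable LT" by (rule measurable_LT_borel[OF trig_poly_measurable[OF tp]])
  have pe: "cplx (p x) = 1 + \<epsilon>/2 * ech (int m) x + \<epsilon>/2 * ech (- int m) x" for x
    by (simp add: p_def ech_def complex_eq_iff)
  have four: "fourier p k = (if k = 0 then 1 else 0) + \<epsilon>/2 * (if k = int m then 1 else 0) + \<epsilon>/2 * (if k = - int m then 1 else 0)" for k
  proof -
    have "fourier p k = (\<integral>x. ech (- k) x + \<epsilon>/2 * ech (int m - k) x + \<epsilon>/2 * ech (- int m - k) x \<partial>LT)"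
      unfolding fourier_ech pe
      by (intro Bochner_Integration.integral_cong) (auto simp: distrib_right mult.assoc ech_mult)
    also have "\<dots> = (\<integral>x. ech (- k) x \<partial>LT) + \<epsilon>/2 * (\<integral>x. ech (int m - k) x \<partial>LT) + \<epsilon>/2 * (\<integral>x. ech (- int m - k) x \<partial>LT)"
      by simp
    finally show ?thesis by (auto simp: integral_ech)
  qed
  have pint: "integrable LT p"
    by (rule LT.integrable_const_bound[where B=2]) (use p01 pm in auto)
  have "cplx (\<integral>x. p x \<partial>LT) = fourier p 0" by (simp add: fourier_ech)
  also have "\<dots> = 1" using m_pos by (simp add: four)
  finally have "(\<integral>x. p x \<partial>LT) = 1" by (simp only: of_real_eq_1_iff)
  then have dens: "is_density p" using p01 pint pm by (simp add: is_density_def)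
  have ient: "finite_ent p" by (rule integrable_xlnx_bounded[OF pm p01])
  have fc: "fc p j = (if j = 1 then \<epsilon> / 2 else 0)" if "1 \<le> j" for j
  proof -
    have "0 < int (m * j)" using that m_pos by simp
    then have "int (m * j) \<noteq> 0" "int (m * j) \<noteq> - int m" by linarith+
    moreover have "int (m * j) = int m \<longleftrightarrow> j = 1" using m_pos by (simp only: of_nat_eq_iff) simp
    ultimately show ?thesis unfolding fc_def four by simp
  qed
  obtain L where L: "bil W p p = (\<Sum>j=1..L. 2 * What W (m*j) * (norm (fc p j))\<^sup>2)" "\<And>j. j > L \<Longrightarrow> fc p j = 0"
    using bil_trig_poly[OF tp] by blast
  have "1 \<le> L" using L(2)[of 1] fc[of 1] e by (cases L) auto
  have "bil W p p = (\<Sum>j\<in>{1}. 2 * What W (m*j) * (norm (fc p j))\<^sup>2)"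
    unfolding L(1) using \<open>1 \<le> L\<close> by (intro sum.mono_neutral_right) (auto simp: fc)
  also have "\<dots> = \<epsilon>\<^sup>2 / 4" using e What_m by (simp add: fc power_divide norm_divide)
  finally have bil: "bil W p p = \<epsilon>\<^sup>2 / 4" .
  have iW: "integrable LL (ker W p p)"
  proof (rule Bochner_Integration.integrable_bound)
    show "integrable LL (\<lambda>z. 4 * \<bar>W (fst z - snd z) * 1\<bar>)" using integrable_W_fst[of "\<lambda>x. 1"] by simp
    show "AE z in LL. norm (ker W p p z) \<le> norm (4 * \<bar>W (fst z - snd z) * 1\<bar>)"
    proof (rule AE_I2)
      fix z
      have "p (fst z) * p (snd z) \<le> 2 * 2" using p01 by (intro mult_mono) auto
      then have "\<bar>W (fst z - snd z)\<bar> * (p (fst z) * p (snd z)) \<le> \<bar>W (fst z - snd z)\<bar> * (2 * 2)" by (intro mult_left_mono) auto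
      then show "norm (ker W p p z) \<le> norm (4 * \<bar>W (fst z - snd z) * 1\<bar>)"
        using p01 by (simp add: abs_mult mult_ac)
    qed
  qed (use pm in measurable)
  have adm: "admissible p" using dens ient iW by (simp add: admissible_def)
  have Ent: "Ent p \<le> \<epsilon>\<^sup>2 / 4 + \<epsilon> ^ 3 / 2"
  proof -
    have y2: "(\<epsilon> * cosk (int m) x)\<^sup>2 / 2 = \<epsilon>\<^sup>2 / 4 * (1 + cosk (2 * int m) x)" for x
      using cos_double_cos[of "2 * pi * of_int (int m) * x"] by (simp add: power_mult_distrib algebra_simps)
    have cosI: "(\<integral>x. cosk k x \<partial>LT) = 0" "integrable LT (\<lambda>x. cosk k x)" if "k \<noteq> 0" for k :: int
    proof -
      have Re: "cosk k x = Re (ech k x)" for x by (simp add: ech_def)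
      show "integrable LT (\<lambda>x. cosk k x)" unfolding Re by simp
      show "(\<integral>x. cosk k x \<partial>LT) = 0" unfolding Re using that by (simp add: integral_ech)
    qed
    have "Ent p \<le> (\<integral>x. \<epsilon> * cosk (int m) x + \<epsilon>\<^sup>2 / 4 * (1 + cosk (2 * int m) x) + \<epsilon> ^ 3 / 2 \<partial>LT)"
      unfolding Ent_def
    proof (rule integral_mono[OF ient])
      show "integrable LT (\<lambda>x. \<epsilon> * cosk (int m) x + \<epsilon>\<^sup>2 / 4 * (1 + cosk (2 * int m) x) + \<epsilon> ^ 3 / 2)"
        using cosI(2)[of "int m"] cosI(2)[of "2 * int m"] m_pos
        by (intro Bochner_Integration.integrable_add integrable_mult_right) auto
      show "p x * ln (p x) \<le> \<epsilon> * cosk (int m) x + \<epsilon>\<^sup>2 / 4 * (1 + cosk (2 * int m) x) + \<epsilon> ^ 3 / 2" for x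
        unfolding y2[symmetric] p_def by (rule xlnx_one_plus_le[OF cosb e'(1)])
    qed
    also have "\<dots> = \<epsilon>\<^sup>2 / 4 + \<epsilon> ^ 3 / 2"
    proof -
      define a where "a x = cosk (int m) x" for x
      define b where "b x = cosk (2 * int m) x" for x
      have "integrable LT a" "(\<integral>x. a x \<partial>LT) = 0"
        using cosI[of "int m"] m_pos by (simp_all add: a_def[abs_def])
      moreover have "integrable LT b" "(\<integral>x. b x \<partial>LT) = 0"
        using cosI[of "2 * int m"] m_pos by (simp_all add: b_def[abs_def])
      ultimately have "(\<integral>x. \<epsilon> * a x + \<epsilon>\<^sup>2 / 4 * (1 + b x) + \<epsilon> ^ 3 / 2 \<partial>LT) = \<epsilon>\<^sup>2 / 4 + \<epsilon> ^ 3 / 2"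
        by simp
      then show ?thesis by (simp only: a_def b_def)
    qed
    finally show ?thesis .
  qed
  have "Ent p - K * bil W p p \<le> \<epsilon>\<^sup>2 / 4 * (1 - K + 2 * \<epsilon>)"
    using Ent unfolding bil by (simp add: algebra_simps power2_eq_square power3_eq_cube)
  also have "\<dots> < 0"
    using e e' K by (intro mult_pos_neg) auto
  finally show ?thesis using that dens free_energy_admissible[OF adm] by simp
qed

text \<open>Shared by the existence of minimizers and the limit K to 1. A first extraction makes the
  entropies converge, so that the second yields a weak limit whose entropy is at most theirs in the
  limit.\<close>

lemma compact_usc:
  assumes q: "\<And>i. admissible (q i)" and bd: "\<And>i. Ent (q i) \<le> A"
  obtains r p R0 where "strict_mono (r :: nat \<Rightarrow> nat)" "is_density p" "finite_ent p" "Ent p \<le> R0"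
    "(\<lambda>i. Ent (q (r i))) \<longlonglongrightarrow> R0"
    "limsup (\<lambda>i. ereal (bil W (q (r i)) (q (r i)))) \<le> energy W (dmeas p)"
proof -
  have qd: "is_density (q i)" and qe: "finite_ent (q i)" for i
    using q[of i] by (auto simp: admissible_def)
  define E where "E i = Ent (q i)" for i
  have "E i \<in> {0..A}" for i using bd Ent_nonneg[OF qd qe] by (auto simp: E_def)
  then obtain R0 s where s: "strict_mono s" "(E \<circ> s) \<longlonglongrightarrow> R0"
    using compact_Icc[of 0 A] unfolding compact_def by blast
  obtain r p where r: "strict_mono r" and p: "is_density p" "finite_ent p" "Ent p \<le> R0"
    and wc: "weak_conv_T (\<lambda>i. dmeas (q (s (r i)))) (dmeas p)"
    using entropy_sublevel_compact[of "\<lambda>i. q (s i)" "\<lambda>i. Ent (q (s i))" R0] qd qe s(2)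
    by (auto simp: comp_def E_def)
  have sr: "strict_mono (s \<circ> r)" using s(1) r by (rule strict_mono_o)
  have "limsup (\<lambda>i. energy W (dmeas (q (s (r i))))) \<le> energy W (dmeas p)"
    by (rule usc[OF dmeas_PT[OF qd] dmeas_PT[OF p(1)] wc])
  moreover have "energy W (dmeas (q i)) = ereal (bil W (q i) (q i))" for i
    by (rule energy_cases[OF qd[of i]]) (use q[of i] in \<open>auto simp: admissible_def\<close>)
  moreover have "(\<lambda>i. Ent (q (s (r i)))) \<longlonglongrightarrow> R0"
    using LIMSEQ_subseq_LIMSEQ[OF s(2) r] by (simp add: comp_def E_def)
  ultimately show ?thesis using that[OF sr p] by (simp add: comp_def)
qed

text \<open>The direct method. Nonnegative entropy and energy at most \<open>C\<close> bound the
  free energy below and the entropy along a minimizing sequence above.\<close>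

lemma ex_global_min:
  assumes K: "0 < K" obtains q where "global_min W K q"
proof -
  let ?F = "\<lambda>q. Ent q - K * bil W q q"
  define S where "S = {?F q | q. admissible q}"
  have Sne: "S \<noteq> {}" using bil_unif(2) by (auto simp: S_def)
  have low: "- (K * C) \<le> x" if xS: "x \<in> S" for x
  proof -
    obtain q where q: "admissible q" "x = ?F q" using xS by (auto simp: S_def)
    have "0 \<le> Ent q" using Ent_nonneg q(1) by (simp add: admissible_def)
    moreover have "K * bil W q q \<le> K * C" using admissible_bil_le[OF q(1)] K by simp
    ultimately show ?thesis using q(2) by linarith
  qed
  then have bb: "bdd_below S" by (rule bdd_belowI)
  define I where "I = Inf S"
  have "\<exists>q. admissible q \<and> ?F q < I + 1 / real (Suc i)" for i
    using cInf_lessD[OF Sne, of "I + 1 / real (Suc i)"] by (auto simp: I_def S_def)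
  then obtain q where q: "\<And>i. admissible (q i)" "\<And>i. ?F (q i) < I + 1 / real (Suc i)"
    by metis
  have Ile: "I \<le> ?F q'" if "admissible q'" for q'
    unfolding I_def using that bb by (intro cInf_lower) (auto simp: S_def)
  have "Ent (q i) \<le> I + 1 + K * C" for i
  proof -
    have "1 / real (Suc i) \<le> 1" by simp
    moreover have "K * bil W (q i) (q i) \<le> K * C" using admissible_bil_le[OF q(1)] K by simp
    ultimately show ?thesis using q(2)[of i] by linarith
  qed
  then obtain r p R0 where r: "strict_mono (r :: nat \<Rightarrow> nat)" and p: "is_density p" "finite_ent p" "Ent p \<le> R0"
    and R0: "(\<lambda>i. Ent (q (r i))) \<longlonglongrightarrow> R0"
    and ls: "limsup (\<lambda>i. ereal (bil W (q (r i)) (q (r i)))) \<le> energy W (dmeas p)"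
    using compact_usc[of q, OF q(1)] by blast
  have F: "(\<lambda>i. ?F (q (r i))) \<longlonglongrightarrow> I"
  proof (rule tendsto_sandwich)
    show "\<forall>\<^sub>F i in sequentially. I \<le> ?F (q (r i))"
      using Ile q(1) by (intro always_eventually allI) blast
    show "\<forall>\<^sub>F i in sequentially. ?F (q (r i)) \<le> I + 1 / real (Suc i)"
    proof (intro always_eventually allI)
      fix i
      have "1 / real (Suc (r i)) \<le> 1 / real (Suc i)"
        using seq_suble[OF r, of i] by (intro divide_left_mono) auto
      then show "?F (q (r i)) \<le> I + 1 / real (Suc i)"
        using q(2)[of "r i"] by linarith
    qed
    have "(\<lambda>i. I + 1 / real (Suc i)) \<longlonglongrightarrow> I + 0"
      by (intro tendsto_add tendsto_const lim_1_over_n[THEN LIMSEQ_Suc])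
    then show "(\<lambda>i. I + 1 / real (Suc i)) \<longlonglongrightarrow> I" by simp
  qed simp
  \<comment> \<open>Entropies and free energies converge and K > 0, so the energies converge too.
    Upper semicontinuity then bounds the energy of \<open>p\<close> below by a real number, which
    also makes \<open>p\<close> admissible.\<close>
  have "(\<lambda>i. (Ent (q (r i)) - (?F (q (r i)))) / K) \<longlonglongrightarrow> (R0 - I) / K"
    using K by (intro tendsto_intros R0 F) auto
  then have "(\<lambda>i. ereal (bil W (q (r i)) (q (r i)))) \<longlonglongrightarrow> ereal ((R0 - I) / K)" using K by simp
  then have "limsup (\<lambda>i. ereal (bil W (q (r i)) (q (r i)))) = ereal ((R0 - I) / K)"
    by (intro lim_imp_Limsup) auto
  then have en: "ereal ((R0 - I) / K) \<le> energy W (dmeas p)" using ls by simp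
  have adm: "admissible p" and bl: "(R0 - I) / K \<le> bil W p p"
    using en p by (cases rule: energy_cases[OF p(1)]; auto simp: admissible_def)+
  have "R0 - I \<le> K * bil W p p" using bl K by (simp add: pos_divide_le_eq mult.commute)
  then have FI: "?F p \<le> I" using p(3) by linarith
  have "free_energy W K p \<le> free_energy W K p'" if p': "is_density p'" for p'
  proof (cases rule: free_energy_cases[OF p' less_imp_le[OF K]])
    case 1
    then show ?thesis using FI Ile[OF 1] by (simp add: free_energy_admissible[OF adm] free_energy_admissible[OF 1])
  qed (use K in auto)
  then have "global_min W K p" using p(1) unfolding global_min_def by blast
  then show ?thesis by (rule that)
qed

lemma phase_transition_1: "phase_transition_at W 1"
  unfolding phase_transition_at_def
proof (intro conjI allI impI)
  show "global_min W 1 unif" using unif_unique_min[of 1] by (simp add: unique_global_min_unif_def)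
  show "\<exists>q. global_min W K q \<and> \<not> (AE x in LT. q x = 1)" if K: "1 < K" for K
  proof -
    obtain q where q: "global_min W K q" using ex_global_min[of K] K by auto
    obtain p where p: "is_density p" "free_energy W K p < 0" using trial_density[OF K] by blast
    have "free_energy W K q < 0" using q p by (auto simp: global_min_def intro: order.strict_trans1)
    then have "\<not> (AE x in LT. q x = 1)" using free_energy_AE_one[of q K] q by (auto simp: global_min_def)
    then show ?thesis using q by blast
  qed
qed (auto intro: unif_unique_min)

text \<open>Weak convergence alone would not give L1 convergence. What does is that the entropies of
  the minimizers tend to 0, through \<open>Ent_L1\<close>.\<close>

lemma minimizers_tendsto_unif:
  assumes qf: "\<And>K. 1 < K \<Longrightarrow> global_min W K (qf K)"
  shows "((\<lambda>K. \<integral>x. \<bar>qf K x - 1\<bar> \<partial>LT) \<longlongrightarrow> 0) (at_right 1)"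
proof (rule tendstoI, rule ccontr)
  fix e :: real assume e: "0 < e"
  assume "\<not> (\<forall>\<^sub>F K in at_right 1. dist (\<integral>x. \<bar>qf K x - 1\<bar> \<partial>LT) 0 < e)"
  then have "\<exists>K. 1 < K \<and> K < 1 + 1 / real (Suc i) \<and> e \<le> (\<integral>x. \<bar>qf K x - 1\<bar> \<partial>LT)" for i
    unfolding eventually_at_right_field
  proof -
    assume "\<nexists>b. 1 < b \<and> (\<forall>y>1. y < b \<longrightarrow> dist (\<integral>x. \<bar>qf y x - 1\<bar> \<partial>LT) 0 < e)"
    moreover have "1 < 1 + 1 / real (Suc i)" by simp
    ultimately obtain K where K: "1 < K" "K < 1 + 1 / real (Suc i)" "\<not> dist (\<integral>x. \<bar>qf K x - 1\<bar> \<partial>LT) 0 < e" by blast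
    have "0 \<le> (\<integral>x. \<bar>qf K x - 1\<bar> \<partial>LT)" by (rule Bochner_Integration.integral_nonneg) simp
    then have "e \<le> (\<integral>x. \<bar>qf K x - 1\<bar> \<partial>LT)" using K(3) unfolding dist_real_def by linarith
    then show ?thesis using K by blast
  qed
  then obtain k where k: "\<And>i. 1 < k i" "\<And>i. k i < 1 + 1 / real (Suc i)" "\<And>i. e \<le> (\<integral>x. \<bar>qf (k i) x - 1\<bar> \<partial>LT)"
    by metis
  define q where "q i = qf (k i)" for i
  have dens: "is_density (q i)" for i using qf[OF k(1)[of i]] by (simp add: q_def global_min_def)
  have le0: "free_energy W (k i) (q i) \<le> 0" for i
    using qf[OF k(1)[of i]] is_density_unif free_energy_unif[of "k i"] unfolding q_def global_min_def by metis
  have kp: "0 \<le> k i" for i using k(1)[of i] by simp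
  have adm: "admissible (q i)" for i
    by (rule free_energy_cases[OF dens[of i] kp[of i]]) (use le0[of i] k(1)[of i] in auto)
  have ek: "Ent (q i) \<le> k i * bil W (q i) (q i)" for i
    using le0[of i] by (simp add: free_energy_admissible[OF adm])
  have "Ent (q i) \<le> 2 * C" for i
  proof -
    have "1 / real (Suc i) \<le> 1" by simp
    then have "k i \<le> 2" using k(2)[of i] by linarith
    then have "k i * C \<le> 2 * C" using C_nonneg by (rule mult_right_mono)
    moreover have "k i * bil W (q i) (q i) \<le> k i * C" using admissible_bil_le[OF adm] kp by (intro mult_left_mono) auto
    ultimately show ?thesis using ek[of i] by linarith
  qed
  then obtain r p R0 where r: "strict_mono (r :: nat \<Rightarrow> nat)" and p: "is_density p" "finite_ent p" "Ent p \<le> R0"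
    and R0: "(\<lambda>i. Ent (q (r i))) \<longlonglongrightarrow> R0"
    and ls: "limsup (\<lambda>i. ereal (bil W (q (r i)) (q (r i)))) \<le> energy W (dmeas p)"
    using compact_usc[of q, OF adm] by blast
  have k1: "(\<lambda>i. k i) \<longlonglongrightarrow> 1"
  proof (rule tendsto_sandwich)
    show "\<forall>\<^sub>F i in sequentially. 1 \<le> k i" using k(1) by (intro always_eventually allI less_imp_le)
    show "\<forall>\<^sub>F i in sequentially. k i \<le> 1 + 1 / real (Suc i)" using k(2) by (intro always_eventually allI less_imp_le)
    have "(\<lambda>i. 1 + 1 / real (Suc i)) \<longlonglongrightarrow> 1 + (0::real)"
      by (intro tendsto_add tendsto_const lim_1_over_n[THEN LIMSEQ_Suc])
    then show "(\<lambda>i. 1 + 1 / real (Suc i)) \<longlonglongrightarrow> (1::real)" by simp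
  qed simp
  have "(\<lambda>i. k (r i)) \<longlonglongrightarrow> 1" using LIMSEQ_subseq_LIMSEQ[OF k1 r] by (simp add: comp_def)
  then have "(\<lambda>i. Ent (q (r i)) / k (r i)) \<longlonglongrightarrow> R0 / 1" by (intro tendsto_divide R0) auto
  then have "(\<lambda>i. ereal (Ent (q (r i)) / k (r i))) \<longlonglongrightarrow> ereal R0" by simp
  \<comment> \<open>As \<open>k i\<close> tends to 1, the limit entropy \<open>R0\<close> is at most
    the energy of \<open>p\<close>, which is at most \<open>Ent p\<close>, which is at most
    \<open>R0\<close>: the equality case of \<open>energy_entropy\<close>.\<close>
  then have "ereal R0 = limsup (\<lambda>i. ereal (Ent (q (r i)) / k (r i)))"
    by (intro lim_imp_Limsup[symmetric]) auto
  also have "\<dots> \<le> limsup (\<lambda>i. ereal (bil W (q (r i)) (q (r i))))"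
  proof (intro Limsup_mono always_eventually allI)
    fix i
    have "0 < k (r i)" using k(1)[of "r i"] by simp
    then show "ereal (Ent (q (r i)) / k (r i)) \<le> ereal (bil W (q (r i)) (q (r i)))"
      using ek[of "r i"] by (simp add: pos_divide_le_eq mult.commute)
  qed
  also note ls
  finally have en: "ereal R0 \<le> energy W (dmeas p)" .
  have admp: "admissible p" and bl: "R0 \<le> bil W p p"
    using en p by (cases rule: energy_cases[OF p(1)]; auto simp: admissible_def)+
  have "bil W p p = Ent p" using bl p(3) bil_le_Ent[OF admp] by linarith
  then have "AE x in LT. p x = 1" using energy_entropy(2) admp by (simp add: admissible_def)
  then have R00: "R0 \<le> 0" using AE_one(1)[OF p(1)] bl by simp
  \<comment> \<open>At tolerance e / 2 the other half of \<open>e\<close> would have to come from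
    the entropy, whose limit is at most 0.\<close>
  have "e \<le> e / 2 + (1 + 1 / (e / 2)) * Ent (q (r i))" for i
  proof -
    have "e \<le> (\<integral>x. \<bar>q (r i) x - 1\<bar> \<partial>LT)" using k(3)[of "r i"] by (simp add: q_def)
    also have "\<dots> \<le> e / 2 + (1 + 1 / (e / 2)) * Ent (q (r i))"
      by (rule Ent_L1[OF dens]) (use adm[of "r i"] e in \<open>auto simp: admissible_def\<close>)
    finally show ?thesis .
  qed
  moreover have "(\<lambda>i. e / 2 + (1 + 1 / (e / 2)) * Ent (q (r i))) \<longlonglongrightarrow> e / 2 + (1 + 1 / (e / 2)) * R0"
    by (intro tendsto_intros R0)
  ultimately have "e \<le> e / 2 + (1 + 1 / (e / 2)) * R0"
    using LIMSEQ_le_const by blast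
  moreover have "(1 + 1 / (e / 2)) * R0 \<le> 0" using e R00 by (intro mult_nonneg_nonpos) auto
  ultimately show False using e by linarith
qed

section \<open>Critical points\<close>

lemma conv_unif: "conv W unif \<theta> = 0"
proof -
  have "conv W unif \<theta> = (\<integral>y. W (- 1 * y + \<theta>) \<partial>LT)" by (simp add: conv_def unif_def)
  also have "\<dots> = (\<integral>y. W y \<partial>LT)" by (rule integral_affine_LT) (auto simp: W_periodic)
  also have "\<dots> = 0" using integral_W_ech[of 0] What_0 by simp
  finally show ?thesis .
qed

lemma critical_point_unif: "critical_point W K unif"
proof -
  have "integrable LT (\<lambda>y. W (\<theta> - y))" for \<theta>
    using W_affine_integrable[of "-1" \<theta>] by simp
  then show ?thesis
    using is_density_unif unfolding critical_point_def conv_unif by (simp add: unif_def)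
qed

text \<open>The bound on \<open>K\<close> enters as 2 K \<le> 1 and yields ln Z \<le> 0. The
  convolution has mean zero, so the integral of ln q is - ln Z, and the equality case of ln t \<le>
  t - 1 finishes.\<close>

lemma critical_point_unique:
  assumes cp: "critical_point W K q" and K: "0 \<le> K" "K \<le> 1/2"
  shows "AE x in LT. q x = 1"
proof -
  have q: "is_density q" and iconv: "AE \<theta> in LT. integrable LT (\<lambda>y. W (\<theta> - y) * q y)"
    and iexp: "integrable LT (\<lambda>\<theta>. exp (2 * K * conv W q \<theta>))"
    using cp by (auto simp: critical_point_def)
  note d = densityD[OF q]
  have [measurable]: "q \<in> borel_measurable LT" using d by simp
  define Z where "Z = (\<integral>\<theta>. exp (2 * K * conv W q \<theta>) \<partial>LT)"
  have qeq: "AE \<theta> in LT. q \<theta> = exp (2 * K * conv W q \<theta>) / Z"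
    using cp by (auto simp: critical_point_def Z_def)
  have Z0: "0 < Z"
  proof -
    have "0 \<le> Z" unfolding Z_def by (rule Bochner_Integration.integral_nonneg) simp
    \<comment> \<open>Division by 0 gives 0, so Z = 0 would make \<open>q\<close> vanish almost
      everywhere.\<close>
    moreover have "Z \<noteq> 0"
    proof
      assume "Z = 0"
      then have "AE \<theta> in LT. q \<theta> = 0" using qeq by auto
      then have "(\<integral>x. q x \<partial>LT) = (\<integral>x. 0 \<partial>LT)" by (intro integral_cong_AE) auto
      then show False using d by simp
    qed
    ultimately show ?thesis by simp
  qed
  \<comment> \<open>The upper bound on \<open>W\<close> bounds the exponent, hence \<open>q\<close>,
    so that the energy kernel is integrable as \<open>energy_entropy\<close> demands.\<close>
  have convC: "AE \<theta> in LT. conv W q \<theta> \<le> C"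
    using iconv
  proof eventually_elim
    case (elim \<theta>)
    have "conv W q \<theta> \<le> (\<integral>y. C * q y \<partial>LT)"
      unfolding conv_def
    proof (rule integral_mono_AE[OF elim])
      show "AE y in LT. W (\<theta> - y) * q y \<le> C * q y"
        using d(2) by eventually_elim (intro mult_right_mono W_le)
    qed (use d in simp)
    then show ?case using d by simp
  qed
  define B where "B = exp (2 * K * C) / Z"
  have qB: "AE \<theta> in LT. 0 < q \<theta> \<and> q \<theta> \<le> B"
    using qeq convC
  proof eventually_elim
    case (elim \<theta>)
    have "2 * K * conv W q \<theta> \<le> 2 * K * C" using elim K by (intro mult_left_mono) auto
    then show ?case using elim Z0 by (simp add: B_def divide_right_mono)
  qed
  have iWs: "integrable LL (\<lambda>z. W (fst z - snd z) * q (snd z))" by (rule integrable_W_snd[OF d(3)])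
  have iW: "integrable LL (ker W q q)"
  proof (rule Bochner_Integration.integrable_bound)
    show "integrable LL (\<lambda>z. B * \<bar>W (fst z - snd z) * q (snd z)\<bar>)" using iWs by simp
    show "AE z in LL. norm (ker W q q z) \<le> norm (B * \<bar>W (fst z - snd z) * q (snd z)\<bar>)"
      using AE_fst_LT[OF qB]
    proof eventually_elim
      case (elim z)
      then have "\<bar>q (fst z)\<bar> * \<bar>W (fst z - snd z) * q (snd z)\<bar> \<le> \<bar>B\<bar> * \<bar>W (fst z - snd z) * q (snd z)\<bar>"
        by (intro mult_right_mono) auto
      then show ?case by (simp add: abs_mult mult_ac)
    qed
  qed measurable
  have conv_eq: "conv W q x = (\<integral>y. W (x - y) * q y \<partial>LT)" for x by (simp add: conv_def)
  have cint: "integrable LT (conv W q)"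
    using LT2.integrable_fst'[OF iWs] by (simp add: conv_def[abs_def])
  \<comment> \<open>Pairing with the constant 1 sees only frequency 0, where \<open>W\<close> has
    coefficient 0.\<close>
  have cI: "(\<integral>x. conv W q x \<partial>LT) = 0"
  proof -
    have "(\<integral>x. conv W q x \<partial>LT) = bil W (\<lambda>x. 1) q"
      using LT2.integral_fst'[OF iWs] by (simp add: conv_def bil_def)
    moreover have "cplx (bil W (\<lambda>x. 1) q) = 0"
      by (subst bil_trig[where L=0, OF _ d(3)]) (auto simp: fourier_ech What_0)
    ultimately show ?thesis by simp
  qed
  have cq: "integrable LT (\<lambda>x. q x * conv W q x)" "(\<integral>x. q x * conv W q x \<partial>LT) = bil W q q"
  proof -
    have eq: "(\<integral>y. W (fst (x, y) - snd (x, y)) * q (fst (x, y)) * q (snd (x, y)) \<partial>LT) = q x * conv W q x" for x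
      by (simp add: conv_def mult_ac flip: integral_mult_right_zero)
    show "integrable LT (\<lambda>x. q x * conv W q x)" using LT2.integrable_fst'[OF iW] unfolding eq .
    show "(\<integral>x. q x * conv W q x \<partial>LT) = bil W q q" using LT2.integral_fst'[OF iW] unfolding eq bil_def .
  qed
  have lnq: "AE x in LT. ln (q x) = 2 * K * conv W q x - ln Z"
    using qeq by eventually_elim (use Z0 in \<open>simp add: ln_div\<close>)
  have m_conv [measurable]: "conv W q \<in> borel_measurable LT" using cint by simp
  have AEe: "AE x in LT. q x * ln (q x) = 2 * K * (q x * conv W q x) - ln Z * q x"
    using lnq
  proof eventually_elim
    case (elim x)
    show ?case unfolding elim by (simp add: algebra_simps)
  qed
  have ie: "integrable LT (\<lambda>x. 2 * K * (q x * conv W q x) - ln Z * q x)" using cq d by simp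
  have ient: "finite_ent q"
    using ie AEe by (subst integrable_cong_AE) auto
  have "Ent q = (\<integral>x. 2 * K * (q x * conv W q x) - ln Z * q x \<partial>LT)"
    unfolding Ent_def using AEe by (intro integral_cong_AE) auto
  also have "\<dots> = 2 * K * bil W q q - ln Z" using cq d by simp
  finally have E: "Ent q = 2 * K * bil W q q - ln Z" .
  have le: "bil W q q \<le> Ent q" by (rule energy_entropy(1)[OF q ient iW])
  have E0: "0 \<le> Ent q" by (rule Ent_nonneg[OF q ient])
  \<comment> \<open>For negative energy it is the nonnegativity of the entropy that bounds
    \<open>2 * K * bil W q q\<close> by \<open>Ent q\<close>.\<close>
  have lnZ: "ln Z \<le> 0"
    using mult_le_of_le_one[of "2 * K" "bil W q q" "Ent q"] le E0 E K by simp
  have AEg: "AE x in LT. q x - 1 - ln (q x) = q x - 1 - (2 * K * conv W q x - ln Z)"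
    using lnq by eventually_elim simp
  have ig: "integrable LT (\<lambda>x. q x - 1 - (2 * K * conv W q x - ln Z))" using cint d by simp
  have ig': "integrable LT (\<lambda>x. q x - 1 - ln (q x))"
    using ig AEg by (subst integrable_cong_AE) auto
  have "(\<integral>x. q x - 1 - ln (q x) \<partial>LT) = (\<integral>x. q x - 1 - (2 * K * conv W q x - ln Z) \<partial>LT)"
    using AEg by (intro integral_cong_AE) auto
  also have "\<dots> = ln Z" using cint d cI by simp
  finally have I: "(\<integral>x. q x - 1 - ln (q x) \<partial>LT) \<le> 0" using lnZ by simp
  have nn: "AE x in LT. 0 \<le> q x - 1 - ln (q x)"
    using qB
  proof eventually_elim
    case (elim x)
    then show ?case using ln_le_minus_one[of "q x"] by linarith
  qed
  have "0 \<le> (\<integral>x. q x - 1 - ln (q x) \<partial>LT)" using nn by (rule integral_nonneg_AE)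
  then have "(\<integral>x. q x - 1 - ln (q x) \<partial>LT) = 0" using I by linarith
  then have "AE x in LT. q x - 1 - ln (q x) = 0" using integral_nonneg_eq_0_iff_AE[OF ig' nn] by simp
  then show ?thesis
    using qB
  proof eventually_elim
    case (elim x)
    then show ?case using ln_eq_minus_one[of "q x"] by linarith
  qed
qed

end

theorem theorem1p1:
  fixes W :: "real \<Rightarrow> real" and n :: nat
  assumes "standing_assms W"
    and "\<forall>x. W (x + 1 / real (n + 1)) = W x"
    and "2 * What W (n + 1) = 1"
    and "\<forall>k::nat. k \<ge> 1 \<longrightarrow> 2 * What W k \<le> real (n + 1) / real k"
  shows "continuous_phase_transition W 1 \<and> Ksharp W = 1
    \<and> (\<forall>K. 0 \<le> K \<and> K \<le> 1/2 \<longrightarrow>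
          critical_point W K unif \<and> (\<forall>q. critical_point W K q \<longrightarrow> (AE x in LT. q x = 1)))"
proof -
  interpret potential W
    using assms(1) by unfold_locales (auto simp: standing_assms_def)
  have usc: "limsup (\<lambda>n. energy W (\<mu>s n)) \<le> energy W \<mu>"
    if "\<And>n. \<mu>s n \<in> PT" "\<mu> \<in> PT" "weak_conv_T \<mu>s \<mu>" for \<mu>s \<mu>
    using assms(1) that unfolding standing_assms_def by blast
  obtain C where C: "0 \<le> C" "\<And>x. W x \<le> C" using bounded_above_of_usc[OF usc] by blast
  have not_dvd: "What W k = 0" if "\<not> (n + 1) dvd k" for k
    by (rule What_not_dvd_of_periodic[of "n + 1"]) (use assms(2) that in auto)
  interpret usc_potential W C "n + 1"
  proof unfold_locales
    have "(\<integral>x. W x \<partial>LT) = 0" using assms(1) by (simp add: standing_assms_def)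
    then show "What W 0 = 0" using integral_W_ech[of 0] by simp
    show "2 * What W ((n + 1) * j) \<le> 1 / real j" if "1 \<le> j" for j
    proof -
      have "2 * What W ((n + 1) * j) \<le> real (n + 1) / real ((n + 1) * j)"
        using assms(4)[rule_format, of "(n + 1) * j"] that by simp
      also have "\<dots> = 1 / real j"
        unfolding of_nat_mult by (rule nonzero_divide_mult_cancel_left) simp
      finally show ?thesis .
    qed
  qed (use C not_dvd usc assms(3) in auto)
  \<comment> \<open>Positive coefficients occur only at multiples of \<open>n + 1\<close>, where the
    hypothesis bounds them by 1/2; the value 1/2 is attained at \<open>n + 1\<close>.\<close>
  have "Sup (What W ` Iplus W) = 1 / 2"
  proof (rule cSup_eq_maximum)
    show "1 / 2 \<in> What W ` Iplus W"
      using assms(3) by (intro image_eqI[of _ _ "n + 1"]) (auto simp: Iplus_def)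
    fix y assume "y \<in> What W ` Iplus W"
    then obtain k where k: "1 \<le> k" "0 < What W k" "y = What W k" by (auto simp: Iplus_def)
    then have "(n + 1) dvd k" using not_dvd by fastforce
    then have "n + 1 \<le> k" using k(1) by (intro dvd_imp_le) auto
    then have "real (n + 1) / real k \<le> 1" using k(1) by (simp add: divide_le_eq_1)
    then have "2 * What W k \<le> 1" using assms(4)[rule_format, OF k(1)] by linarith
    then show "y \<le> 1 / 2" using k(3) by simp
  qed
  then have "Ksharp W = 1" by (simp add: Ksharp_def)
  moreover have "continuous_phase_transition W 1"
    unfolding continuous_phase_transition_def
    using phase_transition_1 unif_unique_min[of 1] minimizers_tendsto_unif by simp
  ultimately show ?thesis using critical_point_unif critical_point_unique by blast
qed

end
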